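(* The integers $\{\widetilde c_{ij}(u,v)\}_{i,j\in I,\,u,v\in\mathbb Z}$ satisfy the following properties for all $i,j\in I$: (1) $\widetilde c_{ij}(u,v)=-\widetilde c_{ij^*}(u+rh^\vee,v-h)$ for any $u\ge0$ and $v\le0$; (2) $\widetilde c_{ij}(u,v)\ge0$ if $0\le u\le rh^\vee$ and $-h\le v\le0$; (3) $\widetilde c_{ij}(rh^\vee-u,-h-v)=\widetilde c_{ij^*}(u,v)$ for any $0\le u\le rh^\vee$ and $-h\le v\le0$.
   Context: $\mathfrak g$ is a complex finite-dimensional simple Lie algebra with Cartan matrix $C=(c_{ij})_{i,j\in I}$. $r\in\{1,2,3\}$ is the lacing number ($1$ for types ADE, $2$ for B, C, F$_4$, $3$ for G$_2$). $(d_i)_{i\in I}$ is the unique tuple of mutually coprime positive integers with $d_ic_{ij}=d_jc_{ji}$ for all $i,j$. $h$ and $h^\vee$ are the Coxeter and dual Coxeter numbers, and $i\mapsto i^*$ is the involution of $I$ with $w_0(\alpha_i)=-\alpha_{i^*}$, where $w_0$ is the longest element of the Weyl group. Let $[k]_q=(q^k-q^{-k})/(q-q^{-1})$. The $(q,t)$-deformed Cartan matrix $C(q,t)$ has entries $C_{ii}(q,t)=q^{d_i}t^{-1}+q^{-d_i}t$ and $C_{ij}(q,t)=[c_{ij}]_q$ for $i\neq j$. It is invertible in $GL_I(\mathbb Z[\![q,t^{-1}]\!][(qt^{-1})^{-1}])$; its inverse is $\widetilde C(q,t)$, and $\widetilde C_{ij}(q,t)=\sum_{u,v\in\mathbb Z}\widetilde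 c_{ij}(u,v)q^ut^v$ with $\widetilde c_{ij}(u,v)\in\mathbb Z$. *)

theory Defs
  imports "HOL-Analysis.Analysis" "HOL-Computational_Algebra.Formal_Laurent_Series"
begin

text \<open>The index set of simple roots is the finite type \<open>'n\<close>, and the entry \<open>c\<^sub>i\<^sub>j\<close> is
  \<open>C $ i $ j\<close>. The Cartan matrices of the complex finite-dimensional simple Lie algebras are
  exactly the indecomposable Cartan matrices of finite type.\<close>

definition symmetrizer_of :: "int ^ 'n ^ 'n \<Rightarrow> ('n::finite \<Rightarrow> nat) \<Rightarrow> bool" where
  "symmetrizer_of C d \<longleftrightarrow>
     (\<forall>i. d i > 0) \<and> (\<forall>i j. int (d i) * C $ i $ j = int (d j) * C $ j $ i)"

definition finite_type_cartan :: "int ^ 'n ^ ('n::finite) \<Rightarrow> bool" where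
  "finite_type_cartan C \<longleftrightarrow>
     (\<forall>i. C $ i $ i = 2) \<and>
     (\<forall>i j. i \<noteq> j \<longrightarrow> C $ i $ j \<le> 0) \<and>
     (\<forall>i j. C $ i $ j = 0 \<longleftrightarrow> C $ j $ i = 0) \<and>
     (\<exists>d. symmetrizer_of C d \<and>
        (\<forall>x :: real ^ 'n. x \<noteq> 0 \<longrightarrow>
           (\<Sum>i\<in>UNIV. \<Sum>j\<in>UNIV. real (d i) * real_of_int (C $ i $ j) * x $ i * x $ j) > 0))"

definition indecomposable_cartan :: "int ^ 'n ^ ('n::finite) \<Rightarrow> bool" where
  "indecomposable_cartan C \<longleftrightarrow>
     (\<forall>J. J \<noteq> {} \<and> J \<noteq> UNIV \<longrightarrow> (\<exists>i\<in>J. \<exists>j\<in>-J. C $ i $ j \<noteq> 0))"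

definition simple_cartan :: "int ^ 'n ^ ('n::finite) \<Rightarrow> bool" where
  "simple_cartan C \<longleftrightarrow> finite_type_cartan C \<and> indecomposable_cartan C"

text \<open>The tuple \<open>(d\<^sub>i)\<close> is coprime as a whole; in type B with at least three simple roots it is
  \<open>(2, \<dots>, 2, 1)\<close>, which is not pairwise coprime.\<close>

definition dvec :: "int ^ 'n ^ 'n \<Rightarrow> 'n::finite \<Rightarrow> nat" where
  "dvec C = (THE d. symmetrizer_of C d \<and> Gcd (range d) = 1)"

text \<open>The lacing number is the largest multiplicity \<open>c\<^sub>i\<^sub>j c\<^sub>j\<^sub>i\<close> of an edge of the Dynkin diagram,
  and \<open>1\<close> if there are no edges (type A with one simple root).\<close>

definition lacing :: "int ^ 'n ^ ('n::finite) \<Rightarrow> int" where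
  "lacing C = Max (insert 1 {C $ i $ j * C $ j $ i | i j. i \<noteq> j})"

text \<open>Elements of the root lattice are written in coordinates with respect to the simple roots:
  \<open>s\<^sub>i(\<alpha>\<^sub>j) = \<alpha>\<^sub>j - c\<^sub>i\<^sub>j \<alpha>\<^sub>i\<close>.\<close>

definition simple_root :: "'n::finite \<Rightarrow> int ^ 'n" where
  "simple_root i = axis i 1"

definition simple_refl :: "int ^ 'n ^ 'n \<Rightarrow> 'n::finite \<Rightarrow> int ^ 'n \<Rightarrow> int ^ 'n" where
  "simple_refl C i x = x - axis i (\<Sum>j\<in>UNIV. C $ i $ j * x $ j)"

definition weyl_word :: "int ^ 'n ^ 'n \<Rightarrow> 'n::finite list \<Rightarrow> int ^ 'n \<Rightarrow> int ^ 'n" where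
  "weyl_word C is = foldr (\<lambda>i w. simple_refl C i \<circ> w) is id"

definition weyl_group :: "int ^ 'n ^ ('n::finite) \<Rightarrow> (int ^ 'n \<Rightarrow> int ^ 'n) set" where
  "weyl_group C = range (weyl_word C)"

definition weyl_length :: "int ^ 'n ^ ('n::finite) \<Rightarrow> (int ^ 'n \<Rightarrow> int ^ 'n) \<Rightarrow> nat" where
  "weyl_length C w = (LEAST k. \<exists>is. length is = k \<and> weyl_word C is = w)"

definition longest_elt :: "int ^ 'n ^ ('n::finite) \<Rightarrow> int ^ 'n \<Rightarrow> int ^ 'n" where
  "longest_elt C =
     (THE w. w \<in> weyl_group C \<and> (\<forall>w'\<in>weyl_group C. weyl_length C w' \<le> weyl_length C w))"

definition star_inv :: "int ^ 'n ^ 'n \<Rightarrow> 'n::finite \<Rightarrow> 'n" where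
  "star_inv C i = (THE k. longest_elt C (simple_root i) = - simple_root k)"

definition roots :: "int ^ 'n ^ ('n::finite) \<Rightarrow> (int ^ 'n) set" where
  "roots C = {w (simple_root i) | w i. w \<in> weyl_group C}"

definition highest_root :: "int ^ 'n ^ ('n::finite) \<Rightarrow> int ^ 'n" where
  "highest_root C = (THE \<theta>. \<theta> \<in> roots C \<and> (\<forall>\<beta>\<in>roots C. \<forall>i. \<beta> $ i \<le> \<theta> $ i))"

text \<open>Normalized so that \<open>(\<alpha>\<^sub>i, \<alpha>\<^sub>j) = d\<^sub>i c\<^sub>i\<^sub>j\<close>, hence \<open>(\<alpha>\<^sub>i, \<alpha>\<^sub>i) = 2 d\<^sub>i\<close>.\<close>

definition root_form :: "int ^ 'n ^ ('n::finite) \<Rightarrow> int ^ 'n \<Rightarrow> int ^ 'n \<Rightarrow> int" where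
  "root_form C x y = (\<Sum>i\<in>UNIV. \<Sum>j\<in>UNIV. int (dvec C i) * C $ i $ j * x $ i * y $ j)"

text \<open>The coefficient of \<open>\<alpha>\<^sub>i\<^sup>\<or>\<close> in the coroot \<open>\<beta>\<^sup>\<or> = 2 \<beta> / (\<beta>, \<beta>)\<close>, where
  \<open>\<alpha>\<^sub>i\<^sup>\<or> = \<alpha>\<^sub>i / d\<^sub>i\<close>. The integer division is exact for every root \<open>\<beta>\<close>.\<close>

definition coroot_coeff :: "int ^ 'n ^ 'n \<Rightarrow> int ^ 'n \<Rightarrow> 'n::finite \<Rightarrow> int" where
  "coroot_coeff C \<beta> i = (2 * int (dvec C i) * \<beta> $ i) div root_form C \<beta> \<beta>"

text \<open>\<open>h\<close> (resp. \<open>h\<^sup>\<or>\<close>) is one plus the sum of the coefficients of the highest root \<open>\<theta>\<close>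
  in the simple roots (resp. of its coroot \<open>\<theta>\<^sup>\<or>\<close> in the simple coroots).\<close>

definition coxeter_number :: "int ^ 'n ^ ('n::finite) \<Rightarrow> int" where
  "coxeter_number C = 1 + (\<Sum>i\<in>UNIV. highest_root C $ i)"

definition dual_coxeter_number :: "int ^ 'n ^ ('n::finite) \<Rightarrow> int" where
  "dual_coxeter_number C = 1 + (\<Sum>i\<in>UNIV. coroot_coeff C (highest_root C) i)"

text \<open>Series in \<open>q\<close> and \<open>t\<close> are taken in the integral domain \<open>\<int>((t\<^sup>-\<^sup>1))((q))\<close>: the outer
  Laurent variable is \<open>q\<close> and the inner one is \<open>t\<^sup>-\<^sup>1\<close>.\<close>

type_synonym qt_series = "int fls fls"

definition qpow :: "int \<Rightarrow> qt_series" where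
  "qpow k = fls_X_intpow k"

definition tpow :: "int \<Rightarrow> qt_series" where
  "tpow k = fls_const (fls_X_intpow (- k))"

definition qt_coeff :: "qt_series \<Rightarrow> int \<Rightarrow> int \<Rightarrow> int" where
  "qt_coeff F u v = fls_nth (fls_nth F u) (- v)"

text \<open>The subring \<open>\<int>[[q, t\<^sup>-\<^sup>1]][(q t\<^sup>-\<^sup>1)\<^sup>-\<^sup>1]\<close>: an element of it is \<open>(q t\<^sup>-\<^sup>1)\<^sup>-\<^sup>N\<close> times a power
  series in \<open>q\<close> and \<open>t\<^sup>-\<^sup>1\<close>.\<close>

definition qt_ring :: "qt_series set" where
  "qt_ring = {F. \<exists>N::nat. \<forall>u v. qt_coeff F u v \<noteq> 0 \<longrightarrow> u \<ge> - int N \<and> v \<le> int N}"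

text \<open>\<open>[k]\<^sub>q = (q\<^sup>k - q\<^sup>-\<^sup>k) / (q - q\<^sup>-\<^sup>1)\<close>, as a quotient in an integral domain.\<close>

definition qint :: "int \<Rightarrow> qt_series" where
  "qint k = (THE x. (qpow 1 - qpow (- 1)) * x = qpow k - qpow (- k))"

definition deformed_cartan :: "int ^ 'n ^ ('n::finite) \<Rightarrow> qt_series ^ 'n ^ 'n" where
  "deformed_cartan C = (\<chi> i j.
     if i = j then qpow (int (dvec C i)) * tpow (- 1) + qpow (- int (dvec C i)) * tpow 1
     else qint (C $ i $ j))"

definition deformed_cartan_inv :: "int ^ 'n ^ ('n::finite) \<Rightarrow> qt_series ^ 'n ^ 'n" where
  "deformed_cartan_inv C =
     (THE M. (\<forall>i j. M $ i $ j \<in> qt_ring) \<and>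
             deformed_cartan C ** M = mat 1 \<and> M ** deformed_cartan C = mat 1)"

definition ctilde :: "int ^ 'n ^ 'n \<Rightarrow> 'n::finite \<Rightarrow> 'n \<Rightarrow> int \<Rightarrow> int \<Rightarrow> int" where
  "ctilde C i j u v = qt_coeff (deformed_cartan_inv C $ i $ j) u v"

lemma qpow_add: "qpow (a + b) = qpow a * qpow b"
  by (simp add: qpow_def fls_X_intpow_times_fls_X_intpow)

lemma qpow_diff_nonzero: "qpow 1 - qpow (- 1) \<noteq> 0"
proof
  assume "qpow 1 - qpow (- 1) = 0"
  then have "fls_nth (qpow 1 - qpow (- 1)) 1 = (0 :: int fls)" by simp
  then show False by (simp add: qpow_def)
qed

lemma qint_unique:
  assumes "(qpow 1 - qpow (- 1)) * x = qpow k - qpow (- k)"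
  shows "qint k = x"
  unfolding qint_def
proof (rule the_equality)
  fix y assume "(qpow 1 - qpow (- 1)) * y = qpow k - qpow (- k)"
  with assms have "(qpow 1 - qpow (- 1)) * y = (qpow 1 - qpow (- 1)) * x" by simp
  then show "y = x" using qpow_diff_nonzero by (simp only: mult_cancel_left) simp
qed (rule assms)

lemma qint_of_nat: "qint (int n) = (\<Sum>m<n. qpow (int n - 1 - 2 * int m))"
proof (rule qint_unique)
  have "(qpow 1 - qpow (- 1)) * (\<Sum>m<n. qpow (int n - 1 - 2 * int m)) =
    (\<Sum>m<n. qpow (int n - 2 * int m) - qpow (int n - 2 * int (Suc m)))"
    by (simp only: sum_distrib_left left_diff_distrib qpow_add [symmetric])
       (simp add: algebra_simps)
  also have "\<dots> = qpow (int n) - qpow (- int n)"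
    by (subst sum_lessThan_telescope') simp
  finally show "(qpow 1 - qpow (- 1)) * (\<Sum>m<n. qpow (int n - 1 - 2 * int m)) =
    qpow (int n) - qpow (- int n)" .
qed

lemma qint_minus_of_nat: "qint (- int n) = - (\<Sum>m<n. qpow (int n - 1 - 2 * int m))"
proof (rule qint_unique)
  have "(qpow 1 - qpow (- 1)) * (\<Sum>m<n. qpow (int n - 1 - 2 * int m)) =
    (\<Sum>m<n. qpow (int n - 2 * int m) - qpow (int n - 2 * int (Suc m)))"
    by (simp only: sum_distrib_left left_diff_distrib qpow_add [symmetric])
       (simp add: algebra_simps)
  also have "\<dots> = qpow (int n) - qpow (- int n)"
    by (subst sum_lessThan_telescope') simp
  finally show "(qpow 1 - qpow (- 1)) * - (\<Sum>m<n. qpow (int n - 1 - 2 * int m)) =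
    qpow (- int n) - qpow (- (- int n))" by simp
qed

end

theory Submission
  imports Defs
begin

text \<open>The braid group acts on vectors over the Laurent polynomials in \<open>q, t\<close> by
  \<open>T\<^sub>i \<alpha>\<^sub>j = \<alpha>\<^sub>j - q\<^bsup>-d\<^sub>i\<^esup> t C\<^sub>i\<^sub>j(q,t) \<alpha>\<^sub>i\<close>, a deformation of the reflection action of the Weyl group.
  As for roots, \<open>T\<^sub>w \<alpha>\<^sub>i\<close> has nonnegative coefficients whenever \<open>w s\<^sub>i\<close> is longer than \<open>w\<close>. For the
  longest element one finds \<open>T\<^sub>w\<^sub>0 \<alpha>\<^sub>i = - \<mu>\<^sup>-\<^sup>1 \<alpha>\<^sub>i\<^sub>*\<close> with \<open>\<mu> = q\<^bsup>r h\<^sup>\<or>\<^esup> t\<^bsup>-h\<^esup>\<close>: positivity and the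
  determinant show that the scalar is a monomial, and its exponents come from
  \<open>2 \<ell>(w\<^sub>0) = n h\<close> and \<open>\<Sum>\<^sub>\<beta>\<^sub>>\<^sub>0 (\<beta>,\<beta>) = n r h\<^sup>\<or>\<close>, with \<open>n\<close> the rank. Telescoping \<open>1 - T\<^sub>w\<^sub>0\<close> along a reduced word gives
  \<open>N C(q,t) = 1 + \<mu>\<^sup>-\<^sup>1 P\<close>, where \<open>P\<close> is the permutation matrix of \<open>*\<close> and \<open>N\<close> has nonnegative coefficients
  in monomials \<open>q\<^sup>u t\<^sup>v\<close> with \<open>u < 0 < v\<close>. Hence \<open>N = (1 + \<mu>\<^sup>-\<^sup>1 P) C(q,t)\<^sup>-\<^sup>1\<close>, and also
  \<open>N' = (1 + \<mu> P) C(q,t)\<^sup>-\<^sup>1\<close> for the image \<open>N'\<close> of \<open>N\<close> under \<open>q, t \<mapsto> q\<^sup>-\<^sup>1, t\<^sup>-\<^sup>1\<close>. As the inverse is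
  supported on \<open>u > 0 > v\<close>, comparing coefficients proves the three claims.\<close>

section \<open>Pseudo-reflections\<close>

text \<open>The deformed reflections are not involutions, so an element of the Weyl group determines
  an operator only through its reduced words, and only after Matsumoto's theorem. That theorem in
  turn rests on the sign of roots under the integral action. To avoid a circle and a duplication,
  the rank-two computations and the positivity induction are stated for a matrix \<open>A\<close>
  over any integral domain: first they serve the integral Cartan matrix, which yields Matsumoto's
  theorem, then the deformed one.

  Two more gaps have to be bridged. The Coxeter numbers are defined by the highest root, whereas the
  determinant of the longest element only sees the letters of a reduced word; a trace computation
  over the positive roots links the two. And \<open>C(q,t)\<close> is not known to be invertible
  beforehand: its inverse is built from \<open>N'\<close>, because the powers of \<mu> go to higher
  and higher powers of \<open>q\<close>, which suits series bounded below in
  \<open>q\<close>.\<close>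

definition pform :: "('n::finite \<Rightarrow> 'n \<Rightarrow> 'a::idom) \<Rightarrow> 'n \<Rightarrow> 'a ^ 'n \<Rightarrow> 'a" where
  "pform A i x = (\<Sum>j\<in>UNIV. A i j * x $ j)"

text \<open>Fixes the kernel of \<open>pform A i\<close> and scales \<open>axis i 1\<close> by
  \<open>1 - A i i\<close>: a reflection when \<open>A i i = 2\<close>, but not of order two for the
  deformed matrix.\<close>

definition prefl :: "('n::finite \<Rightarrow> 'n \<Rightarrow> 'a::idom) \<Rightarrow> 'n \<Rightarrow> 'a ^ 'n \<Rightarrow> 'a ^ 'n" where
  "prefl A i x = x - axis i (pform A i x)"

definition pword :: "('n::finite \<Rightarrow> 'n \<Rightarrow> 'a::idom) \<Rightarrow> 'n list \<Rightarrow> 'a ^ 'n \<Rightarrow> 'a ^ 'n" where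
  "pword A is = foldr (\<lambda>i f. prefl A i \<circ> f) is id"

lemma pword_Nil [simp]: "pword A [] x = x"
  by (simp add: pword_def)

lemma pword_Cons: "pword A (i # is) x = prefl A i (pword A is x)"
  by (simp add: pword_def)

lemma pword_append: "pword A (a @ b) x = pword A a (pword A b x)"
  by (induction a) (simp_all add: pword_Cons)

lemma pword_snoc: "pword A (a @ [i]) x = pword A a (prefl A i x)"
  by (simp add: pword_append pword_Cons)

lemma pform_add: "pform A i (x + y) = pform A i x + pform A i y"
  by (simp add: pform_def algebra_simps sum.distrib)

lemma pform_diff: "pform A i (x - y) = pform A i x - pform A i y"
  by (simp add: pform_def algebra_simps sum_subtractf)

lemma pform_smult: "pform A i (c *s x) = c * pform A i x"
  by (simp add: pform_def algebra_simps sum_distrib_left)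

lemma pform_axis: "pform A i (axis j c) = A i j * c"
  by (simp add: pform_def axis_def if_distrib [where f = "\<lambda>x. _ * x"] cong: if_cong)

lemma axis_zero [simp]: "axis i 0 = 0"
  by (simp add: axis_def vec_eq_iff)

lemma axis_add: "axis i (a + b) = axis i a + (axis i b :: 'a::ab_group_add ^ 'n)"
  and axis_diff: "axis i (a - b) = axis i a - (axis i b :: 'a::ab_group_add ^ 'n)"
  and axis_minus: "axis i (- a) = - (axis i a :: 'a::ab_group_add ^ 'n)"
  by (auto simp: axis_def vec_eq_iff)

lemma axis_smult: "c *s axis i a = axis i (c * a :: 'a::comm_ring_1)"
  by (auto simp: axis_def vec_eq_iff)

lemma prefl_add: "prefl A i (x + y) = prefl A i x + prefl A i y"
  by (simp add: prefl_def pform_add axis_add)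

lemma prefl_smult: "prefl A i (c *s x) = c *s prefl A i x"
  by (simp add: prefl_def pform_smult vec.scale_right_diff_distrib axis_smult)

lemma pword_add: "pword A a (x + y) = pword A a x + pword A a y"
  by (induction a) (simp_all add: pword_Cons prefl_add)

lemma pword_smult: "pword A a (c *s x) = c *s pword A a x"
  by (induction a) (simp_all add: pword_Cons prefl_smult)

lemma pword_minus: "pword A a (- x) = - pword A a x"
proof -
  have m: "- z = (- 1) *s z" for z :: "'a ^ 'n" by (simp add: vec_eq_iff)
  show ?thesis unfolding m [of x] m [of "pword A a x"] by (rule pword_smult)
qed

lemma pword_diff: "pword A a (x - y) = pword A a x - pword A a y"
  using pword_add [of A a x "- y"] by (simp add: pword_minus)

lemma pword_zero [simp]: "pword A a 0 = 0"
  using pword_smult [of A a 0 0] by simp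

lemma pword_sum: "pword A a (\<Sum>k\<in>K. f k) = (\<Sum>k\<in>K. pword A a (f k))"
  by (induction K rule: infinite_finite_induct) (simp_all add: pword_add)

lemma pword_axis: "pword A a (axis i c) = c *s pword A a (axis i 1)"
  using pword_smult [of A a c "axis i 1"] by (simp add: axis_smult)

lemma vec_eq_sum_axis: "x = (\<Sum>k\<in>UNIV. axis k (x $ k) :: 'a::ab_group_add ^ 'n::finite)"
  by (simp add: vec_eq_iff axis_def)

lemma pword_expand: "pword A a x $ k = (\<Sum>i\<in>UNIV. x $ i * pword A a (axis i 1) $ k)"
proof -
  have "pword A a x = (\<Sum>i\<in>UNIV. x $ i *s pword A a (axis i 1))"
    by (subst vec_eq_sum_axis [of x]) (simp add: pword_sum pword_axis [of A a _ "x $ _"])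
  then show ?thesis by simp
qed

lemma pword_ext_axis:
  assumes "\<And>i. pword A a (axis i 1) = pword B b (axis i 1)"
  shows "pword A a = pword B b"
proof
  fix x
  show "pword A a x = pword B b x"
    by (simp add: vec_eq_iff pword_expand [of A a x] pword_expand [of B b x] assms)
qed

section \<open>Rank two: braid relations and positivity\<close>

lemma prefl_span:
  "prefl A i (y - axis i p - axis j q)
     = y - axis i (pform A i y + p - A i i * p - A i j * q) - axis j q"
  unfolding prefl_def pform_diff pform_axis axis_add axis_diff by simp

text \<open>The letters \<open>i\<close> and \<open>j\<close> move a vector only inside the plane of
  the two axes. In the normal form \<open>y - axis i p - axis j q\<close> a braid relation becomes
  two scalar identities.\<close>

lemma prefl_span':
  "prefl A j (y - axis i p - axis j q)
     = y - axis i p - axis j (pform A j y + q - A j i * p - A j j * q)"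
  unfolding prefl_def pform_diff pform_axis axis_add axis_diff by simp

text \<open>Letters are appended on the right, so for \<open>k > 0\<close> the word
  \<open>alt i j k\<close> ends in \<open>i\<close>, the letter that acts first, whatever the parity
  of \<open>k\<close>.\<close>

fun alt :: "'n \<Rightarrow> 'n \<Rightarrow> nat \<Rightarrow> 'n list" where
  "alt i j 0 = []"
| "alt i j (Suc k) = alt j i k @ [i]"

lemma length_alt [simp]: "length (alt i j k) = k"
  by (induction k arbitrary: i j) simp_all

lemma alt_add: "\<exists>y. alt i j (k + m) = y @ alt i j m"
  by (induction m arbitrary: i j) auto

text \<open>With \<open>u = A\<^sub>i\<^sub>i - 1\<close>, \<open>w = A\<^sub>j\<^sub>j - 1\<close>, \<open>x = A\<^sub>i\<^sub>j\<close> and \<open>y = A\<^sub>j\<^sub>i\<close>, the pseudo-reflections have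
  eigenvalues \<open>1\<close>, \<open>-u\<close> and \<open>1\<close>, \<open>-w\<close>, and the product \<open>x y\<close> governs the order of the braid relation;
  for \<open>u = w = 1\<close> the listed values of \<open>x y\<close> are \<open>0, 1, 2, 3\<close>.\<close>

definition rank2 :: "('n::finite \<Rightarrow> 'n \<Rightarrow> 'a::idom) \<Rightarrow> 'n \<Rightarrow> 'n \<Rightarrow> 'a \<Rightarrow> nat \<Rightarrow> bool" where
  "rank2 A i j s m \<longleftrightarrow>
     (let u = A i i - 1; w = A j j - 1; x = A i j; y = A j i in
       m = 2 \<and> x = 0 \<and> y = 0 \<or>
       m = 3 \<and> u = x * y \<and> w = x * y \<or>
       m = 4 \<and> x * y = u + w \<or>
       m = 6 \<and> x * y = u + w + s \<and> s ^ 2 = u * w)"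

lemma rank2_braid:
  assumes "rank2 A i j s m"
  shows "pword A (alt i j m) v = pword A (alt j i m) v"
proof -
  define u w x y where defs: "u = A i i - 1" "w = A j j - 1" "x = A i j" "y = A j i"
  define X Y where XY: "X = pform A i v" "Y = pform A j v"
  have A: "A i i = 1 + u" "A j j = 1 + w" "A i j = x" "A j i = y" by (simp_all add: defs)
  have v: "v = v - axis i 0 - axis j 0" by simp
  note steps = pword_append pword_Cons prefl_span prefl_span' A XY [symmetric]
  have *: "a1 = a2 \<Longrightarrow> b1 = b2 \<Longrightarrow> v - axis i a1 - axis j b1 = v - axis i a2 - axis j b2"
    for a1 a2 b1 b2 by simp
  consider "m = 2" "x = 0" "y = 0" | "m = 3" "u = x * y" "w = x * y"
    | "m = 4" "x * y = u + w" | "m = 6" "x * y = u + w + s" "s ^ 2 = u * w"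
    using assms by (auto simp: rank2_def Let_def defs)
  then show ?thesis
  proof cases
    case 1
    have "alt i j m = [j, i]" "alt j i m = [i, j]"
      by (simp_all add: 1 eval_nat_numeral)
    then show ?thesis
      by (simp only:, subst (1 2) v, simp only: steps pword_Nil 1, simp)
  next
    case 2
    have "alt i j m = [i, j, i]" "alt j i m = [j, i, j]"
      by (simp_all add: 2 eval_nat_numeral)
    then show ?thesis
      by (simp only:, subst (1 2) v, simp only: steps pword_Nil, intro *)
        (simp_all add: 2 algebra_simps)
  next
    case 3
    have w: "w = x * y - u" using 3 by simp
    have "alt i j m = [j, i, j, i]" "alt j i m = [i, j, i, j]"
      by (simp_all add: 3 eval_nat_numeral)
    then show ?thesis
      by (simp only:, subst (1 2) v, simp only: steps pword_Nil, intro *)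
        (simp_all add: w algebra_simps)
  next
    case 4
    \<comment> \<open>Eliminating \<open>s\<close> leaves the single relation
      \<open>(x y - u - w)^2 = u w\<close>. The two sides of each identity differ by a multiple of
      it, with cofactors \<open>x Y\<close> and \<open>- y X\<close>.\<close>
    have eqI: "a = b" if "a - b = c * ((x * y - u - w)\<^sup>2 - u * w)" for a b c
    proof -
      have "x * y - u - w = s" using 4 by simp
      then show ?thesis using that 4 by simp
    qed
    have "alt i j m = [j, i, j, i, j, i]" "alt j i m = [i, j, i, j, i, j]"
      by (simp_all add: 4 eval_nat_numeral)
    then show ?thesis
      apply (simp only:, subst (1 2) v, simp only: steps pword_Nil, intro *)
      subgoal by (rule eqI [where c = "x * Y"]) (simp add: algebra_simps power2_eq_square)
      subgoal by (rule eqI [where c = "- (y * X)"]) (simp add: algebra_simps power2_eq_square)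
      done
  qed
qed

text \<open>\<open>S\<close> holds the coefficients that count as nonnegative. The vectors are the
  deformed positive roots of rank two: as \<open>k < m\<close>, the word
  \<open>alt j i k @ [i]\<close> alternates with length at most \<open>m\<close>. The relations in
  \<open>rank2\<close> rewrite each difference that arises, such as \<open>x * y - u\<close>,
  without subtraction.\<close>

lemma rank2_positive:
  assumes r2: "rank2 A i j s m" and "k < m" and "i \<noteq> j"
    and S: "0 \<in> S" "1 \<in> S" "s \<in> S" "- A i j \<in> S" "- A j i \<in> S" "A i i - 1 \<in> S" "A j j - 1 \<in> S"
    and mult: "\<And>a b. a \<in> S \<Longrightarrow> b \<in> S \<Longrightarrow> a * b \<in> S"
    and add: "\<And>a b. a \<in> S \<Longrightarrow> b \<in> S \<Longrightarrow> a + b \<in> S"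
  shows "\<exists>p\<in>S. \<exists>q\<in>S. pword A (alt j i k) (axis i 1) = axis i p + axis j q"
proof -
  define u w x y where defs: "u = A i i - 1" "w = A j j - 1" "x = - A i j" "y = - A j i"
  have A: "A i i = 1 + u" "A j j = 1 + w" "A i j = - x" "A j i = - y" by (simp_all add: defs)
  have inS: "u \<in> S" "w \<in> S" "x \<in> S" "y \<in> S" using S by (simp_all add: defs)
  have ri: "prefl A i (axis i p + axis j q) = axis i (x * q - u * p) + axis j q" for p q
    unfolding prefl_def pform_add pform_axis A by (simp add: algebra_simps flip: axis_add axis_diff)
  have rj: "prefl A j (axis i p + axis j q) = axis i p + axis j (y * p - w * q)" for p q
    unfolding prefl_def pform_add pform_axis A by (simp add: algebra_simps flip: axis_add axis_diff)
  let ?T = "\<lambda>k. pword A (alt j i k) (axis i 1)"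
  have fin: "k = k' \<Longrightarrow> ?T k' = axis i p + axis j q \<Longrightarrow> p \<in> S \<Longrightarrow> q \<in> S \<Longrightarrow> ?thesis" for k' p q
    by blast
  have 0: "?T 0 = axis i 1 + axis j 0" by simp
  have "?T (Suc 0) = prefl A j (axis i 1 + axis j 0)" by (simp add: pword_Cons)
  then have one: "?T 1 = axis i 1 + axis j y" unfolding rj by simp
  have 2: "?T 2 = prefl A i (?T 1)" and 3: "?T 3 = prefl A j (?T 2)"
    and 4: "?T 4 = prefl A i (?T 3)" and 5: "?T 5 = prefl A j (?T 4)"
    by (simp_all add: eval_nat_numeral pword_Cons pword_append)
  consider "m = 2" "x = 0" "y = 0" | "m = 3" "u = x * y" "w = x * y"
    | "m = 4" "x * y = u + w" | "m = 6" "x * y = u + w + s" "s ^ 2 = u * w"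
    using r2 by (auto simp: rank2_def Let_def defs)
  then show ?thesis
  proof cases
    case 1
    then have "k = 0 \<or> k = 1" using \<open>k < m\<close> by auto
    then show ?thesis
      by (elim disjE) (erule fin, rule 0 one, simp add: S inS, simp add: S inS)+
  next
    case h: 2
    have t2: "?T 2 = axis i 0 + axis j y"
      unfolding 2 one ri by (simp add: h)
    have "k = 0 \<or> k = 1 \<or> k = 2" using \<open>k < m\<close> h by auto
    then show ?thesis
      by (elim disjE) (erule fin, rule 0 one t2, simp add: S inS, simp add: S inS)+
  next
    case h: 3
    have t2: "?T 2 = axis i w + axis j y"
      unfolding 2 one ri by (simp add: h)
    have t3: "?T 3 = axis i w + axis j 0"
      unfolding 3 t2 rj by (simp add: algebra_simps)
    have "k = 0 \<or> k = 1 \<or> k = 2 \<or> k = 3" using \<open>k < m\<close> h by auto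
    then show ?thesis
      by (elim disjE) (erule fin, rule 0 one t2 t3, simp add: S inS, simp add: S inS)+
  next
    case h: 4
    have "x * y - u = w + s" using h by simp
    then have t2: "?T 2 = axis i (w + s) + axis j y"
      unfolding 2 one ri by simp
    have t3: "?T 3 = axis i (w + s) + axis j (y * s)"
      unfolding 3 t2 rj by (simp add: algebra_simps)
    have "x * (y * s) - u * (w + s) = w * s"
      using h(2,3) by algebra
    then have t4: "?T 4 = axis i (w * s) + axis j (y * s)"
      unfolding 4 t3 ri by simp
    have t5: "?T 5 = axis i (w * s) + axis j 0"
      unfolding 5 t4 rj by (simp add: algebra_simps)
    have k: "k = 0 \<or> k = 1 \<or> k = 2 \<or> k = 3 \<or> k = 4 \<or> k = 5" using \<open>k < m\<close> h by auto
    have mem: "w + s \<in> S" "w * s \<in> S" "y * s \<in> S" using inS S mult add by blast+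
    from k show ?thesis
      by (elim disjE) (erule fin, rule 0 one t2 t3 t4 t5, simp add: S inS mem, simp add: S inS mem)+
  qed
qed

section \<open>The Weyl group\<close>

locale simple_cartan_matrix =
  fixes C :: "int ^ 'n ^ ('n::finite)"
  assumes simple: "simple_cartan C"
begin

abbreviation cc :: "'n \<Rightarrow> 'n \<Rightarrow> int" where "cc i j \<equiv> C $ i $ j"
abbreviation W :: "'n list \<Rightarrow> int ^ 'n \<Rightarrow> int ^ 'n" where "W \<equiv> pword cc"
abbreviation \<alpha> :: "'n \<Rightarrow> int ^ 'n" where "\<alpha> i \<equiv> axis i 1"
abbreviation d :: "'n \<Rightarrow> nat" where "d \<equiv> dvec C"
abbreviation B :: "int ^ 'n \<Rightarrow> int ^ 'n \<Rightarrow> int" where "B \<equiv> root_form C"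

lemma cc_diag [simp]: "cc i i = 2"
  and cc_offdiag: "i \<noteq> j \<Longrightarrow> cc i j \<le> 0"
  and cc_zero_iff: "cc i j = 0 \<longleftrightarrow> cc j i = 0"
  using simple by (auto simp: simple_cartan_def finite_type_cartan_def)

text \<open>If \<open>P\<close>, which spreads along the edges of the Dynkin diagram, failed
  somewhere, the set where it holds would disconnect the diagram.\<close>

lemma connected_induct:
  assumes "P i" and "\<And>i j. P i \<Longrightarrow> cc i j \<noteq> 0 \<Longrightarrow> P j"
  shows "P k"
proof (rule ccontr)
  assume "\<not> P k"
  then have "{i. P i} \<noteq> {} \<and> {i. P i} \<noteq> UNIV" using assms(1) by auto
  moreover have "\<forall>J. J \<noteq> {} \<and> J \<noteq> UNIV \<longrightarrow> (\<exists>i\<in>J. \<exists>j\<in>- J. cc i j \<noteq> 0)"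
    using simple by (simp add: simple_cartan_def indecomposable_cartan_def)
  note this [THEN spec, of "{i. P i}"]
  ultimately have "\<exists>i\<in>{i. P i}. \<exists>j\<in>- {i. P i}. cc i j \<noteq> 0" by simp
  then obtain i j where "P i" "\<not> P j" "cc i j \<noteq> 0" by auto
  then show False using assms(2) by blast
qed

text \<open>Across an edge both Cartan entries are nonzero and fix the ratio of neighbouring values;
  connectedness does the rest.\<close>

lemma symmetrizer_proportional:
  assumes "symmetrizer_of C e" "symmetrizer_of C e'"
  shows "e i * e' j = e j * e' i"
proof (rule connected_induct [of "\<lambda>j. e i * e' j = e j * e' i" i])
  fix j k assume IH: "e i * e' j = e j * e' i" and nz: "cc j k \<noteq> 0"
  have 1: "int (e j) * cc j k = int (e k) * cc k j"
    and 2: "int (e' j) * cc j k = int (e' k) * cc k j" and pos: "e j > 0" "e' j > 0"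
    using assms by (auto simp: symmetrizer_of_def)
  have IH': "int (e i) * int (e' j) = int (e j) * int (e' i)"
    using IH by (metis of_nat_mult)
  have "(int (e i) * int (e' k)) * (cc k j * int (e j)) = (int (e k) * int (e' i)) * (cc k j * int (e j))"
    using 1 2 IH' by algebra
  moreover have "cc k j * int (e j) \<noteq> 0" using nz cc_zero_iff pos by auto
  ultimately have "int (e i) * int (e' k) = int (e k) * int (e' i)" by simp
  then show "e i * e' k = e k * e' i" by (metis of_nat_mult of_nat_eq_iff)
qed simp

lemma symmetrizer_unique:
  assumes "symmetrizer_of C e" "symmetrizer_of C e'" "Gcd (range e) = 1" "Gcd (range e') = 1"
  shows "e = e'"
proof
  fix i
  have *: "Gcd (range (\<lambda>j. k * f j)) = k * Gcd (range f)" for f :: "'n \<Rightarrow> nat" and k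
    using Gcd_mult [of k "range f"] by (simp add: image_image)
  have "e i = Gcd (range (\<lambda>j. e i * e' j))" using assms * by simp
  also have "\<dots> = Gcd (range (\<lambda>j. e' i * e j))"
    by (simp add: symmetrizer_proportional [OF assms(1,2), of i] mult.commute)
  also have "\<dots> = e' i" using assms * by simp
  finally show "e i = e' i" .
qed

text \<open>Justifies the \<open>THE\<close> in \<open>dvec\<close>: dividing a symmetrizer by its
  gcd makes it coprime, and positive definiteness survives the scaling.\<close>

lemma symmetrizer_d: "symmetrizer_of C d" and Gcd_d: "Gcd (range d) = 1"
  and d_posdef: "x \<noteq> 0 \<Longrightarrow>
    (\<Sum>i\<in>UNIV. \<Sum>j\<in>UNIV. real (d i) * real_of_int (cc i j) * x $ i * x $ j) > 0"
proof -
  obtain e where e: "symmetrizer_of C e" and pd: "\<And>x :: real ^ 'n. x \<noteq> 0 \<Longrightarrow>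
    (\<Sum>i\<in>UNIV. \<Sum>j\<in>UNIV. real (e i) * real_of_int (cc i j) * x $ i * x $ j) > 0"
    using simple by (auto simp: simple_cartan_def finite_type_cartan_def)
  define g where "g = Gcd (range e)"
  define e' where "e' = (\<lambda>i. e i div g)"
  have epos: "e i > 0" for i using e by (simp add: symmetrizer_of_def)
  have dvd: "g dvd e i" for i by (simp add: g_def)
  have ee': "e i = g * e' i" for i using dvd by (simp add: e'_def)
  have g: "g > 0" using epos ee' by (metis gr0I mult_0 less_irrefl)
  have "range e = (*) g ` range e'" using ee' by auto
  then have "g = g * Gcd (range e')"
    using Gcd_mult [of g "range e'"] by (simp add: g_def)
  then have gcd: "Gcd (range e') = 1" using g by simp
  have sym: "symmetrizer_of C e'"
    using e g unfolding symmetrizer_of_def ee' by (auto simp: mult.assoc)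
  have "symmetrizer_of C d \<and> Gcd (range d) = 1"
    unfolding dvec_def
    by (rule theI [where a = e']) (use gcd sym symmetrizer_unique in auto)
  then show sd: "symmetrizer_of C d" and gd: "Gcd (range d) = 1" by auto
  have d: "d = e'" using symmetrizer_unique sd gd sym gcd by blast
  assume "x \<noteq> 0"
  from pd [OF this] have "real g *
    (\<Sum>i\<in>UNIV. \<Sum>j\<in>UNIV. real (d i) * real_of_int (cc i j) * x $ i * x $ j) > 0"
    by (simp add: d ee' sum_distrib_left mult.assoc)
  then show "(\<Sum>i\<in>UNIV. \<Sum>j\<in>UNIV. real (d i) * real_of_int (cc i j) * x $ i * x $ j) > 0"
    using g by (simp add: zero_less_mult_iff)
qed

lemma d_pos [simp]: "d i > 0"
  and d_sym: "int (d i) * cc i j = int (d j) * cc j i"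
  using symmetrizer_d by (auto simp: symmetrizer_of_def)

lemma form_pos: "x \<noteq> 0 \<Longrightarrow> B x x > 0"
proof -
  assume "x \<noteq> 0"
  then have "(\<chi> i. real_of_int (x $ i)) \<noteq> 0" by (auto simp: vec_eq_iff)
  from d_posdef [OF this] have "real_of_int (B x x) > 0"
    by (simp add: root_form_def)
  then show ?thesis by simp
qed

lemma form_eq_pform: "B x y = (\<Sum>i\<in>UNIV. int (d i) * x $ i * pform cc i y)"
  by (simp add: root_form_def pform_def sum_distrib_left algebra_simps)

lemma form_axis: "B (axis i a) y = a * int (d i) * pform cc i y"
  by (simp add: form_eq_pform axis_def if_distrib [where f = "\<lambda>x. x * _"]
      if_distrib [where f = "\<lambda>x. _ * x"] cong: if_cong)

lemma form_sym: "B x y = B y x"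
proof -
  have "int (d i) * cc i j * x $ i * y $ j = int (d j) * cc j i * y $ j * x $ i" for i j
  proof -
    have "(int (d i) * cc i j) * (x $ i * y $ j) = (int (d j) * cc j i) * (x $ i * y $ j)"
      by (simp only: d_sym)
    then show ?thesis by (simp only: mult_ac)
  qed
  then have "B x y = (\<Sum>i\<in>UNIV. \<Sum>j\<in>UNIV. int (d j) * cc j i * y $ j * x $ i)"
    unfolding root_form_def by (intro sum.cong HOL.refl)
  also have "\<dots> = B y x" by (subst sum.swap) (simp add: root_form_def)
  finally show ?thesis .
qed

lemma form_add: "B x (y + z) = B x y + B x z"
  and form_diff: "B x (y - z) = B x y - B x z"
  and form_smult: "B x (c *s y) = c * B x y"
  by (simp_all add: form_eq_pform pform_add pform_diff pform_smult algebra_simps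
      sum.distrib sum_subtractf sum_distrib_left)

lemma form_add': "B (y + z) x = B y x + B z x"
  and form_diff': "B (y - z) x = B y x - B z x"
  and form_smult': "B (c *s y) x = c * B y x"
  by (simp_all add: form_sym [of _ x] form_add form_diff form_smult)

lemma form_minus: "B x (- y) = - B x y" and form_minus': "B (- y) x = - B y x"
  using form_diff [of x 0 y] form_diff' [of 0 y x] by (simp_all add: root_form_def)

lemma form_simple [simp]: "B (\<alpha> i) (\<alpha> i) = 2 * int (d i)"
  by (simp add: form_axis pform_axis)

lemma form_prefl: "B (prefl cc i x) (prefl cc i y) = B x y"
  unfolding prefl_def form_diff form_diff' form_axis pform_diff pform_axis
  using form_axis [of i "pform cc i y" x]
  by (simp add: form_sym [of x "axis i _"] algebra_simps)

lemma form_W: "B (W a x) (W a y) = B x y"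
  by (induction a) (simp_all add: pword_Cons form_prefl)

lemma prefl_prefl [simp]: "prefl cc i (prefl cc i x) = x"
  unfolding prefl_def pform_diff pform_axis by (simp add: vec_eq_iff axis_def)

lemma W_rev [simp]: "W (rev a) (W a x) = x" "W a (W (rev a) x) = x"
  by (induction a arbitrary: x) (simp_all add: pword_append pword_Cons)

lemma W_inj: "W a x = W a y \<Longrightarrow> x = y"
  by (metis W_rev(1))

lemma prefl_simple: "prefl cc i (\<alpha> i) = - \<alpha> i"
  unfolding prefl_def pform_axis by (simp add: vec_eq_iff axis_def)

lemma simple_nonzero: "\<alpha> i \<noteq> 0"
  by (simp add: axis_eq_0_iff)

lemma W_simple_nonzero: "W a (\<alpha> i) \<noteq> 0"
  using W_inj [of a "\<alpha> i" 0] simple_nonzero by auto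

lemma weyl_word_eq: "weyl_word C = W"
proof -
  have *: "simple_refl C i = prefl cc i" for i
    by (rule ext) (simp add: simple_refl_def prefl_def pform_def)
  show ?thesis by (rule ext) (simp only: weyl_word_def pword_def *)
qed

subsection \<open>Rank two\<close>

lemma cc_mult_less: "i \<noteq> j \<Longrightarrow> cc i j * cc j i < 4"
proof -
  assume "i \<noteq> j"
  \<comment> \<open>Twice the projection of \<open>\<alpha> j\<close> orthogonal to
    \<open>\<alpha> i\<close>; the form takes the value
    \<open>2 d\<^sub>j (4 - c\<^sub>i\<^sub>j c\<^sub>j\<^sub>i)\<close> on it.\<close>
  let ?x = "axis i (- cc i j) + axis j 2"
  have "?x $ j = 2" using \<open>i \<noteq> j\<close> by (simp add: axis_def)
  then have "?x \<noteq> 0" by (metis zero_index zero_neq_numeral)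
  from form_pos [OF this] have "int (d j) * (cc j i * cc i j) < int (d j) * 4"
    using d_sym [of i j]
    by (simp add: form_add form_add' form_axis pform_axis algebra_simps)
  then show ?thesis by (simp add: mult.commute)
qed

text \<open>The Coxeter matrix. For distinct \<open>i\<close>, \<open>j\<close>,
  \<open>rank2_cc\<close> and \<open>rank2_AA\<close> show that this length governs the braid
  relation of both actions.\<close>

definition m :: "'n \<Rightarrow> 'n \<Rightarrow> nat" where
  "m i j = (if cc i j * cc j i = 0 then 2 else if cc i j * cc j i = 1 then 3
    else if cc i j * cc j i = 2 then 4 else 6)"

lemma m_sym: "m i j = m j i"
  by (simp add: m_def mult.commute)

lemma m_pos: "m i j > 0"
  by (simp add: m_def)

lemma cc_mult_cases:
  assumes "i \<noteq> j"
  obtains "cc i j = 0" "cc j i = 0" "m i j = 2"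
  | "cc i j * cc j i = 1" "m i j = 3"
  | "cc i j * cc j i = 2" "m i j = 4"
  | "cc i j * cc j i = 3" "m i j = 6"
proof -
  have "cc i j * cc j i \<ge> 0" using assms cc_offdiag by (simp add: mult_nonpos_nonpos)
  with cc_mult_less [OF assms]
  have "cc i j * cc j i = 0 \<or> cc i j * cc j i = 1 \<or> cc i j * cc j i = 2 \<or> cc i j * cc j i = 3"
    by linarith
  then show ?thesis using that cc_zero_iff by (auto simp: m_def)
qed

lemma rank2_cc: "i \<noteq> j \<Longrightarrow> rank2 cc i j 1 (m i j)"
  by (erule cc_mult_cases) (auto simp: rank2_def Let_def)

subsection \<open>Lengths and reduced words\<close>

definition len :: "'n list \<Rightarrow> nat" where
  "len a = weyl_length C (W a)"

definition red :: "'n list \<Rightarrow> bool" where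
  "red a \<longleftrightarrow> length a = len a"

definition nonneg :: "int ^ 'n \<Rightarrow> bool" where
  "nonneg x \<longleftrightarrow> (\<forall>k. x $ k \<ge> 0)"

lemma len_le: "W b = W a \<Longrightarrow> len a \<le> length b"
  unfolding len_def weyl_length_def weyl_word_eq by (rule Least_le) auto

lemma len_cong: "W a = W b \<Longrightarrow> len a = len b"
  by (simp add: len_def)

lemma ex_red: "\<exists>b. W b = W a \<and> length b = len a \<and> red b"
proof -
  have "\<exists>b. length b = len a \<and> W b = W a"
    unfolding len_def weyl_length_def weyl_word_eq by (rule LeastI_ex) auto
  then show ?thesis using len_cong unfolding red_def by metis
qed

lemma red_cong: "W a = W b \<Longrightarrow> length a = length b \<Longrightarrow> red a \<Longrightarrow> red b"
  using len_cong [of a b] by (simp add: red_def)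

lemma red_length: "red a \<Longrightarrow> red b \<Longrightarrow> W a = W b \<Longrightarrow> length a = length b"
  using len_cong [of a b] by (simp add: red_def)

lemma W_append_cong: "W a = W a' \<Longrightarrow> W b = W b' \<Longrightarrow> W (a @ b) = W (a' @ b')"
  by (simp add: fun_eq_iff pword_append)

lemma W_double [simp]: "W (a @ i # i # b) = W (a @ b)"
  by (simp add: fun_eq_iff pword_append pword_Cons)

lemma len_append: "len (a @ b) \<le> len a + len b"
proof -
  obtain a' where "W a' = W a" "length a' = len a" using ex_red by blast
  moreover obtain b' where "W b' = W b" "length b' = len b" using ex_red by blast
  ultimately show ?thesis using len_le [OF W_append_cong, of a' a b' b] by simp
qed

lemma len_le_length: "len a \<le> length a"
  by (rule len_le) simp

lemma red_appendD: "red (a @ b) \<Longrightarrow> red a" "red (a @ b) \<Longrightarrow> red b"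
  using len_append [of a b] len_le_length [of a] len_le_length [of b] by (auto simp: red_def)

lemma red_not_double: "\<not> red (a @ [i, i])"
  using len_le_length [of a] len_cong [of "a @ [i, i]" a] W_double [of a i "[]"]
  by (auto simp: red_def)

lemma len_snoc_snoc: "len (a @ [i, i]) = len a"
  using W_double [of a i "[]"] by (intro len_cong) simp

text \<open>\<open>b\<close> is the minimal representative of a coset of the dihedral subgroup of
  \<open>i\<close> and \<open>j\<close>: a descent of \<open>b\<close> at \<open>i\<close> or
  \<open>j\<close> could be moved into \<open>x\<close>, making \<open>b\<close> shorter.\<close>

lemma coset_decomposition:
  assumes "red a"
  obtains b x where "red (b @ x)" "W (b @ x) = W a" "set x \<subseteq> {i, j}"
    "length b \<le> len (b @ [i])" "length b \<le> len (b @ [j])"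
proof -
  define Q where "Q = (\<lambda>(b, x). W (b @ x) = W a \<and> length b + length x = len a \<and> set x \<subseteq> {i, j})"
  have "Q (a, [])" using assms by (simp add: Q_def red_def)
  from ex_has_least_nat [of Q, OF this, of "\<lambda>(b, x). length b"]
  obtain b x where Q: "Q (b, x)" and min: "\<And>b' x'. Q (b', x') \<Longrightarrow> length b \<le> length b'" by auto
  have "length b \<le> len (b @ [k])" if "k \<in> {i, j}" for k
  proof (rule ccontr)
    assume *: "\<not> length b \<le> len (b @ [k])"
    obtain b' where b': "W b' = W (b @ [k])" "length b' = len (b @ [k])" using ex_red by metis
    have "W (b' @ k # x) = W ((b @ [k]) @ k # x)" by (rule W_append_cong) (simp_all add: b')
    also have "\<dots> = W a" using Q by (simp add: Q_def)
    finally have "W (b' @ k # x) = W a" .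
    moreover from this have "len a \<le> length (b' @ k # x)" by (rule len_le)
    ultimately have "Q (b', k # x)" using Q * b' that by (auto simp: Q_def)
    from min [OF this] show False using * b' by simp
  qed
  moreover have "red (b @ x)" using Q len_cong [of "b @ x" a] by (simp add: Q_def red_def)
  ultimately show ?thesis using that [of b x] Q by (simp add: Q_def)
qed

lemma red_alternating:
  assumes "red x" "set x \<subseteq> {i, j}"
  shows "x = alt i j (length x) \<or> x = alt j i (length x)"
  using assms
proof (induction x rule: rev_induct)
  case (snoc k y)
  then have "red y" "set y \<subseteq> {i, j}" using red_appendD(1) [of y "[k]"] by auto
  with snoc.IH have y: "y = alt i j (length y) \<or> y = alt j i (length y)" by blast
  have "last y \<noteq> k" if "y \<noteq> []"
    using red_not_double [of "butlast y" k] snoc.prems(1) that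
    by (metis append.assoc append_Cons append_Nil append_butlast_last_id)
  moreover have "last (alt p q n) = p" if "n \<noteq> 0" for p q :: 'n and n using that by (cases n) auto
  ultimately have "y = [] \<or> (k = j \<longrightarrow> y = alt i j (length y)) \<and> (k = i \<longrightarrow> y = alt j i (length y))"
    using y by (metis length_0_conv)
  then show ?case using snoc.prems(2) by auto
qed simp

lemma W_alt: "i \<noteq> j \<Longrightarrow> W (alt i j (m i j)) = W (alt j i (m i j))"
  using rank2_braid [OF rank2_cc] by blast

text \<open>Reduces positivity at an ascent to rank two. The last letter \<open>j\<close> of
  \<open>a\<close> is a descent, so the dihedral tail is nonempty. An ascent at \<open>i\<close>
  forbids reduced factorizations ending in \<open>i\<close>, which fixes the last letter of the tail
  and, through the braid relation, bounds its length.\<close>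

lemma ascent_decomposition:
  assumes red: "red a" and "a \<noteq> []" and asc: "length a \<le> len (a @ [i])"
  obtains j b k where "j \<noteq> i" "0 < k" "k < m i j" "red (b @ alt j i k)" "W (b @ alt j i k) = W a"
    "length b \<le> len (b @ [i])" "length b \<le> len (b @ [j])"
proof -
  obtain a' j where a: "a = a' @ [j]" using \<open>a \<noteq> []\<close> by (metis rev_exhaust)
  have desc: "len (a @ [j]) < length a"
    using len_snoc_snoc [of a' j] len_le_length [of a'] by (simp add: a)
  then have ji: "j \<noteq> i" using asc by auto
  obtain b x where bx: "red (b @ x)" "W (b @ x) = W a" "set x \<subseteq> {i, j}"
    "length b \<le> len (b @ [i])" "length b \<le> len (b @ [j])"
    using coset_decomposition [OF red] by blast
  have len: "length b + length x = length a"
    using bx(1,2) len_cong [of "b @ x" a] red by (simp add: red_def)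
  \<comment> \<open>Cancelling the final \<open>i\<close> would make \<open>a @ [i]\<close> shorter
    than \<open>a\<close>.\<close>
  have not_i: False if "W (b @ y @ [i]) = W a" "length b + length y < length a" for y
  proof -
    have "W ((b @ y @ [i]) @ [i]) = W (a @ [i])" by (rule W_append_cong) (simp_all add: that)
    then have "len (a @ [i]) \<le> length (b @ y)"
      using W_double [of "b @ y" i "[]"] by (intro len_le) simp
    then show False using asc that by simp
  qed
  have "x \<noteq> []"
  proof
    assume "x = []"
    then have "W (b @ [j]) = W (a @ [j])" using bx by (intro W_append_cong) simp_all
    then have "len (b @ [j]) = len (a @ [j])" by (rule len_cong)
    then show False using bx desc len \<open>x = []\<close> by simp
  qed
  moreover have "x = alt i j (length x) \<or> x = alt j i (length x)"
    using red_alternating bx red_appendD by blast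
  moreover have "x \<noteq> alt i j (length x)"
  proof
    assume *: "x = alt i j (length x)"
    with \<open>x \<noteq> []\<close> obtain y where "x = y @ [i]" by (cases "length x") auto
    then show False using not_i [of y] bx len by simp
  qed
  ultimately have x: "x = alt j i (length x)" by blast
  \<comment> \<open>Otherwise the tail ends in a full braid word, which can be exchanged for one
    ending in \<open>i\<close>.\<close>
  moreover have "length x < m i j"
  proof (rule ccontr)
    assume "\<not> length x < m i j"
    then obtain y where y: "x = y @ alt j i (m i j)"
      using x alt_add [of j i "length x - m i j" "m i j"] by auto
    obtain z where z: "alt i j (m i j) = z @ [i]" using m_pos [of i j] by (cases "m i j") auto
    have "W (b @ y @ alt i j (m i j)) = W (b @ y @ alt j i (m i j))"
      using ji by (intro W_append_cong HOL.refl W_alt) simp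
    then have "W (b @ (y @ z) @ [i]) = W a" using bx y z by simp
    moreover have "m i j = Suc (length z)" using length_alt [of i j "m i j"] unfolding z by simp
    then have "length (y @ z) < length x" using y by simp
    ultimately show False using not_i [of "y @ z"] len by simp
  qed
  ultimately show ?thesis using that [of j "length x" b] ji bx \<open>x \<noteq> []\<close> by simp
qed

text \<open>Induction on the length: \<open>a\<close> acts as a shorter \<open>b\<close>, ascending
  at both letters, on a combination of two axes with coefficients in \<open>S\<close>. For
  \<open>A = cc\<close> the hypothesis \<open>word\<close> is trivial, so signs of roots are
  available in the proof of Matsumoto's theorem, which later supplies \<open>word\<close> for the
  deformed matrix.\<close>

lemma ascent_closed:
  assumes rank2: "\<And>i j. i \<noteq> j \<Longrightarrow> \<exists>s\<in>S. rank2 A i j s (m i j)"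
    and word: "\<And>a b. red a \<Longrightarrow> red b \<Longrightarrow> W a = W b \<Longrightarrow> pword A a = pword A b"
    and S: "0 \<in> S" "1 \<in> S" "\<And>i. A i i - 1 \<in> S" "\<And>i j. i \<noteq> j \<Longrightarrow> - A i j \<in> S"
      "\<And>a b. a \<in> S \<Longrightarrow> b \<in> S \<Longrightarrow> a * b \<in> S" "\<And>a b. a \<in> S \<Longrightarrow> b \<in> S \<Longrightarrow> a + b \<in> S"
    and "red a" "length a \<le> len (a @ [i])"
  shows "pword A a (axis i 1) $ k \<in> S"
  using \<open>red a\<close> \<open>length a \<le> len (a @ [i])\<close>
proof (induction "length a" arbitrary: a i rule: less_induct)
  case less
  show ?case
  proof (cases "a = []")
    case True
    then show ?thesis using S by (simp add: axis_def)
  next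
    case False
    obtain j b l where h: "j \<noteq> i" "0 < l" "l < m i j" "red (b @ alt j i l)" "W (b @ alt j i l) = W a"
      "length b \<le> len (b @ [i])" "length b \<le> len (b @ [j])"
      using ascent_decomposition [OF less.prems(1) False less.prems(2)] by metis
    have len: "length b < length a"
      using h len_cong [of "b @ alt j i l" a] less.prems(1) by (simp add: red_def)
    obtain s where s: "s \<in> S" "rank2 A i j s (m i j)" using rank2 [of i j] h by blast
    have "\<exists>p\<in>S. \<exists>q\<in>S. pword A (alt j i l) (axis i 1) = axis i p + axis j q"
      by (rule rank2_positive [OF s(2) h(3)]) (use h s S in auto)
    then obtain p q where pq: "p \<in> S" "q \<in> S" "pword A (alt j i l) (axis i 1) = axis i p + axis j q"
      by blast
    have "pword A a (axis i 1) = pword A b (axis i p + axis j q)"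
      using word [of a "b @ alt j i l"] h less.prems(1) pq by (simp add: pword_append)
    then have "pword A a (axis i 1) $ k
        = p * pword A b (axis i 1) $ k + q * pword A b (axis j 1) $ k"
      by (simp add: pword_add pword_axis [of A b _ p] pword_axis [of A b _ q])
    moreover have "pword A b (axis i 1) $ k \<in> S" "pword A b (axis j 1) $ k \<in> S"
      using less.hyps [OF len] h red_appendD by blast+
    ultimately show ?thesis using pq S by simp
  qed
qed

lemma ascent_nonneg_red: "red a \<Longrightarrow> length a \<le> len (a @ [i]) \<Longrightarrow> nonneg (W a (\<alpha> i))"
  unfolding nonneg_def
  using ascent_closed [of "{0..}" cc a i] rank2_cc cc_offdiag by fastforce

lemma ascent_nonneg: "len a \<le> len (a @ [i]) \<Longrightarrow> nonneg (W a (\<alpha> i))"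
proof -
  assume *: "len a \<le> len (a @ [i])"
  obtain b where b: "W b = W a" "length b = len a" "red b" using ex_red by blast
  then have "W (b @ [i]) = W (a @ [i])" by (intro W_append_cong) auto
  then have "len (b @ [i]) = len (a @ [i])" by (rule len_cong)
  then show ?thesis using ascent_nonneg_red [of b i] b * by simp
qed

lemma descent_nonpos: "len (a @ [i]) \<le> len a \<Longrightarrow> nonneg (- W a (\<alpha> i))"
  using ascent_nonneg [of "a @ [i]" i] by (simp add: len_snoc_snoc pword_snoc prefl_simple pword_minus)

lemma nonneg_antisym: "nonneg x \<Longrightarrow> nonneg (- x) \<Longrightarrow> x = 0"
  by (auto simp: nonneg_def vec_eq_iff intro: antisym)

lemma len_snoc_less: "red (a @ [i]) \<Longrightarrow> len (a @ [i, i]) < len (a @ [i])"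
  using red_appendD(1) [of a "[i]"] by (simp add: len_snoc_snoc red_def)

text \<open>An element with descents at both \<open>i\<close> and \<open>j\<close> ends in the
  longest element of their dihedral subgroup.\<close>

lemma common_braid:
  assumes a: "red (e @ [i])" "red (f @ [j])" "W (e @ [i]) = W (f @ [j])" and ij: "i \<noteq> j"
  obtains g where "red (g @ alt i j (m i j))" "W (g @ alt i j (m i j)) = W (e @ [i])"
proof -
  let ?a = "e @ [i]"
  obtain b x where bx: "red (b @ x)" "W (b @ x) = W ?a" "set x \<subseteq> {i, j}"
    "length b \<le> len (b @ [i])" "length b \<le> len (b @ [j])"
    using coset_decomposition [OF a(1)] by blast
  have neg_i: "nonneg (- W ?a (\<alpha> i))"
    using descent_nonpos [of ?a i] len_snoc_less [OF a(1)] by simp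
  have neg_j: "nonneg (- W ?a (\<alpha> j))"
    using descent_nonpos [of "f @ [j]" j] len_snoc_less [OF a(2)] a(3) by simp
  have pos: "nonneg (W b (\<alpha> i))" "nonneg (W b (\<alpha> j))"
    using bx ascent_nonneg_red red_appendD by blast+
  \<comment> \<open>For a shorter tail, rank-two positivity would make the image of the simple root
    at the letter \<open>q\<close>, on which the tail does not end, nonnegative, although
    \<open>q\<close> is a descent.\<close>
  have big: "m i j \<le> k" if x: "x = alt p q k" and pq: "p \<noteq> q" "p \<in> {i, j}" "q \<in> {i, j}" for p q k
  proof (rule ccontr)
    assume "\<not> m i j \<le> k"
    moreover have "m i j = m q p" using pq m_sym by auto
    ultimately have "k < m q p" by simp
    from rank2_positive [OF rank2_cc this, of "{0..}"] pq cc_offdiag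
    obtain c e where ce: "c \<ge> 0" "e \<ge> 0" "W x (\<alpha> q) = axis q c + axis p e" using x by fastforce
    have "W ?a (\<alpha> q) = W b (axis q c + axis p e)"
      using bx(2) ce(3) by (metis pword_append)
    also have "\<dots> = c *s W b (\<alpha> q) + e *s W b (\<alpha> p)"
      by (simp add: pword_add pword_axis [of cc b _ c] pword_axis [of cc b _ e])
    finally have "nonneg (W ?a (\<alpha> q))" using ce pos pq by (auto simp: nonneg_def)
    then show False using nonneg_antisym neg_i neg_j pq W_simple_nonzero by blast
  qed
  have "x = alt i j (length x) \<or> x = alt j i (length x)"
    using red_alternating bx red_appendD by blast
  then obtain y where "W (b @ x) = W ((b @ y) @ alt i j (m i j))" "length x = length y + m i j"
  proof
    assume x: "x = alt i j (length x)"
    with big [OF x] ij have "m i j \<le> length x" by simp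
    then obtain y where "x = y @ alt i j (m i j)"
      using x alt_add [of i j "length x - m i j" "m i j"] by auto
    then show ?thesis using that [of y] by simp
  next
    assume x: "x = alt j i (length x)"
    with big [OF x] ij have "m i j \<le> length x" by simp
    then obtain y where y: "x = y @ alt j i (m i j)"
      using x alt_add [of j i "length x - m i j" "m i j"] by auto
    then have "W (b @ x) = W ((b @ y) @ alt i j (m i j))"
      using W_append_cong [OF HOL.refl W_alt [OF ij], of "b @ y"] by simp
    then show ?thesis using that [of y] y by simp
  qed
  then have "W ((b @ y) @ alt i j (m i j)) = W ?a" "red ((b @ y) @ alt i j (m i j))"
    using bx red_cong [of "b @ x" "(b @ y) @ alt i j (m i j)"] by simp_all
  then show ?thesis using that by blast
qed

text \<open>Equal last letters are cancelled by induction; different ones are joined through two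
  words ending in the two sides of a braid relation.\<close>

lemma matsumoto:
  assumes rank2: "\<And>i j. i \<noteq> j \<Longrightarrow> \<exists>s. rank2 A i j s (m i j)"
    and "red a" "red b" "W a = W b"
  shows "pword A a = pword A b"
  using assms(2-4)
proof (induction "length a" arbitrary: a b rule: less_induct)
  case less
  have len: "length a = length b" by (rule red_length) (fact less.prems)+
  show ?case
  proof (cases "a = []")
    case True
    then show ?thesis using len by simp
  next
    case False
    then obtain e i where a: "a = e @ [i]" by (metis rev_exhaust)
    from False len have "b \<noteq> []" by auto
    then obtain f j where b: "b = f @ [j]" by (metis rev_exhaust)
    have step: "pword A (e' @ [k]) = pword A (f' @ [k])"
      if "red (e' @ [k])" "red (f' @ [k])" "W (e' @ [k]) = W (f' @ [k])" "length e' < length a"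
      for e' f' k
    proof -
      have "W e' = W f'"
        using W_append_cong [OF that(3), of "[k]" "[k]"] W_double [of _ k "[]"] by simp
      then have "pword A e' = pword A f'"
        using less.hyps [of e' f'] that red_appendD by blast
      then show ?thesis by (simp add: fun_eq_iff pword_append)
    qed
    show ?thesis
    proof (cases "i = j")
      case True
      then show ?thesis using step [of e i f] less.prems a b by simp
    next
      case ij: False
      obtain g where g: "red (g @ alt i j (m i j))" "W (g @ alt i j (m i j)) = W a"
        using common_braid [of e i f j] less.prems a b ij by auto
      have g': "W (g @ alt j i (m i j)) = W a"
        using g W_append_cong [OF HOL.refl W_alt [OF ij], of g] by simp
      then have g'': "red (g @ alt j i (m i j))"
        using g red_cong [of "g @ alt i j (m i j)" "g @ alt j i (m i j)"] by simp
      obtain n where n: "m i j = Suc n" using m_pos [of i j] by (cases "m i j") auto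
      have "pword A a = pword A (g @ alt i j (m i j))"
        using step [of e i "g @ alt j i n"] less.prems(1) g a n by simp
      also have "\<dots> = pword A (g @ alt j i (m i j))"
        using rank2_braid rank2 ij by (metis (no_types) ext pword_append)
      also have "\<dots> = pword A b"
        using step [of "g @ alt i j n" j f] less.prems g' g'' b n len red_length [OF g'' less.prems(1) g']
        by simp
      finally show ?thesis .
    qed
  qed
qed

section \<open>Roots and the longest element\<close>

abbreviation R :: "(int ^ 'n) set" where "R \<equiv> roots C"

definition \<Phi> :: "(int ^ 'n) set" where "\<Phi> = {\<beta> \<in> R. nonneg \<beta>}"

lemma roots_iff: "\<beta> \<in> R \<longleftrightarrow> (\<exists>a i. \<beta> = W a (\<alpha> i))"
  by (auto simp: roots_def weyl_group_def weyl_word_eq simple_root_def)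

lemma root_W: "\<beta> \<in> R \<Longrightarrow> W a \<beta> \<in> R"
  by (metis roots_iff pword_append)

lemma root_prefl: "\<beta> \<in> R \<Longrightarrow> prefl cc i \<beta> \<in> R"
  using root_W [of \<beta> "[i]"] by (simp add: pword_Cons)

lemma simple_root_in: "\<alpha> i \<in> R"
  using roots_iff [of "\<alpha> i"] by (metis pword_Nil)

lemma root_minus: "\<beta> \<in> R \<Longrightarrow> - \<beta> \<in> R"
proof -
  assume "\<beta> \<in> R"
  then obtain a i where "\<beta> = W a (\<alpha> i)" by (auto simp: roots_iff)
  then have "- \<beta> = W (a @ [i]) (\<alpha> i)" by (simp add: pword_snoc prefl_simple pword_minus)
  then show ?thesis by (auto simp: roots_iff)
qed

lemma root_nonzero: "\<beta> \<in> R \<Longrightarrow> \<beta> \<noteq> 0"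
  using W_simple_nonzero by (auto simp: roots_iff)

lemma root_sign: "\<beta> \<in> R \<Longrightarrow> nonneg \<beta> \<or> nonneg (- \<beta>)"
proof -
  assume "\<beta> \<in> R"
  then obtain a i where "\<beta> = W a (\<alpha> i)" by (auto simp: roots_iff)
  then show ?thesis using ascent_nonneg [of a i] descent_nonpos [of a i] by (metis linear)
qed

lemma simple_positive: "\<alpha> i \<in> \<Phi>"
  using simple_root_in [of i] by (auto simp: \<Phi>_def nonneg_def axis_def)

lemma root_form_eq: "\<beta> \<in> R \<Longrightarrow> \<exists>i. B \<beta> \<beta> = 2 * int (d i)"
  by (auto simp: roots_iff form_W)

text \<open>Undoing the Weyl group element makes \<open>\<alpha> i\<close>, which has a coefficient
  1, divisible by \<open>c\<close>.\<close>

lemma root_primitive: "c *s x \<in> R \<Longrightarrow> \<bar>c\<bar> = 1"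
proof -
  assume "c *s x \<in> R"
  then obtain a i where "c *s x = W a (\<alpha> i)" by (auto simp: roots_iff)
  then have "c *s W (rev a) x = \<alpha> i" by (metis W_rev(1) pword_smult)
  then have "c * W (rev a) x $ i = 1" by (metis axis_nth vector_smult_component)
  then show ?thesis by (metis abs_zmult_eq_1 abs_one)
qed

section \<open>Finiteness of the root system and of the Weyl group\<close>

lemma finite_form_le: "finite {x. B x x \<le> K}"
proof -
  define f where "f = (\<lambda>x :: real ^ 'n.
    \<Sum>i\<in>UNIV. \<Sum>j\<in>UNIV. real (d i) * real_of_int (cc i j) * x $ i * x $ j)"
  \<comment> \<open>By compactness the form has a positive minimum on the unit sphere, hence
    dominates a multiple of the squared norm.\<close>
  have "continuous_on (sphere 0 1) f" unfolding f_def by (intro continuous_intros)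
  moreover have "sphere (0 :: real ^ 'n) 1 \<noteq> {}" by simp
  ultimately have "\<exists>x\<in>sphere 0 1. \<forall>y\<in>sphere 0 1. f x \<le> f y"
    by (intro continuous_attains_inf) auto
  then obtain x0 where x0: "x0 \<in> sphere 0 1" "\<And>x. x \<in> sphere 0 1 \<Longrightarrow> f x0 \<le> f x" by blast
  then have "x0 \<noteq> 0" by auto
  then have e: "f x0 > 0" unfolding f_def by (rule d_posdef)
  define e where "e = f x0"
  have bound: "e * (norm x)\<^sup>2 \<le> f x" for x
  proof (cases "x = 0")
    case False
    have "e \<le> f ((1 / norm x) *\<^sub>R x)" unfolding e_def by (rule x0(2)) (use False in simp)
    also have "\<dots> = f x / (norm x)\<^sup>2"
      unfolding f_def sum_divide_distrib
      by (intro sum.cong HOL.refl) (simp add: power2_eq_square)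
    finally show ?thesis using False by (simp add: field_simps)
  qed (simp add: f_def)
  define N where "N = \<lceil>max 1 (real_of_int K / e)\<rceil>"
  have "x $ i \<in> {- N..N}" if "B x x \<le> K" for x :: "int ^ 'n" and i
  proof -
    let ?x = "\<chi> i. real_of_int (x $ i)"
    have "f ?x = real_of_int (B x x)" by (simp add: f_def root_form_def)
    then have "e * (norm ?x)\<^sup>2 \<le> K" using bound [of ?x] that by linarith
    moreover have "\<bar>real_of_int (x $ i)\<bar> \<le> norm ?x" using component_le_norm_cart [of ?x i] by simp
    then have "(real_of_int (x $ i))\<^sup>2 \<le> (norm ?x)\<^sup>2"
      by (metis abs_ge_zero power2_abs power_mono)
    ultimately have "(real_of_int (x $ i))\<^sup>2 \<le> real_of_int K / e"
      using e by (simp add: e_def pos_le_divide_eq mult.commute [of _ "f x0"])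
         (smt (verit) mult_left_mono)
    \<comment> \<open>An integer is at most its square in absolute value, so the bound on the square
      already bounds the coordinate.\<close>
    moreover have "\<bar>real_of_int (x $ i)\<bar> \<le> (real_of_int (x $ i))\<^sup>2"
      using self_le_power [of "\<bar>x $ i\<bar>" 2]
      by (cases "x $ i = 0") (simp_all flip: of_int_abs of_int_power)
    ultimately show ?thesis unfolding N_def by simp linarith
  qed
  then have "{x. B x x \<le> K} \<subseteq> vec_lambda ` (UNIV \<rightarrow>\<^sub>E {- N..N})"
    by (intro subsetI image_eqI [where x = "vec_nth _"]) auto
  then show ?thesis by (rule finite_subset) (intro finite_imageI finite_PiE; simp)
qed

lemma finite_roots: "finite R"
proof -
  have "\<beta> \<in> {x. B x x \<le> Max (range (\<lambda>i. 2 * int (d i)))}" if "\<beta> \<in> R" for \<beta>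
    using root_form_eq [OF that] by (auto intro!: Max_ge)
  then show ?thesis by (intro finite_subset [OF subsetI finite_form_le])
qed

lemma finite_\<Phi> [simp]: "finite \<Phi>"
  by (simp add: \<Phi>_def finite_roots)

lemma finite_W: "finite (range W)"
proof (rule inj_on_finite)
  show "inj_on (\<lambda>w i. w (\<alpha> i)) (range W)"
  proof (rule inj_onI, clarify)
    fix a b assume "(\<lambda>i. W a (\<alpha> i)) = (\<lambda>i. W b (\<alpha> i))"
    then show "W a = W b" by (intro pword_ext_axis) (rule fun_cong)
  qed
  show "(\<lambda>w i. w (\<alpha> i)) ` range W \<subseteq> UNIV \<rightarrow>\<^sub>E R"
    using root_W simple_root_in by auto
  show "finite (UNIV \<rightarrow>\<^sub>E R :: ('n \<Rightarrow> int ^ 'n) set)"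
    by (intro finite_PiE) (simp_all add: finite_roots)
qed

lemma ex_longest: "\<exists>a. \<forall>b. len b \<le> len a"
proof -
  let ?L = "weyl_length C ` range W"
  have fin: "finite ?L" using finite_W by simp
  then have "Max ?L \<in> ?L" by (intro Max_in) auto
  then obtain a where "Max ?L = weyl_length C (W a)" by auto
  moreover have "weyl_length C (W b) \<le> Max ?L" for b using fin by (intro Max_ge) auto
  ultimately have "\<forall>b. len b \<le> len a" by (simp add: len_def)
  then show ?thesis ..
qed

lemma nonpos_W:
  assumes "\<And>i. nonneg (- W a (\<alpha> i))" "nonneg x"
  shows "nonneg (- W a x)"
  unfolding nonneg_def
proof
  fix k
  have "x $ i * W a (\<alpha> i) $ k \<le> 0" for i
    using assms by (auto simp: nonneg_def mult_nonneg_nonpos)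
  then have "W a x $ k \<le> 0" by (subst pword_expand) (rule sum_nonpos)
  then show "0 \<le> (- W a x) $ k" by simp
qed

lemma W_eq_id:
  assumes "\<And>i. nonneg (W a (\<alpha> i))"
  shows "W a x = x"
proof -
  obtain b where b: "W b = W a" "red b" using ex_red by metis
  have "b = []"
  proof (rule ccontr)
    assume "b \<noteq> []"
    then obtain b' i where b': "b = b' @ [i]" by (metis rev_exhaust)
    have "nonneg (- W b (\<alpha> i))"
      using descent_nonpos [of b i] len_snoc_less [of b' i] b b' by simp
    then show False using assms nonneg_antisym W_simple_nonzero b by metis
  qed
  then show ?thesis using b by (metis pword_Nil)
qed

text \<open>Working substitute for maximal length: an element of maximal length has a descent at
  every letter, and \<open>all_neg_unique\<close> shows that this determines it.\<close>

definition all_neg :: "'n list \<Rightarrow> bool" where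
  "all_neg a \<longleftrightarrow> (\<forall>i. nonneg (- W a (\<alpha> i)))"

lemma all_neg_rev:
  assumes "all_neg a" "\<beta> \<in> R" "nonneg \<beta>"
  shows "nonneg (- W (rev a) \<beta>)"
proof (rule ccontr)
  assume "\<not> ?thesis"
  then have "nonneg (W (rev a) \<beta>)" using root_sign [OF root_W [OF assms(2)]] by blast
  from nonpos_W [OF _ this, of a] assms(1) have "nonneg (- W a (W (rev a) \<beta>))"
    by (auto simp only: all_neg_def)
  then have "nonneg (- \<beta>)" by simp
  then show False using assms(2,3) nonneg_antisym root_nonzero by blast
qed

text \<open>\<open>b\<close> makes the simple roots negative and the inverse of \<open>a\<close>
  makes them positive again; the product then has no descent, so it is the identity.\<close>

lemma all_neg_unique:
  assumes "all_neg a" "all_neg b"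
  shows "W a = W b"
proof
  fix x
  have "nonneg (W (rev a @ b) (\<alpha> i))" for i
    using all_neg_rev [OF assms(1), of "- W b (\<alpha> i)"] assms(2)
      root_minus [OF root_W [OF simple_root_in], of b i]
    by (simp add: all_neg_def pword_append pword_minus)
  then have "W (rev a @ b) x = x" by (rule W_eq_id)
  then have "W a (W (rev a) (W b x)) = W a x" by (simp add: pword_append)
  then show "W a x = W b x" by simp
qed

lemma longest_all_neg: "(\<And>b. len b \<le> len a) \<Longrightarrow> all_neg a"
  by (simp add: all_neg_def descent_nonpos)

lemma ex_longest_word: "\<exists>a. red a \<and> W a = longest_elt C \<and> all_neg a"
proof -
  obtain a0 where a0: "\<And>b. len b \<le> len a0" using ex_longest by auto
  obtain a where a: "W a = W a0" "red a" using ex_red by metis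
  have len: "len b \<le> len a" for b using a0 [of b] len_cong [OF a(1)] by simp
  have "longest_elt C = W a"
    unfolding longest_elt_def weyl_group_def weyl_word_eq
  proof (rule the_equality)
    show "W a \<in> range W \<and> (\<forall>w'\<in>range W. weyl_length C w' \<le> weyl_length C (W a))"
      using len by (auto simp: len_def)
  next
    fix w assume w: "w \<in> range W \<and> (\<forall>w'\<in>range W. weyl_length C w' \<le> weyl_length C w)"
    then obtain b where b: "w = W b" by auto
    then have "all_neg b" using w by (intro longest_all_neg) (auto simp: len_def)
    then show "w = W a" using all_neg_unique longest_all_neg len b by blast
  qed
  then show ?thesis using a longest_all_neg [OF len] by metis
qed

definition a0 :: "'n list" where
  "a0 = (SOME a. red a \<and> W a = longest_elt C \<and> all_neg a)"

lemma red_a0: "red a0" and W_a0: "W a0 = longest_elt C" and all_neg_a0: "all_neg a0"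
  using someI_ex [OF ex_longest_word] by (simp_all add: a0_def)

lemma W_rev_a0: "W (rev a0) = W a0"
  using all_neg_rev [OF all_neg_a0] simple_positive
  by (intro all_neg_unique all_neg_a0) (auto simp: all_neg_def \<Phi>_def)

lemma W_a0_a0 [simp]: "W a0 (W a0 x) = x"
  using W_rev(1) [of a0 x] by (simp add: W_rev_a0)

text \<open>\<open>- W a0\<close> is its own inverse and has nonnegative integer entries, which
  forces a permutation matrix.\<close>

lemma a0_simple: "\<exists>k. W a0 (\<alpha> i) = - \<alpha> k"
proof -
  define y where "y = - W a0 (\<alpha> i)"
  have y: "nonneg y" "y \<noteq> 0"
    using all_neg_a0 W_simple_nonzero [of a0 i] by (auto simp: y_def all_neg_def)
  have yy: "- W a0 y = \<alpha> i" by (simp add: y_def pword_minus)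
  obtain k where k: "y $ k > 0" using y by (auto simp: nonneg_def vec_eq_iff order_le_less)
  have z: "nonneg (- W a0 (\<alpha> l))" for l using all_neg_a0 by (simp add: all_neg_def)
  have "W a0 (\<alpha> k) $ l = 0" if "l \<noteq> i" for l
  proof -
    \<comment> \<open>A zero coordinate of \<open>\<alpha> i\<close> is written as a sum of
      nonnegative terms, so the term of \<open>k\<close> vanishes as well.\<close>
    have "(\<Sum>p\<in>UNIV. y $ p * - W a0 (\<alpha> p) $ l) = 0"
      using arg_cong [OF yy, of "\<lambda>x. x $ l"] that pword_expand [of cc a0 y l]
      by (simp add: sum_negf axis_def)
    moreover have "0 \<le> y $ p * - W a0 (\<alpha> p) $ l" for p
      using y z [of p] by (auto simp: nonneg_def mult_nonneg_nonpos)
    ultimately have "y $ k * - W a0 (\<alpha> k) $ l = 0" by (simp add: sum_nonneg_eq_0_iff)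
    then show ?thesis using k by simp
  qed
  then have "W a0 (\<alpha> k) = W a0 (\<alpha> k) $ i *s \<alpha> i" by (simp add: vec_eq_iff axis_def)
  then have "\<alpha> k = W a0 (\<alpha> k) $ i *s W a0 (\<alpha> i)" by (metis W_a0_a0 pword_smult)
  then have *: "\<alpha> k = (- W a0 (\<alpha> k) $ i) *s y" by (simp add: y_def vec_eq_iff)
  have "(- W a0 (\<alpha> k) $ i) * y $ k = 1"
    using arg_cong [OF *, of "\<lambda>x. x $ k"] by simp
  with k have "- W a0 (\<alpha> k) $ i = 1" by (smt (verit) zmult_eq_1_iff)
  with * have "\<alpha> k = y" by (simp add: vec_eq_iff)
  then show ?thesis by (metis y_def minus_minus)
qed

section \<open>The diagram involution\<close>

abbreviation st :: "'n \<Rightarrow> 'n" where "st \<equiv> star_inv C"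

lemma W_a0_simple: "W a0 (\<alpha> i) = - \<alpha> (st i)"
proof -
  obtain k where k: "W a0 (\<alpha> i) = - \<alpha> k" using a0_simple by blast
  have "st i = k"
    unfolding star_inv_def simple_root_def W_a0 [symmetric] k
    by (rule the_equality) (auto simp: axis_eq_axis)
  then show ?thesis using k by simp
qed

lemma st_st [simp]: "st (st i) = i"
proof -
  have "\<alpha> i = W a0 (W a0 (\<alpha> i))" by simp
  also have "\<dots> = \<alpha> (st (st i))" by (simp add: W_a0_simple pword_minus del: W_a0_a0)
  finally show ?thesis by (simp add: axis_eq_axis)
qed

lemma form_st: "B (\<alpha> (st i)) (\<alpha> (st j)) = B (\<alpha> i) (\<alpha> j)"
  using form_W [of a0 "\<alpha> i" "\<alpha> j"] by (simp add: W_a0_simple form_minus form_minus')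

lemma d_st [simp]: "d (st i) = d i"
  using form_st [of i i] by simp

lemma cc_st [simp]: "cc (st i) (st j) = cc i j"
  using form_st [of i j] d_pos [of i] by (simp add: form_axis pform_axis)

lemma pform_W_a0: "pform cc (st i) (W a0 x) = - pform cc i x"
proof -
  have "B (\<alpha> (st i)) (W a0 x) = - B (W a0 (\<alpha> i)) (W a0 x)"
    by (simp add: W_a0_simple form_minus')
  also have "\<dots> = - B (\<alpha> i) x" by (simp only: form_W)
  finally have "int (d i) * (pform cc (st i) (W a0 x) + pform cc i x) = 0"
    by (simp add: form_axis distrib_left)
  then have "pform cc (st i) (W a0 x) + pform cc i x = 0" using d_pos [of i] by simp
  then show ?thesis by linarith
qed

lemma prefl_W_a0: "prefl cc (st i) (W a0 x) = W a0 (prefl cc i x)"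
  unfolding prefl_def pword_diff pword_axis [of cc a0 i "pform cc i x"] pform_W_a0 W_a0_simple
  by (simp add: vec_eq_iff axis_def)

text \<open>\<open>b\<close> is a reduced word of \<open>w\<^sub>0 s\<^sub>i\<close>, which equals
  \<open>s\<^sub>i\<^sub>* w\<^sub>0\<close>. Both words are reduced, so Matsumoto's theorem will
  transfer the commutation to the deformed operators.\<close>

lemma a0_factor:
  obtains b where "red (b @ [i])" "W (b @ [i]) = W a0" "red (st i # b)" "W (st i # b) = W a0"
proof -
  obtain b where b: "W b = W (a0 @ [i])" "length b = len (a0 @ [i])" "red b" using ex_red by metis
  have "W (b @ [i]) = W ((a0 @ [i]) @ [i])" by (intro W_append_cong b HOL.refl)
  then have 1: "W (b @ [i]) = W a0" using W_double [of a0 i "[]"] by simp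
  have 2: "W (st i # b) = W a0"
    by (rule ext) (simp add: pword_Cons b(1) pword_snoc flip: prefl_W_a0)
  have "\<not> len a0 \<le> len (a0 @ [i])"
    using ascent_nonneg [of a0 i] all_neg_a0 nonneg_antisym W_simple_nonzero
    by (auto simp: all_neg_def)
  moreover have "len a0 \<le> length (b @ [i])" using len_le [OF 1] .
  ultimately have "length (b @ [i]) = len a0" using b(2) by simp
  then have "red (b @ [i])" "red (st i # b)"
    using len_cong [OF 1] len_cong [OF 2] by (simp_all add: red_def)
  then show ?thesis using that 1 2 by blast
qed

lemma multiple_of_simple:
  fixes \<beta> :: "int ^ 'n"
  assumes "\<beta> \<in> R" "\<And>k. k \<noteq> i \<Longrightarrow> \<beta> $ k = 0"
  shows "\<beta> = \<alpha> i \<or> \<beta> = - \<alpha> i"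
proof -
  have *: "\<beta> = \<beta> $ i *s \<alpha> i" using assms(2) by (simp add: vec_eq_iff axis_def)
  then have "\<bar>\<beta> $ i\<bar> = 1" using assms(1) root_primitive by metis
  then have "\<beta> $ i = 1 \<or> \<beta> $ i = - 1" by linarith
  then show ?thesis by (subst (1 2) *) (auto simp: vec_eq_iff)
qed

text \<open>Some coefficient of \<beta> away from \<open>i\<close> is positive, and the reflection
  does not touch it.\<close>

lemma prefl_positive: "\<beta> \<in> \<Phi> \<Longrightarrow> \<beta> \<noteq> \<alpha> i \<Longrightarrow> prefl cc i \<beta> \<in> \<Phi> - {\<alpha> i}"
proof -
  assume \<beta>: "\<beta> \<in> \<Phi>" "\<beta> \<noteq> \<alpha> i"
  have "\<beta> \<noteq> - \<alpha> i"
    using \<beta> nonneg_antisym [of \<beta>] simple_positive [of i] root_nonzero by (auto simp: \<Phi>_def)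
  then obtain k where k: "k \<noteq> i" "\<beta> $ k \<noteq> 0"
    using multiple_of_simple [of \<beta> i] \<beta> by (auto simp: \<Phi>_def)
  have same: "prefl cc i \<beta> $ k = \<beta> $ k" using k by (simp add: prefl_def axis_def)
  have "\<beta> $ k > 0" using k \<beta> by (auto simp: \<Phi>_def nonneg_def order_le_less)
  then have "\<not> nonneg (- prefl cc i \<beta>)" using same by (auto simp: nonneg_def not_le intro!: exI [of _ k])
  moreover have "prefl cc i \<beta> \<in> R" using root_prefl \<beta> by (auto simp: \<Phi>_def)
  moreover have "prefl cc i \<beta> \<noteq> \<alpha> i" using same k by (auto simp: axis_def)
  ultimately show ?thesis using root_sign by (auto simp: \<Phi>_def)
qed

lemma sum_prefl_positive:
  "(\<Sum>\<beta>\<in>\<Phi> - {\<alpha> i}. f (prefl cc i \<beta>)) = (\<Sum>\<beta>\<in>\<Phi> - {\<alpha> i}. f \<beta>)"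
  by (rule sum.reindex_bij_witness [where i = "prefl cc i" and j = "prefl cc i"])
    (use prefl_positive in auto)

section \<open>Inversions and the letters of a reduced word\<close>

definition inv_set :: "'n list \<Rightarrow> (int ^ 'n) set" where
  "inv_set a = {\<beta> \<in> \<Phi>. nonneg (- W (rev a) \<beta>)}"

text \<open>A further simple reflection changes the sign of \<gamma>, the pullback of \<beta>, only
  if \<gamma> is \<open>\<alpha> i\<close> or \<open>- \<alpha> i\<close>; the latter is excluded
  because \<open>a\<close> ascends at \<open>i\<close>.\<close>

lemma inv_set_snoc:
  assumes red: "red (a @ [i])"
  shows "inv_set (a @ [i]) = insert (W a (\<alpha> i)) (inv_set a)" "W a (\<alpha> i) \<notin> inv_set a"
proof -
  have pos: "nonneg (W a (\<alpha> i))"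
    using red red_appendD(1) [OF red] by (intro ascent_nonneg) (simp add: red_def)
  then have inP: "W a (\<alpha> i) \<in> \<Phi>" using root_W simple_root_in by (simp add: \<Phi>_def)
  show "W a (\<alpha> i) \<notin> inv_set a"
    using nonneg_antisym [of "\<alpha> i"] simple_positive [of i] simple_nonzero
    by (auto simp: inv_set_def \<Phi>_def)
  have "\<beta> \<in> inv_set (a @ [i]) \<longleftrightarrow> \<beta> = W a (\<alpha> i) \<or> \<beta> \<in> inv_set a" if \<beta>: "\<beta> \<in> \<Phi>" for \<beta>
  proof -
    define \<gamma> where "\<gamma> = W (rev a) \<beta>"
    have \<gamma>: "\<gamma> \<in> R" using \<beta> root_W by (simp add: \<gamma>_def \<Phi>_def)
    have \<beta>': "\<beta> = W a \<gamma>" by (simp add: \<gamma>_def)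
    have "\<gamma> \<noteq> - \<alpha> i"
    proof
      assume "\<gamma> = - \<alpha> i"
      then have "nonneg (- W a (\<alpha> i))" using \<beta> \<beta>' by (simp add: \<Phi>_def pword_minus)
      then show False using nonneg_antisym pos W_simple_nonzero by blast
    qed
    moreover have "\<beta> = W a (\<alpha> i) \<longleftrightarrow> \<gamma> = \<alpha> i" using \<beta>' W_inj by metis
    moreover have "nonneg (- prefl cc i \<gamma>) \<longleftrightarrow> \<gamma> = \<alpha> i \<or> nonneg (- \<gamma>)" if "\<gamma> \<noteq> - \<alpha> i"
    proof (cases "nonneg \<gamma>")
      case True
      then have n: "\<not> nonneg (- \<gamma>)" using \<gamma> nonneg_antisym root_nonzero by blast
      show ?thesis
      proof (cases "\<gamma> = \<alpha> i")
        case True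
        then show ?thesis using simple_positive [of i] by (simp add: prefl_simple \<Phi>_def)
      next
        case False
        then have "prefl cc i \<gamma> \<in> \<Phi>" using prefl_positive True \<gamma> by (auto simp: \<Phi>_def)
        then show ?thesis using False n nonneg_antisym root_nonzero by (auto simp: \<Phi>_def)
      qed
    next
      case False
      then have neg: "nonneg (- \<gamma>)" using root_sign \<gamma> by blast
      then have "- \<gamma> \<in> \<Phi>" "- \<gamma> \<noteq> \<alpha> i"
        using \<gamma> root_minus that by (auto simp: \<Phi>_def) (metis minus_minus)
      then have "prefl cc i (- \<gamma>) \<in> \<Phi>" using prefl_positive by blast
      moreover have "prefl cc i (- \<gamma>) = - prefl cc i \<gamma>"
        using pword_minus [of cc "[i]" \<gamma>] by (simp add: pword_Cons)
      ultimately show ?thesis using neg by (simp add: \<Phi>_def)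
    qed
    ultimately show ?thesis
      using \<beta> by (simp add: inv_set_def pword_Cons \<gamma>_def)
  qed
  then show "inv_set (a @ [i]) = insert (W a (\<alpha> i)) (inv_set a)"
    using inP by (auto simp: inv_set_def)
qed

text \<open>Each letter \<open>i\<close> contributes one inversion, an image of
  \<open>\<alpha> i\<close>, on which the form is \<open>2 d\<^sub>i\<close>.\<close>

lemma sum_inv_set:
  assumes "red a"
  shows "(\<Sum>\<beta>\<in>inv_set a. f (B \<beta> \<beta>)) = (\<Sum>i\<leftarrow>a. f (2 * int (d i)) :: real)"
  using assms
proof (induction a rule: rev_induct)
  case Nil
  have "inv_set [] = {}" using nonneg_antisym root_nonzero by (auto simp: inv_set_def \<Phi>_def)
  then show ?case by simp
next
  case (snoc i a)
  have "finite (inv_set a)" by (simp add: inv_set_def)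
  then show ?case
    using snoc.IH red_appendD(1) [OF snoc.prems] inv_set_snoc [OF snoc.prems] by (simp add: form_W)
qed

lemma sum_positive_roots: "(\<Sum>\<beta>\<in>\<Phi>. f (B \<beta> \<beta>)) = (\<Sum>i\<leftarrow>a0. f (2 * int (d i)) :: real)"
proof -
  have "inv_set a0 = \<Phi>"
    using all_neg_rev [OF all_neg_a0] by (auto simp: inv_set_def \<Phi>_def)
  then show ?thesis using sum_inv_set [OF red_a0, of f] by simp
qed

section \<open>Coxeter numbers\<close>

lemma nonneg_add: "nonneg x \<Longrightarrow> nonneg y \<Longrightarrow> nonneg (x + y)"
  by (simp add: nonneg_def)

lemma simple_nth: "\<alpha> i $ k = (if k = i then 1 else 0)"
  by (simp add: axis_def)

lemma prefl_nth: "prefl cc i x $ k = (if k = i then x $ k - pform cc i x else x $ k)"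
  by (simp add: prefl_def axis_def)

lemma form_eq_sum: "B x y = (\<Sum>i\<in>UNIV. x $ i * B (\<alpha> i) y)"
  by (simp add: form_eq_pform [of x] form_axis algebra_simps)

text \<open>\<open>p\<close> is the pairing of \<open>x\<close> with the coroot of \<gamma>; the
  last vector is the reflection of \<open>x\<close> in \<gamma>.\<close>

lemma root_pairing:
  assumes "\<gamma> \<in> R"
  obtains p where "2 * B x \<gamma> = p * B \<gamma> \<gamma>" "x \<in> R \<Longrightarrow> x - p *s \<gamma> \<in> R"
proof -
  obtain a k where \<gamma>: "\<gamma> = W a (\<alpha> k)" using assms by (auto simp: roots_iff)
  define p where "p = pform cc k (W (rev a) x)"
  have "B x \<gamma> = B (W a (W (rev a) x)) (W a (\<alpha> k))" by (simp add: \<gamma>)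
  also have "\<dots> = int (d k) * p"
    by (simp only: form_W) (simp add: form_sym [of _ "\<alpha> k"] form_axis p_def)
  finally have 1: "2 * B x \<gamma> = p * B \<gamma> \<gamma>" by (simp add: \<gamma> form_W)
  have "x - p *s \<gamma> = W a (prefl cc k (W (rev a) x))"
    by (simp add: \<gamma> prefl_def pword_diff pword_axis [of cc a k "pform cc k (W (rev a) x)"] p_def)
  then have "x - p *s \<gamma> \<in> R" if "x \<in> R" using that by (simp add: root_W root_prefl)
  then show ?thesis using that 1 by blast
qed

lemma root_form_pos: "\<beta> \<in> R \<Longrightarrow> B \<beta> \<beta> > 0"
  using form_pos root_nonzero by blast

text \<open>\<open>p * p'\<close> is four times the squared cosine of the angle. The value 4 would
  make the roots proportional, which primitivity excludes for distinct roots at an acute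
  angle.\<close>

lemma root_pairing_bound:
  assumes \<beta>: "\<beta> \<in> R" and \<gamma>: "\<gamma> \<in> R" and pos: "B \<beta> \<gamma> > 0" and ne: "\<beta> \<noteq> \<gamma>"
    and p: "2 * B \<beta> \<gamma> = p * B \<gamma> \<gamma>" and p': "2 * B \<beta> \<gamma> = p' * B \<beta> \<beta>"
  shows "p > 0" "p' > 0" "p * p' \<le> 3" "p = 1 \<or> p' = 1"
proof -
  note bp = root_form_pos [OF \<beta>] and gp = root_form_pos [OF \<gamma>]
  show pp: "p > 0" "p' > 0" using pos p p' bp gp by (metis zero_less_mult_pos2 zero_less_mult_iff zero_less_numeral)+
  \<comment> \<open>Evaluating the form at this vector gives Cauchy-Schwarz in integral
    form.\<close>
  define x where "x = 2 *s \<beta> - p *s \<gamma>"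
  have "B x x = 4 * B \<beta> \<beta> - 4 * p * B \<beta> \<gamma> + p * (p * B \<gamma> \<gamma>)"
    by (simp add: x_def form_diff form_diff' form_smult form_smult' form_sym [of \<gamma> \<beta>] algebra_simps)
  also have "\<dots> = 4 * B \<beta> \<beta> - p * (2 * B \<beta> \<gamma>)" unfolding p [symmetric] by simp
  also have "\<dots> = (4 - p * p') * B \<beta> \<beta>" unfolding p' by (simp add: algebra_simps)
  finally have x: "B x x = (4 - p * p') * B \<beta> \<beta>" .
  have not4: "p * p' \<noteq> 4"
  proof
    assume 4: "p * p' = 4"
    then have "x = 0" using x form_pos [of x] by auto
    then have eq: "2 *s \<beta> = p *s \<gamma>" by (simp add: x_def)
    have "p \<le> 4" using zdvd_imp_le [of p 4] 4 by (metis dvd_triv_left zero_less_numeral)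
    then have "p = 1 \<or> p = 2 \<or> p = 3 \<or> p = 4" using pp by linarith
    then show False
    proof (elim disjE)
      assume "p = 1"
      then have "2 *s \<beta> \<in> R" using eq \<gamma> by simp
      then show False using root_primitive by fastforce
    next
      assume "p = 2"
      then show False using eq ne by (simp add: vec_eq_iff)
    next
      assume "p = 3"
      then show False using 4 by presburger
    next
      assume "p = 4"
      then have "\<beta> = 2 *s \<gamma>" using eq by (simp add: vec_eq_iff)
      then have "2 *s \<gamma> \<in> R" using \<beta> by simp
      then show False using root_primitive by fastforce
    qed
  qed
  have "B x x \<ge> 0" using form_pos [of x] by (cases "x = 0") (auto simp: root_form_def)
  then have "p * p' \<le> 4" using x bp by (simp add: zero_le_mult_iff)
  with not4 show 3: "p * p' \<le> 3" by linarith
  show "p = 1 \<or> p' = 1"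
  proof (rule ccontr)
    assume "\<not> ?thesis"
    then have "2 * 2 \<le> p * p'" using pp by (intro mult_mono) auto
    then show False using 3 by simp
  qed
qed

lemma root_diff:
  assumes "\<beta> \<in> R" "\<gamma> \<in> R" "B \<beta> \<gamma> > 0" "\<beta> \<noteq> \<gamma>"
  shows "\<beta> - \<gamma> \<in> R"
proof -
  obtain p where p: "2 * B \<beta> \<gamma> = p * B \<gamma> \<gamma>" "\<beta> - p *s \<gamma> \<in> R"
    using root_pairing [OF assms(2), of \<beta>] assms(1) by blast
  obtain p' where p': "2 * B \<gamma> \<beta> = p' * B \<beta> \<beta>" "\<gamma> - p' *s \<beta> \<in> R"
    using root_pairing [OF assms(1), of \<gamma>] assms(2) by blast
  have "p = 1 \<or> p' = 1"
    using root_pairing_bound(4) [OF assms p(1)] p'(1) by (simp add: form_sym)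
  then show ?thesis using p(2) root_minus [OF p'(2)] by auto
qed

subsection \<open>The values of the symmetrizer\<close>

text \<open>Makes the lengths of simple roots comparable even when their nodes are not
  adjacent.\<close>

lemma ex_W_nonorthogonal: "\<exists>a. B (\<alpha> i) (W a (\<alpha> j)) \<noteq> 0"
proof (rule connected_induct [of "\<lambda>i. \<exists>a. B (\<alpha> i) (W a (\<alpha> j)) \<noteq> 0" j])
  show "\<exists>a. B (\<alpha> j) (W a (\<alpha> j)) \<noteq> 0" by (intro exI [of _ "[]"]) simp
next
  fix i k assume "\<exists>a. B (\<alpha> i) (W a (\<alpha> j)) \<noteq> 0" and ik: "cc i k \<noteq> 0"
  then obtain a where a: "B (\<alpha> i) (W a (\<alpha> j)) \<noteq> 0" by blast
  show "\<exists>a. B (\<alpha> k) (W a (\<alpha> j)) \<noteq> 0"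
  proof (cases "B (\<alpha> k) (W a (\<alpha> j)) = 0")
    case True
    \<comment> \<open>The reflection in the neighbour \<open>i\<close> carries a nonzero pairing
      across the edge.\<close>
    have "B (\<alpha> k) (W (i # a) (\<alpha> j)) = B (prefl cc i (\<alpha> k)) (W a (\<alpha> j))"
      using form_prefl [of i "prefl cc i (\<alpha> k)" "W a (\<alpha> j)"] by (simp add: pword_Cons)
    also have "prefl cc i (\<alpha> k) = \<alpha> k - cc i k *s \<alpha> i"
      by (simp add: prefl_def pform_axis axis_smult)
    finally have "B (\<alpha> k) (W (i # a) (\<alpha> j)) = - (cc i k * B (\<alpha> i) (W a (\<alpha> j)))"
      by (simp add: form_diff' form_smult' True)
    then show ?thesis using a ik by (intro exI [of _ "i # a"]) simp
  qed blast
qed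

lemma d_ratio: "d i = d j \<or> d i = 2 * d j \<or> d i = 3 * d j \<or> d j = 2 * d i \<or> d j = 3 * d i"
proof -
  obtain a where a: "B (\<alpha> i) (W a (\<alpha> j)) \<noteq> 0" using ex_W_nonorthogonal by blast
  define \<gamma> where "\<gamma> = (if B (\<alpha> i) (W a (\<alpha> j)) > 0 then W a (\<alpha> j) else - W a (\<alpha> j))"
  have \<gamma>: "\<gamma> \<in> R" "B (\<alpha> i) \<gamma> > 0" "B \<gamma> \<gamma> = 2 * int (d j)"
    using a root_W simple_root_in root_minus by (auto simp: \<gamma>_def form_minus form_minus' form_W)
  show ?thesis
  proof (cases "\<alpha> i = \<gamma>")
    case True
    then show ?thesis using \<gamma>(3) by auto
  next
    case False
    obtain p where p: "2 * B (\<alpha> i) \<gamma> = p * B \<gamma> \<gamma>" using root_pairing [OF \<gamma>(1)] by blast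
    obtain p' where "2 * B \<gamma> (\<alpha> i) = p' * B (\<alpha> i) (\<alpha> i)"
      using root_pairing [OF simple_root_in] by blast
    then have p': "2 * B (\<alpha> i) \<gamma> = p' * B (\<alpha> i) (\<alpha> i)" by (simp add: form_sym)
    note pp = root_pairing_bound [OF simple_root_in \<gamma>(1,2) False p p']
    have eq: "p * int (d j) = p' * int (d i)" using p p' \<gamma>(3) by simp
    from pp(4) show ?thesis
    proof
      assume "p = 1"
      then have "p' = 1 \<or> p' = 2 \<or> p' = 3" using pp by auto
      then show ?thesis using eq \<open>p = 1\<close> by auto
    next
      assume "p' = 1"
      then have "p = 1 \<or> p = 2 \<or> p = 3" using pp by auto
      then show ?thesis using eq \<open>p' = 1\<close> by auto
    qed
  qed
qed

definition dmax :: nat where "dmax = Max (range d)"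

lemma d_le_dmax: "d i \<le> dmax"
  by (simp add: dmax_def)

lemma dmax_pos: "dmax > 0"
  using d_le_dmax [of undefined] d_pos [of undefined] by linarith

lemma ex_d_dmax: "\<exists>i. d i = dmax"
proof -
  have "dmax \<in> range d" unfolding dmax_def by (rule Max_in) auto
  then show ?thesis by auto
qed

text \<open>By \<open>d_ratio\<close> the smallest value divides all the others, hence their gcd,
  which is 1.\<close>

lemma ex_d_1: "\<exists>i. d i = 1" and d_le_3: "d i \<le> 3"
proof -
  have "Min (range d) \<in> range d" by (rule Min_in) auto
  then obtain i0 where i0: "d i0 = Min (range d)" by (metis imageE)
  then have min: "d i0 \<le> d j" for j by simp
  have mult: "d j = d i0 \<or> d j = 2 * d i0 \<or> d j = 3 * d i0" for j
    using d_ratio [of j i0] min [of j] d_pos [of j] by linarith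
  then have "d i0 dvd d j" for j using dvd_triv_right [of "d i0"] by (metis dvd_refl)
  then have "d i0 dvd Gcd (range d)" by (intro Gcd_greatest) auto
  then have 1: "d i0 = 1" by (simp add: Gcd_d)
  then show "\<exists>i. d i = 1" by blast
  show "d i \<le> 3" using mult [of i] 1 by linarith
qed

text \<open>With values up to 3, only 2 below a maximum of 3 has to be excluded, and
  \<open>d_ratio\<close> does that.\<close>

lemma d_cases: "d i = 1 \<or> d i = dmax"
proof -
  obtain j where "d j = dmax" using ex_d_dmax by blast
  then show ?thesis
    using d_ratio [of i j] d_le_dmax [of i] d_le_3 [of j] d_pos [of i] by linarith
qed

lemma cc_adjacent:
  assumes "i \<noteq> j" "cc i j \<noteq> 0"
  shows "cc i j \<le> - 1" "cc j i \<le> - 1" "cc i j = - 1 \<or> cc j i = - 1"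
proof -
  show 1: "cc i j \<le> - 1" "cc j i \<le> - 1"
    using cc_offdiag [of i j] cc_offdiag [of j i] cc_zero_iff [of i j] assms by auto
  show "cc i j = - 1 \<or> cc j i = - 1"
  proof (rule ccontr)
    assume "\<not> ?thesis"
    then have "2 * 2 \<le> (- cc i j) * (- cc j i)" using 1 by (intro mult_mono) auto
    then show False using cc_mult_less [OF assms(1)] by simp
  qed
qed

lemma d_ge_1: "1 \<le> int (d i)"
  using d_pos [of i] by linarith

text \<open>Serves two ends: comparing edge multiplicities with \<open>dmax\<close>, and limiting
  how far the entries of \<open>C(q,t)\<close> raise the power of \<open>q\<close> in
  \<open>qt_bounded_nvec\<close>.\<close>

lemma cc_bound: "i \<noteq> j \<Longrightarrow> - cc i j \<le> int (d j)"
proof (cases "cc i j = 0")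
  case False
  assume "i \<noteq> j"
  note adj = cc_adjacent [OF this False]
  from adj(3) show ?thesis
  proof
    assume "cc i j = - 1"
    then show ?thesis using d_pos [of j] by linarith
  next
    assume "cc j i = - 1"
    then have "int (d i) * (- cc i j) = int (d j)" using d_sym [of i j] by simp
    moreover have "1 * (- cc i j) \<le> int (d i) * (- cc i j)"
      using adj(1) by (intro mult_right_mono d_ge_1) auto
    ultimately show ?thesis by linarith
  qed
qed simp

lemma lacing_eq_dmax: "lacing C = int dmax"
  unfolding lacing_def
proof (rule Max_eqI)
  have "{cc i j * cc j i |i j. i \<noteq> j} \<subseteq> (\<lambda>(i, j). cc i j * cc j i) ` UNIV" by auto
  then show "finite (insert 1 {cc i j * cc j i |i j. i \<noteq> j})"
    using finite_subset by fastforce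
next
  fix y assume "y \<in> insert 1 {cc i j * cc j i |i j. i \<noteq> j}"
  then consider "y = 1" | i j where "i \<noteq> j" "y = cc i j * cc j i" by blast
  then show "y \<le> int dmax"
  proof cases
    case 1
    then show ?thesis using dmax_pos by linarith
  next
    case 2
    show ?thesis
    proof (cases "cc i j = 0")
      case False
      from cc_adjacent(3) [OF 2(1) this] have "y = - cc i j \<or> y = - cc j i" using 2(2) by auto
      moreover have "- cc i j \<le> int dmax" "- cc j i \<le> int dmax"
        using cc_bound [of i j] cc_bound [of j i] d_le_dmax [of i] d_le_dmax [of j] 2(1) by auto
      ultimately show ?thesis by auto
    qed (simp add: 2)
  qed
next
  show "int dmax \<in> insert 1 {cc i j * cc j i |i j. i \<noteq> j}"
  proof (cases "dmax = 1")
    case False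
    obtain i0 where i0: "d i0 = 1" using ex_d_1 by blast
    \<comment> \<open>Connectedness gives an edge from a short to a long simple root, where the
      multiplicity \<open>dmax\<close> is attained.\<close>
    have "\<exists>i j. d i = 1 \<and> cc i j \<noteq> 0 \<and> d j \<noteq> 1"
    proof (rule ccontr)
      assume "\<not> ?thesis"
      then have "d k = 1" for k using connected_induct [of "\<lambda>i. d i = 1" i0 k] i0 by blast
      then show False using ex_d_dmax False by metis
    qed
    then obtain i j where ij: "d i = 1" "cc i j \<noteq> 0" "d j \<noteq> 1" by blast
    then have dj: "d j = dmax" using d_cases by blast
    have ne: "i \<noteq> j" using ij by auto
    note adj = cc_adjacent [OF ne ij(2)]
    have eq: "cc i j = int dmax * cc j i" using d_sym [of i j] ij dj by simp
    have big: "dmax \<ge> 2" using False d_pos [of j] dj by linarith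
    have "cc j i = - 1"
    proof (rule ccontr)
      assume "cc j i \<noteq> - 1"
      then have "- cc i j = 1" using adj(3) by simp
      moreover have "2 * 1 \<le> int dmax * (- cc j i)" using big adj by (intro mult_mono) auto
      ultimately show False using eq by simp
    qed
    then have "int dmax = cc i j * cc j i" using eq by simp
    then show ?thesis using ne by blast
  qed simp
qed

subsection \<open>The highest root\<close>

definition height :: "int ^ 'n \<Rightarrow> int" where
  "height x = (\<Sum>k\<in>UNIV. x $ k)"

lemma finite_ex_max:
  fixes f :: "'b \<Rightarrow> int"
  assumes "finite S" "S \<noteq> {}"
  shows "\<exists>x\<in>S. \<forall>y\<in>S. f y \<le> f x"
proof -
  have "Max (f ` S) \<in> f ` S" using assms by (intro Max_in) auto
  then obtain x where "x \<in> S" "Max (f ` S) = f x" by auto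
  then show ?thesis using assms(1) by (metis Max_ge finite_imageI imageI)
qed

lemma height_strict: "nonneg (y - x) \<Longrightarrow> x \<noteq> y \<Longrightarrow> height x < height y"
proof -
  assume *: "nonneg (y - x)" "x \<noteq> y"
  then obtain k where "x $ k \<noteq> y $ k" by (auto simp: vec_eq_iff)
  moreover have "x $ k \<le> y $ k" for k using *(1) by (simp add: nonneg_def)
  ultimately show ?thesis
    unfolding height_def by (intro sum_strict_mono_ex1) (auto simp: order_le_less)
qed

definition dominant :: "int ^ 'n \<Rightarrow> bool" where
  "dominant x \<longleftrightarrow> (\<forall>i. pform cc i x \<ge> 0)"

lemma form_dominant: "nonneg x \<Longrightarrow> dominant y \<Longrightarrow> B x y \<ge> 0"
  unfolding form_eq_pform by (intro sum_nonneg) (simp add: nonneg_def dominant_def)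

definition maximal :: "int ^ 'n \<Rightarrow> bool" where
  "maximal \<theta> \<longleftrightarrow> \<theta> \<in> \<Phi> \<and> (\<forall>\<beta>\<in>\<Phi>. nonneg (\<beta> - \<theta>) \<longrightarrow> \<beta> = \<theta>)"

lemma not_dominant_increase:
  assumes "\<not> dominant x"
  obtains i where "nonneg (prefl cc i x - x)" "prefl cc i x \<noteq> x"
proof -
  obtain i where i: "pform cc i x < 0" using assms by (auto simp: dominant_def not_le)
  have "prefl cc i x - x = axis i (- pform cc i x)" by (simp add: prefl_def axis_minus)
  then have "nonneg (prefl cc i x - x)" "(prefl cc i x - x) $ i \<noteq> 0"
    using i by (auto simp: nonneg_def axis_def)
  moreover from this(2) have "prefl cc i x \<noteq> x" by auto
  ultimately show ?thesis using that by blast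
qed

lemma maximal_dominant: "maximal \<theta> \<Longrightarrow> dominant \<theta>"
proof (rule ccontr)
  assume \<theta>: "maximal \<theta>" and "\<not> dominant \<theta>"
  then obtain i where i: "nonneg (prefl cc i \<theta> - \<theta>)" "prefl cc i \<theta> \<noteq> \<theta>"
    using not_dominant_increase by blast
  have "nonneg \<theta>" "\<theta> \<in> R" using \<theta> by (auto simp: maximal_def \<Phi>_def)
  then have "nonneg (prefl cc i \<theta>)" using nonneg_add [OF \<open>nonneg \<theta>\<close> i(1)] by simp
  then have "prefl cc i \<theta> \<in> \<Phi>" using \<open>\<theta> \<in> R\<close> root_prefl by (simp add: \<Phi>_def)
  then show False using \<theta> i by (auto simp: maximal_def)
qed

text \<open>A zero coefficient next to a positive one makes the pairing at that node negative,
  against dominance.\<close>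

lemma maximal_support:
  fixes \<theta> :: "int ^ 'n"
  assumes "maximal \<theta>"
  shows "\<theta> $ k > 0"
proof -
  have nn: "\<theta> $ k \<ge> 0" for k using assms by (simp add: maximal_def \<Phi>_def nonneg_def)
  have "\<theta> \<noteq> 0" using assms root_nonzero by (simp add: maximal_def \<Phi>_def)
  then obtain k0 where "\<theta> $ k0 \<noteq> 0" by (auto simp: vec_eq_iff)
  then have k0: "\<theta> $ k0 > 0" using nn [of k0] by simp
  show ?thesis
  proof (rule connected_induct [of "\<lambda>k. \<theta> $ k > 0", OF k0])
    fix i j assume i: "\<theta> $ i > 0" and ij: "cc i j \<noteq> 0"
    show "\<theta> $ j > 0"
    proof (rule ccontr)
      assume "\<not> \<theta> $ j > 0"
      then have j: "\<theta> $ j = 0" using nn [of j] by simp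
      have "cc j k * \<theta> $ k \<le> 0" for k
        using cc_offdiag [of j k] nn [of k] j by (cases "k = j") (auto simp: mult_nonpos_nonneg)
      moreover have "cc j i * \<theta> $ i < 0"
        using cc_offdiag [of j i] cc_zero_iff [of i j] ij i j
        by (metis less_irrefl mult_neg_pos order_le_less)
      ultimately have "pform cc j \<theta> < 0"
        using sum_strict_mono_ex1 [of UNIV "\<lambda>k. cc j k * \<theta> $ k" "\<lambda>_. 0"] by (auto simp: pform_def)
      then show False using maximal_dominant [OF assms] unfolding dominant_def by (metis not_le)
    qed
  qed
qed

text \<open>Full support against dominance gives a positive product, so the difference is a root;
  whatever its sign, one of the two is not maximal.\<close>

lemma maximal_unique:
  assumes "maximal \<theta>" "maximal \<eta>"
  shows "\<theta> = \<eta>"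
proof (rule ccontr)
  assume ne: "\<theta> \<noteq> \<eta>"
  have R: "\<theta> \<in> R" "\<eta> \<in> R" using assms by (auto simp: maximal_def \<Phi>_def)
  have dom: "pform cc i \<eta> \<ge> 0" for i using maximal_dominant [OF assms(2)] by (simp add: dominant_def)
  have "\<exists>i. pform cc i \<eta> \<noteq> 0"
  proof (rule ccontr)
    assume "\<not> ?thesis"
    then have "B \<eta> \<eta> = 0" by (simp add: form_eq_pform)
    then show False using root_form_pos [OF R(2)] by simp
  qed
  then obtain i where "pform cc i \<eta> > 0" using dom by (metis order_le_less)
  then have "int (d i) * \<theta> $ i * pform cc i \<eta> > 0" using maximal_support [OF assms(1)] by simp
  moreover have "int (d j) * \<theta> $ j * pform cc j \<eta> \<ge> 0" for j
    using maximal_support [OF assms(1), of j] dom [of j] by simp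
  ultimately have "B \<theta> \<eta> > 0" unfolding form_eq_pform by (intro sum_pos2) auto
  from root_sign [OF root_diff [OF R this ne]] show False
  proof
    assume "nonneg (\<theta> - \<eta>)"
    then show False using assms ne by (auto simp: maximal_def)
  next
    assume "nonneg (- (\<theta> - \<eta>))"
    then show False using assms ne by (auto simp: maximal_def)
  qed
qed

lemma ex_maximal_above:
  assumes "\<beta> \<in> \<Phi>"
  obtains \<theta> where "maximal \<theta>" "nonneg (\<theta> - \<beta>)"
proof -
  let ?S = "{x \<in> \<Phi>. nonneg (x - \<beta>)}"
  have "\<beta> \<in> ?S" using assms by (simp add: nonneg_def)
  moreover have "finite ?S" by simp
  ultimately obtain \<theta> where \<theta>: "\<theta> \<in> ?S" "\<And>x. x \<in> ?S \<Longrightarrow> height x \<le> height \<theta>"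
    using finite_ex_max [of ?S height] by blast
  have "maximal \<theta>"
    unfolding maximal_def
  proof (intro conjI ballI impI)
    show "\<theta> \<in> \<Phi>" using \<theta> by simp
  next
    fix x assume x: "x \<in> \<Phi>" "nonneg (x - \<theta>)"
    then have "nonneg (x - \<beta>)" using \<theta>(1) nonneg_add [of "x - \<theta>" "\<theta> - \<beta>"] by simp
    then have "height x \<le> height \<theta>" using \<theta>(2) x by simp
    then show "x = \<theta>" using height_strict [OF x(2)] by force
  qed
  then show ?thesis using that \<theta> by blast
qed

abbreviation \<theta> :: "int ^ 'n" where "\<theta> \<equiv> highest_root C"

lemma highest_root: "maximal \<theta>" "\<And>\<beta>. \<beta> \<in> R \<Longrightarrow> nonneg (\<theta> - \<beta>)"
proof -
  obtain \<eta> where \<eta>: "maximal \<eta>" using ex_maximal_above simple_positive by blast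
  have above: "nonneg (\<eta> - \<beta>)" if "\<beta> \<in> R" for \<beta>
  proof (cases "nonneg \<beta>")
    case True
    then show ?thesis using ex_maximal_above [of \<beta>] that maximal_unique [OF \<eta>] by (auto simp: \<Phi>_def)
  next
    case False
    then have "nonneg (- \<beta>)" using root_sign that by blast
    moreover have "nonneg \<eta>" using \<eta> by (simp add: maximal_def \<Phi>_def)
    ultimately show ?thesis using nonneg_add [of \<eta> "- \<beta>"] by simp
  qed
  have "\<theta> = \<eta>"
    unfolding highest_root_def
  proof (rule the_equality)
    show "\<eta> \<in> R \<and> (\<forall>\<beta>\<in>R. \<forall>i. \<beta> $ i \<le> \<eta> $ i)"
      using above \<eta> by (auto simp: maximal_def \<Phi>_def nonneg_def)
  next
    fix x assume x: "x \<in> R \<and> (\<forall>\<beta>\<in>R. \<forall>i. \<beta> $ i \<le> x $ i)"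
    have "\<eta> \<in> R" using \<eta> by (simp add: maximal_def \<Phi>_def)
    then have "\<eta> $ i \<le> x $ i" "x $ i \<le> \<eta> $ i" for i
      using x above [of x] by (auto simp: nonneg_def)
    then show "x = \<eta>" by (auto simp: vec_eq_iff intro: antisym)
  qed
  then show "maximal \<theta>" "\<And>\<beta>. \<beta> \<in> R \<Longrightarrow> nonneg (\<theta> - \<beta>)" using \<eta> above by auto
qed

lemma \<theta>_root: "\<theta> \<in> R" and \<theta>_pos: "\<theta> \<in> \<Phi>" and \<theta>_nonneg: "\<theta> $ i \<ge> 0"
  and \<theta>_dominant: "dominant \<theta>"
  using highest_root(1) maximal_dominant by (auto simp: maximal_def \<Phi>_def nonneg_def)

text \<open>A conjugate \<gamma> of greatest height is dominant, so \<open>B \<gamma> \<gamma> \<le>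
  B \<theta> \<gamma> \<le> B \<theta> \<theta>\<close>.\<close>

lemma \<theta>_long:
  assumes "\<beta> \<in> R"
  shows "B \<beta> \<beta> \<le> B \<theta> \<theta>"
proof -
  let ?S = "range (\<lambda>a. W a \<beta>)"
  have "finite ?S" using finite_roots root_W [OF assms] by (intro finite_subset [of ?S R]) auto
  then obtain a where a: "\<And>b. height (W b \<beta>) \<le> height (W a \<beta>)"
    using finite_ex_max [of ?S height] by auto
  define \<gamma> where "\<gamma> = W a \<beta>"
  have "dominant \<gamma>"
  proof (rule ccontr)
    assume "\<not> dominant \<gamma>"
    then obtain i where "nonneg (prefl cc i \<gamma> - \<gamma>)" "prefl cc i \<gamma> \<noteq> \<gamma>"
      using not_dominant_increase by blast
    then have "height \<gamma> < height (prefl cc i \<gamma>)" by (intro height_strict) auto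
    then show False using a [of "i # a"] by (simp add: \<gamma>_def pword_Cons)
  qed
  moreover have nn: "nonneg (\<theta> - \<gamma>)" using highest_root(2) root_W assms by (simp add: \<gamma>_def)
  ultimately have "B (\<theta> - \<gamma>) \<gamma> \<ge> 0" "B (\<theta> - \<gamma>) \<theta> \<ge> 0"
    using form_dominant \<theta>_dominant by blast+
  then have "B \<gamma> \<gamma> \<le> B \<theta> \<theta>" by (simp add: form_diff' form_sym [of \<gamma> \<theta>])
  then show ?thesis by (simp add: \<gamma>_def form_W)
qed

lemma form_\<theta>: "B \<theta> \<theta> = 2 * int dmax"
proof (rule antisym)
  show "B \<theta> \<theta> \<le> 2 * int dmax" using root_form_eq [OF \<theta>_root] d_le_dmax by auto
next
  obtain i where "d i = dmax" using ex_d_dmax by blast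
  then show "2 * int dmax \<le> B \<theta> \<theta>" using \<theta>_long [OF simple_root_in, of i] by simp
qed

text \<open>The pairing with the coroot of \<theta> is 0 or 1, since a larger value would make
  \<beta> longer than \<theta>.\<close>

lemma form_\<theta>_cases:
  assumes "\<beta> \<in> \<Phi>" "\<beta> \<noteq> \<theta>"
  shows "B \<beta> \<theta> = 0 \<or> B \<beta> \<theta> = int dmax"
proof (cases "B \<beta> \<theta> = 0")
  case False
  have \<beta>: "\<beta> \<in> R" "nonneg \<beta>" using assms by (auto simp: \<Phi>_def)
  then have pos: "B \<beta> \<theta> > 0" using False form_dominant \<theta>_dominant by (metis order_le_less)
  obtain p where p: "2 * B \<beta> \<theta> = p * B \<theta> \<theta>" using root_pairing [OF \<theta>_root] by blast
  obtain p' where "2 * B \<theta> \<beta> = p' * B \<beta> \<beta>" using root_pairing [OF \<beta>(1)] by blast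
  then have p': "2 * B \<beta> \<theta> = p' * B \<beta> \<beta>" by (simp add: form_sym)
  note pp = root_pairing_bound [OF \<beta>(1) \<theta>_root pos assms(2) p p']
  have "p = 1"
  proof (rule ccontr)
    assume "p \<noteq> 1"
    then have "p' = 1" "p \<ge> 2" using pp by auto
    then have "p * B \<theta> \<theta> = B \<beta> \<beta>" using p p' by simp
    moreover have "2 * B \<theta> \<theta> \<le> p * B \<theta> \<theta>"
      using \<open>p \<ge> 2\<close> root_form_pos [OF \<theta>_root] by (intro mult_right_mono) auto
    ultimately show False using \<theta>_long [OF \<beta>(1)] root_form_pos [OF \<theta>_root] by linarith
  qed
  then show ?thesis using p form_\<theta> by simp
qed simp

subsection \<open>The operator \<open>\<Sum>\<^sub>\<beta> m\<^sub>\<beta> (\<beta>, \<cdot>) \<beta>\<close>\<close>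

text \<open>The simple reflection \<open>s\<^sub>i\<close> changes the sign of the image of \<open>\<alpha>\<^sub>i\<close>, so the operator is a scalar.
  Comparing its trace with its value at the highest root expresses \<open>h\<close> (for \<open>m\<^sub>\<beta> = 1/(\<beta>,\<beta>)\<close>) and
  \<open>h\<^sup>\<or>\<close> (for \<open>m\<^sub>\<beta> = 1\<close>) through the positive roots.\<close>

lemma sum_prefl_odd:
  fixes f :: "int ^ 'n \<Rightarrow> real"
  assumes "\<And>\<beta>. f (prefl cc i \<beta>) = - f \<beta>"
  shows "(\<Sum>\<beta>\<in>\<Phi>. f \<beta>) = f (\<alpha> i)"
proof -
  have "(\<Sum>\<beta>\<in>\<Phi> - {\<alpha> i}. f \<beta>) = - (\<Sum>\<beta>\<in>\<Phi> - {\<alpha> i}. f \<beta>)"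
    using sum_prefl_positive [of f i] by (simp add: assms sum_negf)
  then show ?thesis using simple_positive [of i] by (simp add: sum.remove [of \<Phi> "\<alpha> i"])
qed

lemma form_simple_prefl: "B (\<alpha> i) (prefl cc i \<beta>) = - B (\<alpha> i) \<beta>"
  using form_prefl [of i "\<alpha> i" \<beta>]
  by (simp add: prefl_simple form_minus')

context
  fixes w :: "int \<Rightarrow> real"
begin

text \<open>By \<open>sum_form_coeff\<close> this is the eigenvalue of the operator on
  \<open>\<alpha> i\<close>.\<close>

definition K :: "'n \<Rightarrow> real" where
  "K i = (\<Sum>\<beta>\<in>\<Phi>. w (B \<beta> \<beta>) * B (\<alpha> i) \<beta> * \<beta> $ i)"

lemma sum_form_simple: "(\<Sum>\<beta>\<in>\<Phi>. w (B \<beta> \<beta>) * B (\<alpha> i) \<beta>) = w (2 * int (d i)) * (2 * d i)"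
  by (subst sum_prefl_odd [of _ i]) (simp_all add: form_prefl form_simple_prefl)

lemma sum_form_coeff: "(\<Sum>\<beta>\<in>\<Phi>. w (B \<beta> \<beta>) * B (\<alpha> i) \<beta> * \<beta> $ k) = (if k = i then K i else 0)"
proof (cases "k = i")
  case False
  have same: "prefl cc i \<beta> $ k = \<beta> $ k" for \<beta> using False by (simp add: prefl_def axis_def)
  show ?thesis
    by (subst sum_prefl_odd [of _ i])
      (use False in \<open>simp_all add: form_prefl form_simple_prefl same simple_nth\<close>)
qed (simp add: K_def)

lemma sum_form_form:
  "(\<Sum>\<beta>\<in>\<Phi>. w (B \<beta> \<beta>) * B x \<beta> * B \<beta> y) = (\<Sum>i\<in>UNIV. x $ i * K i * B (\<alpha> i) y)"
proof -
  have "(\<Sum>\<beta>\<in>\<Phi>. w (B \<beta> \<beta>) * B x \<beta> * B \<beta> y)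
      = (\<Sum>\<beta>\<in>\<Phi>. \<Sum>i\<in>UNIV. \<Sum>k\<in>UNIV. x $ i * (w (B \<beta> \<beta>) * B (\<alpha> i) \<beta> * \<beta> $ k) * B (\<alpha> k) y)"
    by (subst form_eq_sum [of x], subst form_eq_sum [of _ y])
      (simp add: sum_product sum_distrib_left algebra_simps)
  also have "\<dots> = (\<Sum>i\<in>UNIV. \<Sum>\<beta>\<in>\<Phi>. \<Sum>k\<in>UNIV. x $ i * (w (B \<beta> \<beta>) * B (\<alpha> i) \<beta> * \<beta> $ k) * B (\<alpha> k) y)"
    by (rule sum.swap)
  also have "\<dots> = (\<Sum>i\<in>UNIV. \<Sum>k\<in>UNIV. \<Sum>\<beta>\<in>\<Phi>. x $ i * (w (B \<beta> \<beta>) * B (\<alpha> i) \<beta> * \<beta> $ k) * B (\<alpha> k) y)"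
    by (intro sum.cong HOL.refl sum.swap)
  also have "\<dots> = (\<Sum>i\<in>UNIV. \<Sum>k\<in>UNIV. x $ i * (if k = i then K i else 0) * B (\<alpha> k) y)"
    by (simp only: sum_form_coeff [symmetric] sum_distrib_left sum_distrib_right)
  also have "\<dots> = (\<Sum>i\<in>UNIV. x $ i * K i * B (\<alpha> i) y)"
    by (simp add: if_distrib [where f = "\<lambda>x. _ * x"] if_distrib [where f = "\<lambda>x. x * _"] cong: if_cong)
  finally show ?thesis .
qed

text \<open>The operator is symmetric for the form, so simple roots that are not orthogonal share
  their eigenvalue.\<close>

lemma K_const: "K i = K j"
proof (rule connected_induct [of "\<lambda>j. K i = K j" i])
  fix j k assume IH: "K i = K j" and jk: "cc j k \<noteq> 0"
  have simp: "(\<Sum>\<beta>\<in>\<Phi>. w (B \<beta> \<beta>) * B (\<alpha> p) \<beta> * B \<beta> (\<alpha> q)) = K p * B (\<alpha> p) (\<alpha> q)" for p q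
    unfolding sum_form_form
    by (simp add: simple_nth if_distrib [where f = "\<lambda>x. x * _"] if_distrib [where f = real_of_int] cong: if_cong)
  have "K j * B (\<alpha> j) (\<alpha> k) = K k * B (\<alpha> k) (\<alpha> j)"
    unfolding simp [symmetric] by (simp add: form_sym mult_ac)
  moreover have "B (\<alpha> j) (\<alpha> k) \<noteq> 0" using jk by (simp add: form_axis pform_axis)
  ultimately show "K i = K k" using IH by (simp add: form_sym [of "\<alpha> k"])
qed simp

lemma K_trace: "real CARD('n) * K i = (\<Sum>\<beta>\<in>\<Phi>. w (B \<beta> \<beta>) * B \<beta> \<beta>)"
proof -
  have "real CARD('n) * K i = (\<Sum>k\<in>(UNIV :: 'n set). K i)" by simp
  also have "\<dots> = (\<Sum>k\<in>UNIV. K k)" by (intro sum.cong HOL.refl K_const)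
  also have "\<dots> = (\<Sum>\<beta>\<in>\<Phi>. \<Sum>k\<in>UNIV. w (B \<beta> \<beta>) * B (\<alpha> k) \<beta> * \<beta> $ k)"
    unfolding K_def by (rule sum.swap)
  also have "\<dots> = (\<Sum>\<beta>\<in>\<Phi>. w (B \<beta> \<beta>) * B \<beta> \<beta>)"
    by (subst (3) form_eq_sum) (simp add: sum_distrib_left mult_ac)
  finally show ?thesis .
qed

lemma K_\<theta>: "K i = (\<Sum>k\<in>UNIV. \<theta> $ k * w (2 * int (d k)) * d k) + dmax * w (2 * int dmax)"
proof -
  let ?g = "\<lambda>\<beta>. w (B \<beta> \<beta>) * B \<theta> \<beta>"
  have dm: "real dmax > 0" using dmax_pos by simp
  have lin: "(\<Sum>\<beta>\<in>\<Phi>. ?g \<beta>) = 2 * (\<Sum>k\<in>UNIV. \<theta> $ k * w (2 * int (d k)) * d k)"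
  proof -
    have "(\<Sum>\<beta>\<in>\<Phi>. ?g \<beta>) = (\<Sum>\<beta>\<in>\<Phi>. \<Sum>k\<in>UNIV. \<theta> $ k * (w (B \<beta> \<beta>) * B (\<alpha> k) \<beta>))"
      by (subst (2) form_eq_sum) (simp add: sum_distrib_left mult_ac)
    also have "\<dots> = (\<Sum>k\<in>UNIV. \<theta> $ k * (\<Sum>\<beta>\<in>\<Phi>. w (B \<beta> \<beta>) * B (\<alpha> k) \<beta>))"
      by (subst sum.swap) (simp add: sum_distrib_left)
    finally show ?thesis by (simp add: sum_form_simple sum_distrib_left mult_ac)
  qed
  have "K i * (2 * dmax) = K i * B \<theta> \<theta>" by (simp add: form_\<theta>)
  also have "\<dots> = (\<Sum>k\<in>UNIV. \<theta> $ k * K i * B (\<alpha> k) \<theta>)"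
    by (subst form_eq_sum) (simp add: sum_distrib_left mult_ac)
  also have "\<dots> = (\<Sum>k\<in>UNIV. \<theta> $ k * K k * B (\<alpha> k) \<theta>)"
    by (intro sum.cong HOL.refl arg_cong2 [where f = times] K_const)
  also have "\<dots> = (\<Sum>\<beta>\<in>\<Phi>. ?g \<beta> * B \<beta> \<theta>)" by (simp add: sum_form_form)
  also have "\<dots> = ?g \<theta> * B \<theta> \<theta> + (\<Sum>\<beta>\<in>\<Phi> - {\<theta>}. ?g \<beta> * B \<beta> \<theta>)"
    using \<theta>_pos by (simp add: sum.remove)
  \<comment> \<open>Where \<open>B \<beta> \<theta>\<close> is not \<open>dmax\<close> it is 0, and
    then \<open>?g \<beta>\<close> is 0 too.\<close>
  also have "(\<Sum>\<beta>\<in>\<Phi> - {\<theta>}. ?g \<beta> * B \<beta> \<theta>) = (\<Sum>\<beta>\<in>\<Phi> - {\<theta>}. ?g \<beta> * dmax)"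
    using form_\<theta>_cases by (intro sum.cong) (force simp: form_sym [of \<theta>])+
  also have "\<dots> = ((\<Sum>\<beta>\<in>\<Phi>. ?g \<beta>) - ?g \<theta>) * dmax"
    using \<theta>_pos by (simp add: sum.remove [of \<Phi> \<theta>] sum_distrib_right)
  finally have "K i * (2 * dmax) = 2 * dmax * ((\<Sum>k\<in>UNIV. \<theta> $ k * w (2 * int (d k)) * d k) + dmax * w (2 * int dmax))"
    unfolding lin form_\<theta> by (simp add: algebra_simps)
  then show ?thesis using dm by simp
qed

lemma weighted_length:
  "real CARD('n) * ((\<Sum>k\<in>UNIV. \<theta> $ k * w (2 * int (d k)) * d k) + dmax * w (2 * int dmax))
     = (\<Sum>i\<leftarrow>a0. w (2 * int (d i)) * (2 * d i))"
  using K_trace [of undefined] sum_positive_roots [of "\<lambda>x. w x * x"] by (simp add: K_\<theta>)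

end

text \<open>With weight \<open>1 / (\<beta>, \<beta>)\<close> every letter of \<open>a0\<close>
  counts 1, and the eigenvalue is half of \<open>height \<theta> + 1\<close>.\<close>

lemma coxeter_length: "int CARD('n) * coxeter_number C = 2 * int (length a0)"
proof -
  have [simp]: "d i \<noteq> 0" for i using d_pos [of i] by linarith
  have "real CARD('n) * ((\<Sum>k\<in>UNIV. \<theta> $ k * (1 / real_of_int (2 * int (d k))) * d k)
      + dmax * (1 / real_of_int (2 * int dmax))) = (\<Sum>i\<leftarrow>a0. 1 / real_of_int (2 * int (d i)) * (2 * d i))"
    by (rule weighted_length)
  also have "(\<Sum>i\<leftarrow>a0. 1 / real_of_int (2 * int (d i)) * (2 * d i)) = length a0"
    by (simp add: sum_list_triv)
  also have "(\<Sum>k\<in>UNIV. \<theta> $ k * (1 / real_of_int (2 * int (d k))) * d k) = (\<Sum>k\<in>UNIV. \<theta> $ k) / 2"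
    by (simp add: sum_divide_distrib)
  also have "real dmax * (1 / real_of_int (2 * int dmax)) = 1 / 2"
    using dmax_pos by simp
  finally have "real CARD('n) * (\<Sum>k\<in>UNIV. \<theta> $ k) + CARD('n) = 2 * length a0"
    by (simp add: algebra_simps)
  then have "real_of_int (int CARD('n) * coxeter_number C) = real_of_int (2 * int (length a0))"
    by (simp add: coxeter_number_def algebra_simps)
  then show ?thesis by (simp only: of_int_eq_iff)
qed

text \<open>Makes the integer division in \<open>coroot_coeff\<close> exact. A simple reflection
  changes one coroot coefficient by an integral combination of all of them.\<close>

lemma coroot_divides: "\<beta> \<in> R \<Longrightarrow> B \<beta> \<beta> dvd 2 * int (d i) * \<beta> $ i"
proof -
  have "B (W a (\<alpha> k)) (W a (\<alpha> k)) dvd 2 * int (d i) * W a (\<alpha> k) $ i" for a k i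
  proof (induction a arbitrary: i)
    case Nil
    then show ?case by (simp add: simple_nth)
  next
    case (Cons j a)
    let ?x = "W a (\<alpha> k)"
    have "2 * int (d j) * pform cc j ?x = (\<Sum>l\<in>UNIV. (int (d j) * cc j l) * (2 * ?x $ l))"
      by (simp add: pform_def sum_distrib_left mult_ac)
    also have "\<dots> = (\<Sum>l\<in>UNIV. cc l j * (2 * int (d l) * ?x $ l))"
      by (simp add: d_sym [of j] mult_ac)
    finally have "B ?x ?x dvd 2 * int (d j) * pform cc j ?x"
      using Cons.IH by (simp add: dvd_sum)
    then show ?case
      using Cons.IH by (auto simp: pword_Cons form_prefl prefl_nth right_diff_distrib)
  qed
  then show "\<beta> \<in> R \<Longrightarrow> B \<beta> \<beta> dvd 2 * int (d i) * \<beta> $ i" by (auto simp: roots_iff)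
qed

lemma lacing_dual_coxeter:
  "lacing C * dual_coxeter_number C = int dmax + (\<Sum>k\<in>UNIV. int (d k) * \<theta> $ k)"
proof -
  have "int dmax * coroot_coeff C \<theta> k = int (d k) * \<theta> $ k" for k
    using coroot_divides [OF \<theta>_root, of k] by (auto simp: coroot_coeff_def form_\<theta> elim!: dvdE)
  then show ?thesis
    by (simp add: lacing_eq_dmax dual_coxeter_number_def distrib_left sum_distrib_left)
qed

text \<open>With weight 1 a letter \<open>i\<close> counts \<open>2 d\<^sub>i\<close>, and
  \<open>lacing_dual_coxeter\<close> identifies the eigenvalue.\<close>

lemma dual_coxeter_length:
  "int CARD('n) * (lacing C * dual_coxeter_number C) = 2 * (\<Sum>i\<leftarrow>a0. int (d i))"
proof -
  have *: "(\<Sum>i\<leftarrow>a. 2 * real (d i)) = real_of_int (2 * (\<Sum>i\<leftarrow>a. int (d i)))" for a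
    by (induction a) simp_all
  have "real CARD('n) * real_of_int ((\<Sum>k\<in>UNIV. \<theta> $ k * int (d k)) + int dmax)
      = (\<Sum>i\<leftarrow>a0. 2 * real (d i))"
    using weighted_length [of "\<lambda>_. 1"] by simp
  also note *
  finally have "real_of_int (int CARD('n) * (lacing C * dual_coxeter_number C))
      = real_of_int (2 * (\<Sum>i\<leftarrow>a0. int (d i)))"
    unfolding lacing_dual_coxeter by (simp add: algebra_simps)
  then show ?thesis by (simp only: of_int_eq_iff)
qed

lemma coxeter_pos: "coxeter_number C > 0"
  using \<theta>_nonneg by (simp add: coxeter_number_def sum_nonneg add_pos_nonneg)

lemma lacing_dual_coxeter_pos: "lacing C * dual_coxeter_number C > 0"
  using \<theta>_nonneg dmax_pos unfolding lacing_dual_coxeter by (intro add_pos_nonneg sum_nonneg) auto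

end

section \<open>Laurent series in two variables\<close>

definition qt_mono :: "int \<Rightarrow> int \<Rightarrow> qt_series" where
  "qt_mono a b = qpow a * tpow b"

lemma qt_coeff_add [simp]: "qt_coeff (F + G) u v = qt_coeff F u v + qt_coeff G u v"
  and qt_coeff_diff [simp]: "qt_coeff (F - G) u v = qt_coeff F u v - qt_coeff G u v"
  and qt_coeff_minus [simp]: "qt_coeff (- F) u v = - qt_coeff F u v"
  and qt_coeff_zero [simp]: "qt_coeff 0 u v = 0"
  by (simp_all add: qt_coeff_def)

lemma qt_coeff_sum: "qt_coeff (\<Sum>x\<in>K. f x) u v = (\<Sum>x\<in>K. qt_coeff (f x) u v)"
  by (induction K rule: infinite_finite_induct) simp_all

lemma qt_coeff_one: "qt_coeff 1 u v = (if u = 0 \<and> v = 0 then 1 else 0)"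
  by (simp add: qt_coeff_def)

lemma qt_series_eqI: "(\<And>u v. qt_coeff F u v = qt_coeff G u v) \<Longrightarrow> F = G"
proof (rule fls_eqI, rule fls_eqI)
  fix u v assume "\<And>u v. qt_coeff F u v = qt_coeff G u v"
  from this [of u "- v"] show "fls_nth (fls_nth F u) v = fls_nth (fls_nth G u) v"
    by (simp add: qt_coeff_def)
qed

lemma qt_coeff_mono_mult [simp]: "qt_coeff (qt_mono a b * F) u v = qt_coeff F (u - a) (v - b)"
  by (simp add: qt_mono_def qpow_def tpow_def qt_coeff_def mult.assoc fls_shifted_times_simps)

lemma qt_mono_zero [simp]: "qt_mono 0 0 = 1"
  by (simp add: qt_mono_def qpow_def tpow_def)

lemma qt_coeff_mono: "qt_coeff (qt_mono a b) u v = (if u = a \<and> v = b then 1 else 0)"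
  using qt_coeff_mono_mult [of a b 1 u v] by (auto simp: qt_coeff_one simp del: qt_coeff_mono_mult)

lemma qt_mono_mult: "qt_mono a b * qt_mono a' b' = qt_mono (a + a') (b + b')"
  by (rule qt_series_eqI) (auto simp: qt_coeff_mono)

lemma qt_mono_eq_iff: "qt_mono a b = qt_mono a' b' \<longleftrightarrow> a = a' \<and> b = b'"
proof
  assume "qt_mono a b = qt_mono a' b'"
  then have "qt_coeff (qt_mono a b) a b = qt_coeff (qt_mono a' b') a b" by simp
  then show "a = a' \<and> b = b'" by (auto simp: qt_coeff_mono split: if_splits)
qed simp

lemma qt_mono_power: "qt_mono a b ^ n = qt_mono (int n * a) (int n * b)"
  by (induction n) (simp_all add: qt_mono_mult algebra_simps)

lemma qpow_eq_mono: "qpow a = qt_mono a 0"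
  by (simp add: qt_mono_def qpow_def tpow_def)

text \<open>\<open>range mons\<close> consists of the Laurent polynomials with nonnegative coefficients.\<close>

definition mons :: "(int \<times> int) multiset \<Rightarrow> qt_series" where
  "mons M = (\<Sum>(a, b)\<in>#M. qt_mono a b)"

lemma mons_empty [simp]: "mons {#} = 0"
  and mons_add_mset [simp]: "mons (add_mset (a, b) M) = qt_mono a b + mons M"
  and mons_union: "mons (M + N) = mons M + mons N"
  by (simp_all add: mons_def)

lemma qt_coeff_mons: "qt_coeff (mons M) u v = int (count M (u, v))"
  by (induction M) (auto simp: qt_coeff_mono split: if_splits)

lemma qt_mono_mult_mons: "qt_mono a b * mons M = mons (image_mset (\<lambda>(c, e). (a + c, b + e)) M)"
  by (induction M) (auto simp: qt_mono_mult distrib_left)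

lemma mons_mult: "\<exists>P. mons M * mons N = mons P \<and> size P = size M * size N"
proof (induction M)
  case (add x M)
  then obtain P where "mons M * mons N = mons P" "size P = size M * size N" by blast
  then show ?case
    by (intro exI [of _ "image_mset (\<lambda>(c, e). (fst x + c, snd x + e)) N + P"], cases x)
      (simp add: distrib_right mons_union qt_mono_mult_mons)
qed simp

text \<open>The number of monomials, with multiplicity, is multiplicative because nothing
  cancels.\<close>

lemma mult_mons_eq_mono:
  assumes "F \<in> range mons" "G \<in> range mons" "F * G = qt_mono a b"
  shows "\<exists>c e. F = qt_mono c e"
proof -
  obtain M N where MN: "F = mons M" "G = mons N" using assms by auto
  obtain P where P: "mons M * mons N = mons P" "size P = size M * size N" using mons_mult by blast
  have "count P (u, v) = count {#(a, b)#} (u, v)" for u v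
    using arg_cong [OF assms(3), of "\<lambda>F. qt_coeff F u v"] P MN
    by (auto simp: qt_coeff_mons qt_coeff_mono split: if_splits)
  then have "P = {#(a, b)#}" by (intro multiset_eqI) (metis surj_pair)
  then have "size M = 1" using P(2) by simp
  then obtain x where "M = {#x#}" by (metis size_1_singleton_mset)
  then show ?thesis using MN by (cases x) auto
qed

lemma mons_closed:
  "0 \<in> range mons" "1 \<in> range mons" "qt_mono a b \<in> range mons"
  "F \<in> range mons \<Longrightarrow> G \<in> range mons \<Longrightarrow> F * G \<in> range mons"
  "F \<in> range mons \<Longrightarrow> G \<in> range mons \<Longrightarrow> F + G \<in> range mons"
proof -
  show "0 \<in> range mons" by (rule range_eqI [of _ _ "{#}"]) simp
  show "1 \<in> range mons" by (rule range_eqI [of _ _ "{#(0, 0)#}"]) simp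
  show "qt_mono a b \<in> range mons" by (rule range_eqI [of _ _ "{#(a, b)#}"]) simp
  assume "F \<in> range mons" "G \<in> range mons"
  then obtain M N where MN: "F = mons M" "G = mons N" by auto
  show "F * G \<in> range mons" using mons_mult [of M N] MN by auto
  show "F + G \<in> range mons" using mons_union [of M N] MN by (metis rangeI)
qed

lemma mons_closed_sum: "(\<And>x. x \<in> K \<Longrightarrow> f x \<in> range mons) \<Longrightarrow> (\<Sum>x\<in>K. f x) \<in> range mons"
  by (induction K rule: infinite_finite_induct) (simp_all add: mons_closed)

lemma mons_closed_power: "F \<in> range mons \<Longrightarrow> F ^ n \<in> range mons"
  by (induction n) (simp_all add: mons_closed)

lemma qt_coeff_range_mons: "F \<in> range mons \<Longrightarrow> qt_coeff F u v \<ge> 0"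
  by (auto simp: qt_coeff_mons)

text \<open>A relation instead of a map, since inverting \<open>q\<close> and \<open>t\<close> makes
  no sense for series with infinitely many terms.\<close>

definition bar_rel :: "qt_series \<Rightarrow> qt_series \<Rightarrow> bool" where
  "bar_rel F F' \<longleftrightarrow> (\<forall>u v. qt_coeff F' u v = qt_coeff F (- u) (- v))"

lemma bar_rel_diff: "bar_rel F F' \<Longrightarrow> bar_rel G G' \<Longrightarrow> bar_rel (F - G) (F' - G')"
  and bar_rel_add: "bar_rel F F' \<Longrightarrow> bar_rel G G' \<Longrightarrow> bar_rel (F + G) (F' + G')"
  and bar_rel_minus: "bar_rel F F' \<Longrightarrow> bar_rel (- F) (- F')"
  and bar_rel_zero: "bar_rel 0 0"
  by (simp_all add: bar_rel_def)

lemma bar_rel_sum: "(\<And>x. x \<in> K \<Longrightarrow> bar_rel (f x) (g x)) \<Longrightarrow> bar_rel (\<Sum>x\<in>K. f x) (\<Sum>x\<in>K. g x)"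
  by (induction K rule: infinite_finite_induct) (simp_all add: bar_rel_add bar_rel_zero)

lemma bar_rel_mono_mult: "bar_rel F F' \<Longrightarrow> bar_rel (qt_mono a b * F) (qt_mono (- a) (- b) * F')"
  by (simp add: bar_rel_def)

lemma bar_rel_mono: "bar_rel (qt_mono a b) (qt_mono (- a) (- b))"
  by (auto simp: bar_rel_def qt_coeff_mono)

lemma bar_rel_unique: "bar_rel F G \<Longrightarrow> bar_rel F H \<Longrightarrow> G = H"
  by (rule qt_series_eqI) (simp add: bar_rel_def)

text \<open>Bounds the exponents in the two directions in which the series ring itself imposes no
  bound.\<close>

definition qt_bounded :: "int \<Rightarrow> int \<Rightarrow> qt_series \<Rightarrow> bool" where
  "qt_bounded r s F \<longleftrightarrow> (\<forall>u v. qt_coeff F u v \<noteq> 0 \<longrightarrow> u \<le> r \<and> v \<ge> s)"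

lemma qt_bounded_diff: "qt_bounded r s F \<Longrightarrow> qt_bounded r s G \<Longrightarrow> qt_bounded r s (F - G)"
  and qt_bounded_add: "qt_bounded r s F \<Longrightarrow> qt_bounded r s G \<Longrightarrow> qt_bounded r s (F + G)"
  and qt_bounded_minus: "qt_bounded r s F \<Longrightarrow> qt_bounded r s (- F)"
  and qt_bounded_zero: "qt_bounded r s 0"
  unfolding qt_bounded_def by (auto, (metis add.right_neutral diff_0_right add_0)+)

lemma qt_bounded_sum: "(\<And>x. x \<in> K \<Longrightarrow> qt_bounded r s (f x)) \<Longrightarrow> qt_bounded r s (\<Sum>x\<in>K. f x)"
  by (induction K rule: infinite_finite_induct) (simp_all add: qt_bounded_add qt_bounded_zero)

lemma qt_bounded_mono_mult:
  assumes "qt_bounded r s F" "a + r \<le> r'" "s' \<le> b + s"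
  shows "qt_bounded r' s' (qt_mono a b * F)"
  unfolding qt_bounded_def
proof (intro allI impI)
  fix u v assume "qt_coeff (qt_mono a b * F) u v \<noteq> 0"
  then have "u - a \<le> r \<and> s \<le> v - b" using assms(1) by (simp add: qt_bounded_def)
  then show "u \<le> r' \<and> s' \<le> v" using assms(2,3) by linarith
qed

section \<open>Quantum integers\<close>

lemma qint_zero [simp]: "qint 0 = 0"
  using qint_of_nat [of 0] by simp

lemma qint_one [simp]: "qint 1 = 1"
  using qint_of_nat [of 1] by (simp add: qpow_eq_mono)

lemma qint_minus: "qint (- int n) = - qint (int n)"
  by (simp add: qint_of_nat qint_minus_of_nat)

lemma qint_mono: "qint (int n) = (\<Sum>m<n. qt_mono (int n - 1 - 2 * int m) 0)"
  by (simp add: qint_of_nat qpow_eq_mono)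

lemma qint_nonzero:
  assumes "k \<noteq> 0"
  shows "qint k \<noteq> 0"
proof -
  have pos: "qint (int n) \<noteq> 0" if "n > 0" for n
  proof
    assume "qint (int n) = 0"
    moreover obtain p where p: "n = Suc p" using \<open>n > 0\<close> gr0_implies_Suc by blast
    moreover have "qint (int (Suc p)) = qt_mono (int p) 0 + (\<Sum>m<p. qt_mono (int p - 2 * int (Suc m)) 0)"
      unfolding qint_mono by (subst sum.lessThan_Suc_shift) simp
    ultimately have "qt_coeff (qt_mono (int p) 0 + (\<Sum>m<p. qt_mono (int p - 2 * int (Suc m)) 0)) (int p) 0 = 0"
      by simp
    then show False by (simp add: qt_coeff_sum qt_coeff_mono)
  qed
  show ?thesis
  proof (cases "k > 0")
    case True
    then show ?thesis using pos [of "nat k"] by simp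
  next
    case False
    then show ?thesis using pos [of "nat (- k)"] qint_minus [of "nat (- k)"] assms by simp
  qed
qed

lemma qint_in_mons: "qint (int n) \<in> range mons"
  unfolding qint_mono by (intro mons_closed_sum mons_closed)

lemma bar_rel_qint_mult:
  assumes "bar_rel F F'"
  shows "bar_rel (qint (int n) * F) (qint (int n) * F')"
proof -
  have "(\<Sum>m<n. qt_mono (int n - 1 - 2 * int m) 0) = (\<Sum>m<n. qt_mono (int n - 1 - 2 * int (n - Suc m)) 0)"
    by (rule sum.nat_diff_reindex [symmetric])
  also have "\<dots> = (\<Sum>m<n. qt_mono (- (int n - 1 - 2 * int m)) (- 0))"
    by (intro sum.cong) (simp_all add: of_nat_diff algebra_simps)
  finally have "qint (int n) * F' = (\<Sum>m<n. qt_mono (- (int n - 1 - 2 * int m)) (- 0) * F')"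
    by (simp only: qint_mono sum_distrib_right)
  moreover have "qint (int n) * F = (\<Sum>m<n. qt_mono (int n - 1 - 2 * int m) 0 * F)"
    by (simp only: qint_mono sum_distrib_right)
  ultimately show ?thesis by (simp only:) (intro bar_rel_sum bar_rel_mono_mult assms)
qed

lemma qt_bounded_qint_mult:
  assumes "qt_bounded r s F" "r + int n - 1 \<le> r'"
  shows "qt_bounded r' s (qint (int n) * F)"
  unfolding qint_mono sum_distrib_right
  by (intro qt_bounded_sum qt_bounded_mono_mult [OF assms(1)]) (use assms(2) in auto)

section \<open>The braid group action\<close>

context simple_cartan_matrix
begin

definition DD :: "'n \<Rightarrow> 'n \<Rightarrow> qt_series" where
  "DD i j = deformed_cartan C $ i $ j"

text \<open>The sign \<open>e = -1\<close> replaces \<open>q, t\<close> by \<open>q\<^sup>-\<^sup>1, t\<^sup>-\<^sup>1\<close>.\<close>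

definition kap :: "int \<Rightarrow> 'n \<Rightarrow> qt_series" where
  "kap e i = qt_mono (- e * int (d i)) e"

definition AA :: "int \<Rightarrow> 'n \<Rightarrow> 'n \<Rightarrow> qt_series" where
  "AA e i j = kap e i * DD i j"

lemma DD_diag: "DD i i = qt_mono (int (d i)) (- 1) + qt_mono (- int (d i)) 1"
  by (simp add: DD_def deformed_cartan_def qt_mono_def)

lemma DD_offdiag: "i \<noteq> j \<Longrightarrow> DD i j = - qint (int (nat (- cc i j)))"
  using cc_offdiag [of i j] qint_minus [of "nat (- cc i j)"] by (simp add: DD_def deformed_cartan_def)

lemma AA_diag: "AA 1 i i = 1 + qt_mono (- 2 * int (d i)) 2"
  and AA_diag': "AA (- 1) i i = 1 + qt_mono (2 * int (d i)) (- 2)"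
  by (simp_all add: AA_def kap_def DD_diag distrib_left qt_mono_mult)

lemma AA_offdiag: "i \<noteq> j \<Longrightarrow> AA e i j = - (kap e i * qint (int (nat (- cc i j))))"
  by (simp add: AA_def DD_offdiag)

lemma edge_cases:
  assumes "i \<noteq> j" "cc i j \<noteq> 0"
  obtains "d i = d j" "cc i j = - 1" "cc j i = - 1"
  | "d i = 1" "d j = dmax" "dmax \<noteq> 1" "cc i j = - int dmax" "cc j i = - 1"
  | "d j = 1" "d i = dmax" "dmax \<noteq> 1" "cc j i = - int dmax" "cc i j = - 1"
proof -
  have *: "d i = d j \<and> cc i j = - 1 \<or> d i = 1 \<and> d j = dmax \<and> dmax \<noteq> 1 \<and> cc i j = - int dmax"
    if "cc j i = - 1" for i j
  proof (cases "d i = d j")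
    case True
    then have "int (d j) * (cc i j + 1) = 0" using d_sym [of i j] that by (simp add: distrib_left)
    moreover have "int (d j) \<noteq> 0" using d_ge_1 [of j] by linarith
    ultimately have "cc i j + 1 = 0" by (simp only: mult_eq_0_iff) simp
    then show ?thesis using True by simp
  next
    case False
    have eq: "int (d i) * (- cc i j) = int (d j)" using d_sym [of i j] that by simp
    have "d j \<noteq> 1"
    proof
      assume "d j = 1"
      then have "int (d i) dvd 1" using eq by (metis dvd_triv_left of_nat_1)
      then show False using False \<open>d j = 1\<close> by simp
    qed
    then have "d j = dmax" using d_cases by blast
    moreover from this have "d i = 1" using False d_cases by metis
    ultimately show ?thesis using eq \<open>d j \<noteq> 1\<close> by auto
  qed
  show ?thesis
    using cc_adjacent(3) [OF assms] * [of i j] * [of j i] that by metis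
qed

lemma rank2_sym: "rank2 A i j s n \<Longrightarrow> rank2 A j i s n"
  by (auto simp: rank2_def Let_def mult.commute add.commute)

lemma rank2_AA:
  assumes "i \<noteq> j"
  shows "\<exists>s\<in>range mons. rank2 (AA 1) i j s (m i j)"
proof -
  have edge: "\<exists>s\<in>range mons. rank2 (AA 1) i j s (m i j)"
    if ij: "i \<noteq> j" and h: "d i = 1" "d j = dmax" "dmax \<noteq> 1" "cc i j = - int dmax" "cc j i = - 1" for i j
  proof -
    have "dmax = 2 \<or> dmax = 3" using h(2,3) d_le_3 [of j] dmax_pos by auto
    then show ?thesis
    proof
      assume 2: "dmax = 2"
      have q: "qint 2 = qt_mono 1 0 + qt_mono (- 1) 0"
        using qint_mono [of 2] by (simp add: eval_nat_numeral)
      have "rank2 (AA 1) i j 1 (m i j)"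
        using h ij 2 by (simp add: rank2_def Let_def m_def AA_diag AA_offdiag kap_def q
            ring_distribs qt_mono_mult)
      then show ?thesis using mons_closed by blast
    next
      assume 3: "dmax = 3"
      have q: "qint 3 = qt_mono 2 0 + 1 + qt_mono (- 2) 0"
        using qint_mono [of 3] by (simp add: eval_nat_numeral)
      \<comment> \<open>\<open>s\<close> is the geometric mean of \<open>u = q^-2 t^2\<close> and
        \<open>w = q^-6 t^2\<close>, and the middle one of the three terms that \<open>[3]\<close>
        contributes to \<open>x y\<close>.\<close>
      have "rank2 (AA 1) i j (qt_mono (- 4) 2) (m i j)"
        using h ij 3 by (simp add: rank2_def Let_def m_def AA_diag AA_offdiag kap_def q
            ring_distribs qt_mono_mult qt_mono_power)
      then show ?thesis using mons_closed by blast
    qed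
  qed
  show ?thesis
  proof (cases "cc i j = 0")
    case True
    then have "rank2 (AA 1) i j 1 (m i j)"
      using cc_zero_iff [of i j] assms by (simp add: rank2_def Let_def m_def AA_offdiag)
    then show ?thesis using mons_closed by blast
  next
    case False
    from assms False show ?thesis
    proof (cases rule: edge_cases)
      case 1
      then have "rank2 (AA 1) i j 1 (m i j)"
        using assms by (simp add: rank2_def Let_def m_def AA_diag AA_offdiag kap_def qt_mono_mult)
      then show ?thesis using mons_closed by blast
    next
      case 2
      then show ?thesis using edge assms by blast
    next
      case 3
      then show ?thesis using edge [of j i] assms rank2_sym m_sym by metis
    qed
  qed
qed

lemma AA_offdiag_mons: "i \<noteq> j \<Longrightarrow> - AA 1 i j \<in> range mons"
  by (subst AA_offdiag, assumption) (unfold kap_def minus_minus, intro mons_closed qint_in_mons)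

lemma AA_diag_mons: "AA 1 i i - 1 \<in> range mons"
  by (simp add: AA_diag mons_closed)

lemma AA_word: "red a \<Longrightarrow> red b \<Longrightarrow> W a = W b \<Longrightarrow> pword (AA 1) a = pword (AA 1) b"
  using matsumoto rank2_AA by blast

lemma AA_ascent:
  assumes "red (a @ [i])"
  shows "pword (AA 1) a (axis i 1) $ k \<in> range mons"
proof (rule ascent_closed [OF rank2_AA AA_word])
  show "red a" using red_appendD(1) [OF assms] .
  show "length a \<le> len (a @ [i])" using assms by (simp add: red_def)
qed (simp_all add: mons_closed AA_offdiag_mons AA_diag_mons)

subsection \<open>The action of the longest element\<close>

lemma DD_st [simp]: "DD (st i) (st j) = DD i j"
proof (cases "i = j")
  case False
  then have "st i \<noteq> st j" by (metis st_st)
  then show ?thesis using False by (simp add: DD_offdiag)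
qed (simp add: DD_diag)

lemma AA_st [simp]: "AA e (st i) (st j) = AA e i j"
  by (simp add: AA_def kap_def)

lemma DD_nonzero: "i \<noteq> j \<Longrightarrow> cc i j \<noteq> 0 \<Longrightarrow> DD i j \<noteq> 0"
  using cc_offdiag [of i j] by (simp add: DD_offdiag qint_nonzero)

lemma kap_nonzero: "kap e i \<noteq> 0"
proof
  assume "kap e i = 0"
  then have "qt_coeff (kap e i) (- e * int (d i)) e = 0" by simp
  then show False by (simp add: kap_def qt_coeff_mono)
qed

abbreviation T :: "'n list \<Rightarrow> qt_series ^ 'n \<Rightarrow> qt_series ^ 'n" where "T \<equiv> pword (AA 1)"

lemma T_a0_prefl: "T a0 (prefl (AA 1) i x) = prefl (AA 1) (st i) (T a0 x)"
proof -
  obtain b where b: "red (b @ [i])" "W (b @ [i]) = W a0" "red (st i # b)" "W (st i # b) = W a0"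
    using a0_factor by blast
  have "T a0 (prefl (AA 1) i x) = T (st i # b) (prefl (AA 1) i x)"
    using AA_word [OF b(3) red_a0 b(4)] by simp
  also have "\<dots> = prefl (AA 1) (st i) (T (b @ [i]) x)" by (simp add: pword_Cons pword_snoc)
  also have "T (b @ [i]) = T a0" by (rule AA_word [OF b(1) red_a0 b(2)])
  finally show ?thesis .
qed

definition g :: "'n \<Rightarrow> qt_series" where
  "g i = - T a0 (axis i 1) $ st i"

lemma axis_other: "k \<noteq> i \<Longrightarrow> axis i c $ k = 0"
  by (simp add: axis_def)

text \<open>\<open>\<alpha> i\<close> is an eigenvector of \<open>T\<^sub>i\<close> for
  \<open>- ?u\<close>, so its image is one of \<open>T\<^sub>i\<^sub>*\<close>; because
  \<open>1 + ?u\<close> is nonzero, that eigenspace is the line of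
  \<open>axis (st i) 1\<close>.\<close>

lemma T_a0_simple: "T a0 (axis i 1) = axis (st i) (- g i)"
proof -
  let ?u = "qt_mono (- 2 * int (d i)) 2" and ?y = "T a0 (axis i 1)"
  have "prefl (AA 1) i (axis i 1) = axis i (- ?u)"
    unfolding prefl_def pform_axis AA_diag by (simp flip: axis_diff)
  then have "prefl (AA 1) (st i) ?y = - ?u *s ?y"
    using T_a0_prefl [of i "axis i 1"] pword_axis [of "AA 1" a0 i "- ?u"] by simp
  then have *: "(?y - axis (st i) (pform (AA 1) (st i) ?y)) $ k = - ?u * ?y $ k" for k
    unfolding prefl_def by (metis vector_smult_component)
  have nz: "1 + ?u \<noteq> 0"
  proof
    assume "1 + ?u = 0"
    then have "qt_coeff (1 + ?u) 0 0 = 0" by simp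
    then show False by (simp add: qt_coeff_one qt_coeff_mono)
  qed
  have "?y $ k = 0" if "k \<noteq> st i" for k
  proof -
    have "(?y - axis (st i) (pform (AA 1) (st i) ?y)) $ k = ?y $ k"
      using that by (simp add: axis_other)
    then have "?y $ k - - ?u * ?y $ k = 0" using * [of k] by simp
    then have "(1 + ?u) * ?y $ k = 0"
      by (simp only: distrib_right mult_1_left mult_minus_left diff_minus_eq_add)
    then show ?thesis using nz by (simp only: mult_eq_0_iff) blast
  qed
  then show ?thesis by (simp add: vec_eq_iff axis_def g_def)
qed

text \<open>Positivity does not apply to \<open>a0\<close> directly, as \<open>i\<close> is a
  descent; splitting off a last letter \<open>i\<close> leaves a word that ascends at
  \<open>i\<close>.\<close>

lemma g_mons: "g i \<in> range mons"
proof -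
  obtain b where b: "red (b @ [i])" "W (b @ [i]) = W a0" using a0_factor by metis
  let ?u = "qt_mono (- 2 * int (d i)) 2"
  have "prefl (AA 1) i (axis i 1) = axis i (- ?u)"
    unfolding prefl_def pform_axis AA_diag by (simp flip: axis_diff)
  then have "T a0 (axis i 1) = - ?u *s T b (axis i 1)"
    using AA_word [OF b(1) red_a0 b(2)] pword_axis [of "AA 1" b i "- ?u"]
    by (metis pword_snoc)
  then have "g i = ?u * T b (axis i 1) $ st i" by (simp add: g_def)
  then show ?thesis using AA_ascent [OF b(1)] mons_closed by simp
qed

text \<open>Compare the coefficients at \<open>st k\<close> in \<open>T_a0_prefl\<close> for
  \<open>axis j 1\<close>; along an edge the factor \<open>AA 1 k j\<close> is nonzero and
  cancels.\<close>

lemma g_const: "g i = g j"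
proof (rule connected_induct [of "\<lambda>j. g i = g j" i])
  fix k j assume IH: "g i = g k" and kj: "cc k j \<noteq> 0"
  show "g i = g j"
  proof (cases "k = j")
    case False
    have "prefl (AA 1) k (axis j 1) = axis j 1 - axis k (AA 1 k j)"
      by (simp add: prefl_def pform_axis)
    then have "T a0 (prefl (AA 1) k (axis j 1)) = axis (st j) (- g j) - axis (st k) (AA 1 k j * - g k)"
      by (simp add: pword_diff pword_axis [of "AA 1" a0 k "AA 1 k j"] T_a0_simple axis_smult)
    moreover have "prefl (AA 1) (st k) (T a0 (axis j 1))
        = axis (st j) (- g j) - axis (st k) (AA 1 k j * - g j)"
      by (simp add: prefl_def pform_axis T_a0_simple)
    ultimately have "axis (st k) (AA 1 k j * - g k) = axis (st k) (AA 1 k j * - g j)"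
      using T_a0_prefl [of k "axis j 1"] by simp
    then have "AA 1 k j * - g k = AA 1 k j * - g j" by (metis axis_nth)
    moreover have "AA 1 k j \<noteq> 0" using DD_nonzero [OF False kj] kap_nonzero by (simp add: AA_def)
    ultimately show ?thesis using IH by simp
  qed (use IH in simp)
qed simp

definition Tmat :: "'n list \<Rightarrow> qt_series ^ 'n ^ 'n" where
  "Tmat a = (\<chi> k i. T a (axis i 1) $ k)"

lemma Tmat_append: "Tmat (a @ b) = Tmat a ** Tmat b"
  by (simp add: vec_eq_iff Tmat_def matrix_matrix_mult_def pword_append pword_expand [of "AA 1" a "T b _"]
      mult.commute)

text \<open>Only row \<open>i\<close> differs from the identity matrix, and a nontrivial permutation
  moves some other index, so just the diagonal product survives.\<close>

lemma det_Tmat_single: "det (Tmat [i]) = - qt_mono (- 2 * int (d i)) 2"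
proof -
  have entry: "Tmat [i] $ k $ l = (if k = l then 1 else 0) - (if k = i then AA 1 i l else 0)" for k l
  proof -
    have "T [i] (axis l 1) = axis l 1 - axis i (AA 1 i l)"
      by (simp add: pword_Cons prefl_def pform_axis)
    then show ?thesis by (simp add: Tmat_def) (simp add: axis_def)
  qed
  have "det (Tmat [i]) = (\<Sum>p\<in>{id}. of_int (sign p) * (\<Prod>k\<in>UNIV. Tmat [i] $ k $ p k))"
    unfolding det_def
  proof (rule sum.mono_neutral_right)
    show "\<forall>p\<in>{p. p permutes UNIV} - {id}. of_int (sign p) * (\<Prod>k\<in>UNIV. Tmat [i] $ k $ p k) = 0"
    proof
      fix p :: "'n \<Rightarrow> 'n" assume p: "p \<in> {p. p permutes UNIV} - {id}"
      have "\<exists>k. k \<noteq> i \<and> p k \<noteq> k"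
      proof (rule ccontr)
        assume "\<not> ?thesis"
        then have fixp: "p k = k" if "k \<noteq> i" for k using that by blast
        have "inj p" using p by (auto dest: permutes_inj)
        then have "p i = i" using fixp by (metis injD)
        then have "p x = x" for x using fixp by (cases "x = i") auto
        then show False using p by (auto simp: fun_eq_iff)
      qed
      then obtain k where "k \<noteq> i" "p k \<noteq> k" by blast
      then have "Tmat [i] $ k $ p k = 0" by (simp add: entry)
      then have "(\<Prod>k\<in>UNIV. Tmat [i] $ k $ p k) = 0" by (intro prod_zero) auto
      then show "of_int (sign p) * (\<Prod>k\<in>UNIV. Tmat [i] $ k $ p k) = 0" by simp
    qed
  qed (auto simp: finite_permutations permutes_id)
  also have "\<dots> = (\<Prod>k\<in>UNIV. Tmat [i] $ k $ k)" by simp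
  also have "\<dots> = (\<Prod>k\<in>UNIV. if k = i then 1 - AA 1 i i else 1)"
    by (intro prod.cong) (auto simp: entry)
  also have "\<dots> = - qt_mono (- 2 * int (d i)) 2" by (simp add: AA_diag)
  finally show ?thesis .
qed

text \<open>Squaring disposes of the sign of the word length; correspondingly, \<open>g_eq\<close>
  uses the word \<open>a0 @ a0\<close>, on which the diagram involution becomes the
  identity.\<close>

lemma det_Tmat_square: "(det (Tmat a))\<^sup>2 = qt_mono (- 4 * (\<Sum>i\<leftarrow>a. int (d i))) (4 * int (length a))"
proof (induction a)
  case Nil
  have "Tmat [] = mat 1" by (simp add: Tmat_def mat_def vec_eq_iff axis_def)
  then show ?case by simp
next
  case (Cons i a)
  have "(det (Tmat (i # a)))\<^sup>2 = (det (Tmat [i]))\<^sup>2 * (det (Tmat a))\<^sup>2"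
    using Tmat_append [of "[i]" a] by (simp add: det_mul power_mult_distrib)
  moreover have "(det (Tmat [i]))\<^sup>2 = qt_mono (- 4 * int (d i)) 4"
    by (simp add: det_Tmat_single power2_eq_square qt_mono_mult)
  ultimately show ?case
    unfolding Cons.IH by (simp add: qt_mono_mult algebra_simps)
qed

lemma g_eq: "g i = qt_mono (- (lacing C * dual_coxeter_number C)) (coxeter_number C)"
proof -
  define G where "G = g i"
  have T2: "T (a0 @ a0) (axis k 1) = axis k (G * G)" for k
    using g_const [of k i] g_const [of "st k" i]
    by (simp add: pword_append T_a0_simple pword_axis [of "AA 1" a0 _ "- g _"] axis_smult G_def)
  have "Tmat (a0 @ a0) $ k $ l = (if k = l then G * G else 0)" for k l
    by (simp add: Tmat_def T2) (simp add: axis_def)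
  then have "det (Tmat (a0 @ a0)) = (\<Prod>k\<in>(UNIV :: 'n set). G * G)"
    by (subst det_diagonal) simp_all
  then have "(G * G) ^ CARD('n) = (det (Tmat a0))\<^sup>2"
    by (simp add: Tmat_append det_mul power2_eq_square)
  also have "\<dots> = qt_mono (- 4 * (\<Sum>i\<leftarrow>a0. int (d i))) (4 * int (length a0))"
    by (rule det_Tmat_square)
  finally have power: "(G * G) ^ CARD('n) = \<dots>" .
  obtain N where N: "CARD('n) = Suc N" using not0_implies_Suc by fastforce
  \<comment> \<open>One factor is split off to present a monomial as a product of two nonnegative
    Laurent polynomials.\<close>
  have "G * (G * (G * G) ^ N) = qt_mono (- 4 * (\<Sum>i\<leftarrow>a0. int (d i))) (4 * int (length a0))"
    using power by (simp add: N mult.assoc)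
  moreover have "G \<in> range mons" unfolding G_def by (rule g_mons)
  moreover from this have "G * (G * G) ^ N \<in> range mons"
    by (simp add: mons_closed mons_closed_power)
  ultimately obtain a b where G: "G = qt_mono a b" using mult_mons_eq_mono by blast
  have "qt_mono (int CARD('n) * (a + a)) (int CARD('n) * (b + b))
      = qt_mono (- 4 * (\<Sum>i\<leftarrow>a0. int (d i))) (4 * int (length a0))"
    using power unfolding G qt_mono_mult qt_mono_power .
  then have "int CARD('n) * (a + a) = - 4 * (\<Sum>i\<leftarrow>a0. int (d i))"
    "int CARD('n) * (b + b) = 4 * int (length a0)"
    unfolding qt_mono_eq_iff by blast+
  then have "int CARD('n) * a = int CARD('n) * - (lacing C * dual_coxeter_number C)"
    "int CARD('n) * b = int CARD('n) * coxeter_number C"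
    unfolding mult_minus_right dual_coxeter_length coxeter_length distrib_left by linarith+
  moreover have "int CARD('n) \<noteq> 0" by simp
  ultimately have "a = - (lacing C * dual_coxeter_number C)" "b = coxeter_number C"
    unfolding mult_cancel_left by blast+
  then show ?thesis using G unfolding G_def by simp
qed

subsection \<open>The telescoping sum\<close>

text \<open>Column \<open>j\<close> of \<open>N\<close> for the word: the sum, over the occurrences
  of \<open>j\<close>, of the operator of the preceding letters applied to
  \<open>axis j (kap e j)\<close>.\<close>

fun nvec :: "int \<Rightarrow> 'n list \<Rightarrow> 'n \<Rightarrow> qt_series ^ 'n" where
  "nvec e [] j = 0"
| "nvec e (i # a) j = (if i = j then axis i (kap e i) else 0) + prefl (AA e) i (nvec e a j)"

lemma prefl_zero [simp]: "prefl A i 0 = 0"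
  by (simp add: prefl_def pform_def)

lemma nvec_snoc:
  "nvec e (a @ [i]) j = nvec e a j + (if i = j then pword (AA e) a (axis i (kap e i)) else 0)"
proof (induction a)
  case Nil
  show ?case by simp
next
  case (Cons k a)
  then show ?case by (auto simp: prefl_add pword_Cons)
qed

text \<open>Rests on \<open>1 - T\<^sub>i T\<^sub>a = (1 - T\<^sub>i) + T\<^sub>i (1 -
  T\<^sub>a)\<close>, where \<open>1 - T\<^sub>i\<close> sends \<open>x\<close> to
  \<open>axis i 1\<close> times \<open>kap e i\<close> and coordinate \<open>i\<close> of
  \<open>C(q,t) x\<close>.\<close>

lemma nvec_telescope:
  "pword (AA e) a x = x - (\<Sum>j\<in>UNIV. (\<Sum>l\<in>UNIV. DD j l * x $ l) *s nvec e a j)"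
proof (induction a)
  case (Cons i a)
  let ?c = "\<lambda>j. \<Sum>l\<in>UNIV. DD j l * x $ l"
  have "prefl (AA e) i (\<Sum>j\<in>UNIV. ?c j *s nvec e a j) = (\<Sum>j\<in>UNIV. ?c j *s prefl (AA e) i (nvec e a j))"
    using pword_sum [of "AA e" "[i]" "\<lambda>j. ?c j *s nvec e a j" UNIV] by (simp add: pword_Cons prefl_smult)
  moreover have "prefl (AA e) i x = x - ?c i *s axis i (kap e i)"
    by (simp add: prefl_def pform_def AA_def axis_smult sum_distrib_left mult_ac)
  ultimately have "pword (AA e) (i # a) x
      = x - ?c i *s axis i (kap e i) - (\<Sum>j\<in>UNIV. ?c j *s prefl (AA e) i (nvec e a j))"
    using pword_diff [of "AA e" "[i]" x "\<Sum>j\<in>UNIV. ?c j *s nvec e a j"]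
    by (simp add: pword_Cons Cons.IH)
  moreover have "(\<Sum>j\<in>UNIV. ?c j *s nvec e (i # a) j)
      = ?c i *s axis i (kap e i) + (\<Sum>j\<in>UNIV. ?c j *s prefl (AA e) i (nvec e a j))"
    by (simp add: vec.scale_right_distrib sum.distrib if_distrib [where f = "\<lambda>y. _ *s y"] cong: if_cong)
  ultimately show ?case by simp
qed (simp add: vec_eq_iff)

lemma nvec_mons: "red a \<Longrightarrow> nvec 1 a j $ k \<in> range mons"
proof (induction a rule: rev_induct)
  case (snoc i a)
  have "T a (axis i (kap 1 i)) $ k = kap 1 i * T a (axis i 1) $ k"
    by (simp add: pword_axis [of "AA 1" a i "kap 1 i"])
  then have "T a (axis i (kap 1 i)) $ k \<in> range mons"
    using AA_ascent [OF snoc.prems] by (simp add: mons_closed kap_def)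
  then show ?case
    using snoc.IH red_appendD(1) [OF snoc.prems] by (auto simp: nvec_snoc intro: mons_closed(5))
qed (simp add: mons_closed)

lemma bar_rel_prefl:
  fixes x y :: "qt_series ^ 'n"
  assumes "\<And>k. bar_rel (x $ k) (y $ k)"
  shows "bar_rel (prefl (AA 1) i x $ k) (prefl (AA (- 1)) i y $ k)"
proof -
  have "bar_rel (AA 1 i j * x $ j) (AA (- 1) i j * y $ j)" for j
  proof (cases "i = j")
    case True
    have "bar_rel (x $ j + qt_mono (- 2 * int (d j)) 2 * x $ j)
        (y $ j + qt_mono (- (- 2 * int (d j))) (- 2) * y $ j)"
      by (intro bar_rel_add bar_rel_mono_mult assms)
    then show ?thesis by (simp add: True AA_diag AA_diag' distrib_right)
  next
    case False
    have "bar_rel (- (qt_mono (- int (d i)) 1 * (qint (int (nat (- cc i j))) * x $ j)))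
        (- (qt_mono (- (- int (d i))) (- 1) * (qint (int (nat (- cc i j))) * y $ j)))"
      by (intro bar_rel_minus bar_rel_mono_mult bar_rel_qint_mult assms)
    then show ?thesis using False by (simp add: AA_offdiag kap_def mult.assoc)
  qed
  then show ?thesis using assms
    by (simp add: prefl_def pform_def axis_def bar_rel_diff bar_rel_sum)
qed

lemma bar_rel_nvec: "bar_rel (nvec 1 a j $ k) (nvec (- 1) a j $ k)"
proof (induction a arbitrary: k)
  case (Cons i a)
  have "bar_rel (kap 1 i) (kap (- 1) i)"
    using bar_rel_mono [of "- int (d i)" 1] by (simp add: kap_def)
  then show ?case
    using bar_rel_prefl [OF Cons.IH, of i k] by (auto simp: bar_rel_add bar_rel_zero axis_def)
qed (simp add: bar_rel_zero)

text \<open>The bound must depend on the row for the induction to close: by \<open>cc_bound\<close>,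
  the off-diagonal entry in column \<open>l\<close> raises the power of \<open>q\<close> by at most
  \<open>d\<^sub>l - 1\<close>, which the bound \<open>- d\<^sub>l\<close> absorbs, and
  \<open>kap\<close> then restores \<open>- d\<^sub>i\<close>.\<close>

lemma qt_bounded_nvec: "qt_bounded (- int (d k)) 1 (nvec 1 a j $ k)"
proof (induction a arbitrary: k)
  case (Cons i a)
  have "qt_bounded (- int (d i)) 1 (AA 1 i l * nvec 1 a j $ l)" for l
  proof (cases "i = l")
    case True
    have "qt_bounded (- int (d l)) 1 (nvec 1 a j $ l + qt_mono (- 2 * int (d l)) 2 * nvec 1 a j $ l)"
      by (intro qt_bounded_add qt_bounded_mono_mult [OF Cons.IH] Cons.IH) auto
    then show ?thesis by (simp add: True AA_diag distrib_right)
  next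
    case False
    have "qt_bounded 0 1 (qint (int (nat (- cc i l))) * nvec 1 a j $ l)"
      by (rule qt_bounded_qint_mult [OF Cons.IH]) (use cc_bound [OF False] cc_offdiag [OF False] in simp)
    then have "qt_bounded (- int (d i)) 1
        (- (qt_mono (- int (d i)) 1 * (qint (int (nat (- cc i l))) * nvec 1 a j $ l)))"
      by (intro qt_bounded_minus qt_bounded_mono_mult) auto
    then show ?thesis using False cc_offdiag [OF False] by (simp add: AA_offdiag kap_def mult.assoc)
  qed
  then have "qt_bounded (- int (d i)) 1 (pform (AA 1) i (nvec 1 a j))"
    unfolding pform_def by (rule qt_bounded_sum)
  then have "qt_bounded (- int (d k)) 1 (prefl (AA 1) i (nvec 1 a j) $ k)"
    using Cons.IH by (auto simp: prefl_def axis_def qt_bounded_diff)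
  moreover have "qt_bounded (- int (d i)) 1 (kap 1 i)"
    by (auto simp: qt_bounded_def kap_def qt_coeff_mono split: if_splits)
  ultimately show ?case by (auto simp: qt_bounded_add qt_bounded_zero axis_def)
qed (simp add: qt_bounded_zero)

end

section \<open>The inverse matrix\<close>

text \<open>The lowest coefficient in \<open>q\<close> is 1, a unit.\<close>

lemma geometric_inverse:
  assumes "r > 0"
  shows "\<exists>G. G * (1 - qt_mono r s) = 1"
proof -
  have nth: "fls_nth (qt_mono r s) k = (if k = r then fls_X_intpow (- s) else 0)" for k
    by (simp add: qt_mono_def qpow_def tpow_def fls_shifted_times_simps)
  let ?f = "1 - qt_mono r s"
  have "fls_subdegree ?f = 0"
    by (rule fls_subdegree_eqI) (use assms in \<open>auto simp: nth\<close>)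
  then have "1 * fls_nth ?f (fls_subdegree ?f) = 1" using assms by (simp add: nth)
  then show ?thesis using fls_left_inverse by blast
qed

context simple_cartan_matrix
begin

abbreviation rh :: int where "rh \<equiv> lacing C * dual_coxeter_number C"
abbreviation hh :: int where "hh \<equiv> coxeter_number C"

definition NN :: "int \<Rightarrow> 'n \<Rightarrow> 'n \<Rightarrow> qt_series" where
  "NN e i j = nvec e a0 j $ i"

lemma bar_rel_pword:
  fixes x y :: "qt_series ^ 'n"
  assumes "\<And>k. bar_rel (x $ k) (y $ k)"
  shows "bar_rel (T a x $ k) (pword (AA (- 1)) a y $ k)"
  by (induction a arbitrary: k) (simp_all add: pword_Cons bar_rel_prefl assms)

lemma T_a0: "T a0 (axis l 1) = axis (st l) (- qt_mono (- rh) hh)"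
  by (simp add: T_a0_simple g_eq)

lemma T_a0_bar: "pword (AA (- 1)) a0 (axis l 1) = axis (st l) (- qt_mono rh (- hh))"
proof -
  have one: "bar_rel (axis l 1 $ k :: qt_series) (axis l 1 $ k)" for k
    by (auto simp: axis_def bar_rel_def qt_coeff_one)
  have "bar_rel (axis (st l) (- qt_mono (- rh) hh) $ k) (axis (st l) (- qt_mono rh (- hh)) $ k)" for k
    using bar_rel_minus [OF bar_rel_mono [of "- rh" hh]] by (simp add: axis_def bar_rel_zero)
  then show ?thesis
    using bar_rel_pword [of "axis l 1" "axis l 1" a0, OF one]
    unfolding vec_eq_iff T_a0 by (blast intro: bar_rel_unique)
qed

lemma NN_DD:
  "(\<Sum>j\<in>UNIV. NN 1 i j * DD j l) = (if i = l then 1 else 0) + (if i = st l then qt_mono (- rh) hh else 0)"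
  "(\<Sum>j\<in>UNIV. NN (- 1) i j * DD j l) = (if i = l then 1 else 0) + (if i = st l then qt_mono rh (- hh) else 0)"
proof -
  have *: "(\<Sum>j\<in>UNIV. NN e i j * DD j l) = axis l 1 $ i - pword (AA e) a0 (axis l 1) $ i" for e
  proof -
    have "(\<Sum>k\<in>UNIV. DD j k * axis l 1 $ k) = DD j l" for j
      by (simp add: axis_def if_distrib [where f = "\<lambda>x. _ * x"] cong: if_cong)
    then have "pword (AA e) a0 (axis l 1) = axis l 1 - (\<Sum>j\<in>UNIV. DD j l *s nvec e a0 j)"
      using nvec_telescope [of e a0 "axis l 1"] by simp
    then show ?thesis by (simp add: NN_def mult.commute)
  qed
  show "(\<Sum>j\<in>UNIV. NN 1 i j * DD j l) = (if i = l then 1 else 0) + (if i = st l then qt_mono (- rh) hh else 0)"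
    unfolding * T_a0 by (simp add: axis_def)
  show "(\<Sum>j\<in>UNIV. NN (- 1) i j * DD j l) = (if i = l then 1 else 0) + (if i = st l then qt_mono rh (- hh) else 0)"
    unfolding * T_a0_bar by (simp add: axis_def)
qed

lemma NN_nonneg: "qt_coeff (NN 1 i j) u v \<ge> 0"
  unfolding NN_def by (intro qt_coeff_range_mons nvec_mons red_a0)

lemma NN_support: "qt_coeff (NN 1 i j) u v \<noteq> 0 \<Longrightarrow> u \<le> - 1 \<and> v \<ge> 1"
  using qt_bounded_nvec [of i a0 j] d_ge_1 [of i] by (fastforce simp: NN_def qt_bounded_def)

lemma NN_bar: "qt_coeff (NN (- 1) i j) u v = qt_coeff (NN 1 i j) (- u) (- v)"
  using bar_rel_nvec [of a0 j i] by (simp add: NN_def bar_rel_def)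

abbreviation mu :: qt_series where "mu \<equiv> qt_mono rh (- hh)"

definition GG :: qt_series where
  "GG = (SOME G. G * (1 - qt_mono (rh + rh) (- hh + - hh)) = 1)"

lemma GG: "GG * (1 - mu * mu) = 1"
proof -
  have "rh + rh > 0" using lacing_dual_coxeter_pos by linarith
  then show ?thesis
    unfolding GG_def qt_mono_mult by (intro someI_ex [of "\<lambda>G. G * (1 - _) = 1"] geometric_inverse)
qed

text \<open>With \<open>P\<close> the permutation matrix, \<open>P^2 = 1\<close> gives
  \<open>(1 - mu P) (1 + mu P) = 1 - mu^2\<close>; so this is
  \<open>(1 + mu P)^-1 N'\<close>.\<close>

definition MM :: "'n \<Rightarrow> 'n \<Rightarrow> qt_series" where
  "MM i j = GG * (NN (- 1) i j - mu * NN (- 1) (st i) j)"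

lemma MM_DD: "(\<Sum>j\<in>UNIV. MM i j * DD j l) = (if i = l then 1 else 0)"
proof -
  have "(\<Sum>j\<in>UNIV. MM i j * DD j l)
      = GG * ((\<Sum>j\<in>UNIV. NN (- 1) i j * DD j l) - mu * (\<Sum>j\<in>UNIV. NN (- 1) (st i) j * DD j l))"
    by (simp add: MM_def sum_distrib_left sum_subtractf right_diff_distrib left_diff_distrib mult.assoc)
  also have "\<dots> = GG * (1 - mu * mu) * (if i = l then 1 else 0)"
  proof -
    have "st i = l \<longleftrightarrow> i = st l" "st i = st l \<longleftrightarrow> i = l" by (metis st_st)+
    then show ?thesis unfolding NN_DD by (auto simp: algebra_simps)
  qed
  finally show ?thesis by (simp add: GG)
qed

text \<open>\<open>C(q,t) E\<close> is symmetric for the diagonal matrix \<open>E\<close> below, which turns the left inverse into a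
  two-sided one over the integral domain of series.\<close>

definition EE :: "'n \<Rightarrow> qt_series" where
  "EE i = (if d i = 1 then qint (int dmax) else 1)"

lemma DD_EE: "DD i j * EE j = DD j i * EE i"
proof (cases "i = j \<or> cc i j = 0")
  case True
  then show ?thesis using cc_zero_iff [of i j] by (cases "i = j") (auto simp: DD_offdiag)
next
  case False
  then have ij: "i \<noteq> j" "cc i j \<noteq> 0" by auto
  then show ?thesis
    by (cases rule: edge_cases) (insert ij, auto simp: DD_offdiag EE_def)
qed

lemma EE_nonzero: "EE i \<noteq> 0"
  using dmax_pos by (simp add: EE_def qint_nonzero)

abbreviation Dm :: "qt_series ^ 'n ^ 'n" where "Dm \<equiv> deformed_cartan C"

definition Mm :: "qt_series ^ 'n ^ 'n" where
  "Mm = (\<chi> i j. MM i j)"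

lemma Mm_Dm: "Mm ** Dm = mat 1"
  by (simp add: vec_eq_iff Mm_def matrix_matrix_mult_def mat_def MM_DD flip: DD_def)

text \<open>Scaled by \<open>EE\<close>, each row of \<open>X\<close> becomes a column vector killed
  by \<open>Dm\<close>, which has a left inverse. \<open>EE i\<close> is
  \<open>[dmax] / [d\<^sub>i]\<close>, written without division.\<close>

lemma Dm_cancel:
  assumes "X ** Dm = 0"
  shows "X = 0"
proof -
  have "X $ i $ l = 0" for i l
  proof -
    define z where "z = (\<chi> l. X $ i $ l * EE l)"
    have "(Dm *v z) $ k = 0" for k
    proof -
      have "(Dm *v z) $ k = (\<Sum>l\<in>UNIV. X $ i $ l * (DD k l * EE l))"
        by (simp add: matrix_vector_mult_def z_def DD_def mult_ac)
      also have "\<dots> = (\<Sum>l\<in>UNIV. X $ i $ l * DD l k) * EE k"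
        by (simp add: DD_EE [of k] sum_distrib_right mult.assoc)
      also have "(\<Sum>l\<in>UNIV. X $ i $ l * DD l k) = (X ** Dm) $ i $ k"
        by (simp add: matrix_matrix_mult_def DD_def)
      finally show ?thesis using assms by simp
    qed
    then have "Dm *v z = 0" by (simp add: vec_eq_iff)
    then have "(Mm ** Dm) *v z = 0" by (simp flip: matrix_vector_mul_assoc)
    then have "z $ l = 0" by (simp add: Mm_Dm)
    then show ?thesis using EE_nonzero by (simp add: z_def)
  qed
  then show ?thesis by (simp add: vec_eq_iff)
qed

lemma Dm_Mm: "Dm ** Mm = mat 1"
proof -
  have "(Dm ** Mm - mat 1) ** Dm = (Dm ** Mm) ** Dm - mat 1 ** Dm"
    by (simp only: vec_eq_iff matrix_matrix_mult_def vec_lambda_beta vector_minus_component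
        left_diff_distrib sum_subtractf) simp
  also have "\<dots> = 0" by (simp add: Mm_Dm flip: matrix_mul_assoc)
  finally have "(Dm ** Mm - mat 1) ** Dm = 0" .
  then show ?thesis using Dm_cancel by fastforce
qed

lemma DD_MM: "(\<Sum>j\<in>UNIV. DD i j * MM j l) = (if i = l then 1 else 0)"
  using arg_cong [OF Dm_Mm, of "\<lambda>X. X $ i $ l"]
  by (simp add: matrix_matrix_mult_def mat_def Mm_def DD_def)

lemma left_mult_MM:
  assumes "\<And>l. (\<Sum>j\<in>UNIV. x j * DD j l) = y l"
  shows "x j = (\<Sum>l\<in>UNIV. y l * MM l j)"
proof -
  have "(\<Sum>l\<in>UNIV. y l * MM l j) = (\<Sum>l\<in>UNIV. \<Sum>k\<in>UNIV. x k * (DD k l * MM l j))"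
    by (simp add: sum_distrib_right mult.assoc flip: assms)
  also have "\<dots> = (\<Sum>k\<in>UNIV. \<Sum>l\<in>UNIV. x k * (DD k l * MM l j))" by (rule sum.swap)
  also have "\<dots> = (\<Sum>k\<in>UNIV. x k * (if k = j then 1 else 0))"
    by (simp only: DD_MM flip: sum_distrib_left)
  finally show ?thesis
    by (simp add: if_distrib [where f = "\<lambda>z. _ * z"] cong: if_cong)
qed

lemma MM_st_st: "MM (st i) (st j) = MM i j"
proof -
  have "(\<Sum>j\<in>UNIV. MM (st i) (st j) * DD j l) = (if i = l then 1 else 0)" for l
  proof -
    have "(\<Sum>j\<in>UNIV. MM (st i) (st j) * DD j l) = (\<Sum>j\<in>UNIV. MM (st i) j * DD j (st l))"
      by (rule sum.reindex_bij_witness [where i = st and j = st])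
        simp_all
    also have "\<dots> = (if i = l then 1 else 0)" unfolding MM_DD by (metis st_st)
    finally show ?thesis .
  qed
  from left_mult_MM [of "\<lambda>j. MM (st i) (st j)", OF this] show ?thesis
    by (simp add: if_distrib [where f = "\<lambda>z. z * _"] cong: if_cong)
qed

lemma MM_st: "MM (st i) j = MM i (st j)"
  using MM_st_st [of i "st j"] by simp

lemma NN_MM:
  "NN 1 i j = MM i j + qt_mono (- rh) hh * MM (st i) j"
  "NN (- 1) i j = MM i j + mu * MM (st i) j"
proof -
  have *: "(\<Sum>l\<in>UNIV. ((if i = l then 1 else 0) + (if i = st l then c else 0)) * MM l j)
      = MM i j + c * MM (st i) j" for c
  proof -
    have "i = st l \<longleftrightarrow> st i = l" for l by (metis st_st)
    then show ?thesis
      by (simp add: distrib_right sum.distrib if_distrib [where f = "\<lambda>x. x * _"] cong: if_cong)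
  qed
  show "NN 1 i j = MM i j + qt_mono (- rh) hh * MM (st i) j"
    using left_mult_MM [OF NN_DD(1)] by (simp only: *)
  show "NN (- 1) i j = MM i j + mu * MM (st i) j"
    using left_mult_MM [OF NN_DD(2)] by (simp only: *)
qed

text \<open>By \<open>MM = N' - mu P MM\<close>, a nonzero coefficient comes from \<open>N'\<close>
  or from \<open>MM\<close> at a \<open>q\<close>-exponent lower by \<open>rh\<close>. The descent
  stops because Laurent series in \<open>q\<close> have a least exponent, and undoing it only raises
  \<open>u\<close> and lowers \<open>v\<close>.\<close>

lemma MM_support: "qt_coeff (MM i j) u v \<noteq> 0 \<Longrightarrow> u \<ge> 1 \<and> v \<le> - 1"
proof -
  define L where "L = Min (range (\<lambda>i. fls_subdegree (MM i j)))"
  have L: "qt_coeff (MM i j) u v = 0" if "u < L" for i u v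
  proof -
    have "L \<le> fls_subdegree (MM i j)" by (simp add: L_def)
    then show ?thesis using that by (simp add: qt_coeff_def)
  qed
  have "qt_coeff (MM i j) u v \<noteq> 0 \<Longrightarrow> u < L + int n * rh \<Longrightarrow> u \<ge> 1 \<and> v \<le> - 1" for n i u v
  proof (induction n arbitrary: i u v)
    case 0
    then show ?case using L by simp
  next
    case (Suc n)
    have "qt_coeff (MM i j) u v = qt_coeff (NN 1 i j) (- u) (- v) - qt_coeff (MM (st i) j) (u - rh) (v + hh)"
      unfolding NN_bar [symmetric] unfolding NN_MM by simp
    with Suc.prems(1) consider "qt_coeff (NN 1 i j) (- u) (- v) \<noteq> 0"
      | "qt_coeff (MM (st i) j) (u - rh) (v + hh) \<noteq> 0" by fastforce
    then show ?case
    proof cases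
      case 1
      then show ?thesis using NN_support by fastforce
    next
      case 2
      moreover have "u - rh < L + int n * rh" using Suc.prems(2) by (simp add: algebra_simps)
      ultimately have "u - rh \<ge> 1 \<and> v + hh \<le> - 1" by (rule Suc.IH)
      then show ?thesis using lacing_dual_coxeter_pos coxeter_pos by linarith
    qed
  qed
  moreover have "u < L + int (nat (u - L + 1)) * rh"
  proof -
    define N where "N = int (nat (u - L + 1))"
    have "N * 1 \<le> N * rh"
      using lacing_dual_coxeter_pos by (intro mult_left_mono) (auto simp: N_def)
    moreover have "u < L + N" by (simp add: N_def)
    ultimately show ?thesis unfolding N_def [symmetric] by linarith
  qed
  ultimately show "qt_coeff (MM i j) u v \<noteq> 0 \<Longrightarrow> u \<ge> 1 \<and> v \<le> - 1" by blast
qed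

lemma deformed_cartan_inv_eq: "deformed_cartan_inv C = Mm"
  unfolding deformed_cartan_inv_def
proof (rule the_equality)
  have "Mm $ i $ j \<in> qt_ring" for i j
    unfolding qt_ring_def mem_Collect_eq
    by (rule exI [of _ 0]) (use MM_support in \<open>fastforce simp: Mm_def\<close>)
  then show "(\<forall>i j. Mm $ i $ j \<in> qt_ring) \<and> Dm ** Mm = mat 1 \<and> Mm ** Dm = mat 1"
    using Mm_Dm Dm_Mm by blast
next
  fix M assume "(\<forall>i j. M $ i $ j \<in> qt_ring) \<and> Dm ** M = mat 1 \<and> M ** Dm = mat 1"
  then have "M ** (Dm ** Mm) = Mm" by (simp add: matrix_mul_assoc)
  then show "M = Mm" by (simp add: Dm_Mm)
qed

section \<open>The three claims\<close>

lemma ctilde_eq: "ctilde C i j u v = qt_coeff (MM i j) u v"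
  by (simp add: ctilde_def deformed_cartan_inv_eq Mm_def)

lemma ctilde_support: "ctilde C i j u v \<noteq> 0 \<Longrightarrow> u \<ge> 1 \<and> v \<le> - 1"
  unfolding ctilde_eq by (rule MM_support)

lemma ctilde_NN:
  "qt_coeff (NN 1 i j) u v = ctilde C i j u v + ctilde C i (st j) (u + rh) (v - hh)"
  unfolding NN_MM MM_st ctilde_eq by simp

text \<open>In \<open>N' = (1 + mu P) C(q,t)^-1\<close> the second summand is evaluated at
  \<open>q\<close>-exponent \<open>u - rh \<le> 0\<close>, outside the support of the
  inverse.\<close>

lemma ctilde_box:
  assumes "u \<le> rh"
  shows "ctilde C i j u v = qt_coeff (NN 1 i j) (- u) (- v)"
proof -
  have "ctilde C i (st j) (u - rh) (v + hh) = 0"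
    using ctilde_support [of i "st j" "u - rh"] assms by fastforce
  moreover have "qt_coeff (NN 1 i j) (- u) (- v) = ctilde C i j u v + ctilde C i (st j) (u - rh) (v + hh)"
    unfolding NN_bar [symmetric] unfolding NN_MM MM_st ctilde_eq by simp
  ultimately show ?thesis by simp
qed

text \<open>The left side of \<open>ctilde_NN\<close> vanishes, because \<open>N\<close> has only
  negative powers of \<open>q\<close>.\<close>

lemma ctilde_period:
  assumes "u \<ge> 0"
  shows "ctilde C i j u v = - ctilde C i (st j) (u + rh) (v - hh)"
proof -
  have "qt_coeff (NN 1 i j) u v = 0" using NN_support [of i j u v] assms by fastforce
  then show ?thesis using ctilde_NN [of i j u v] by simp
qed

lemma ctilde_nonneg: "u \<le> rh \<Longrightarrow> ctilde C i j u v \<ge> 0"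
  by (simp add: ctilde_box NN_nonneg)

text \<open>One coefficient of \<open>N\<close> is read twice: through \<open>ctilde_box\<close>,
  and through \<open>ctilde_NN\<close>, where the first summand has \<open>q\<close>-exponent
  \<open>u - rh \<le> 0\<close> and vanishes.\<close>

lemma ctilde_reflect:
  assumes "0 \<le> u" "u \<le> rh"
  shows "ctilde C i j (rh - u) (- hh - v) = ctilde C i (st j) u v"
proof -
  have "ctilde C i j (u - rh) (v + hh) = 0"
    using ctilde_support [of i j "u - rh"] assms by fastforce
  moreover have "ctilde C i j (rh - u) (- hh - v) = qt_coeff (NN 1 i j) (u - rh) (v + hh)"
    using assms ctilde_box [of "rh - u" i j "- hh - v"] by (simp add: algebra_simps)
  ultimately show ?thesis using ctilde_NN [of i j "u - rh" "v + hh"] by simp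
qed

end

theorem corollary3p15:
  fixes C :: "int ^ 'n ^ ('n::finite)" and r h hv :: int
  assumes "simple_cartan C"
    and "r = lacing C"
    and "h = coxeter_number C"
    and "hv = dual_coxeter_number C"
  shows "\<forall>i j.
      (\<forall>u v. u \<ge> 0 \<and> v \<le> 0 \<longrightarrow>
         ctilde C i j u v = - ctilde C i (star_inv C j) (u + r * hv) (v - h)) \<and>
      (\<forall>u v. 0 \<le> u \<and> u \<le> r * hv \<and> - h \<le> v \<and> v \<le> 0 \<longrightarrow>
         ctilde C i j u v \<ge> 0) \<and>
      (\<forall>u v. 0 \<le> u \<and> u \<le> r * hv \<and> - h \<le> v \<and> v \<le> 0 \<longrightarrow>
         ctilde C i j (r * hv - u) (- h - v) = ctilde C i (star_inv C j) u v)"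
proof -
  interpret simple_cartan_matrix C by unfold_locales (fact assms(1))
  show ?thesis
    unfolding assms(2-4) 
    by (intro allI conjI impI; elim conjE) (rule ctilde_period ctilde_nonneg ctilde_reflect; assumption)+
qed

end
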